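(* (i) For every random continuous function $F$, the set of zeros $Z_F=\{y\in 2^\omega : F(y)=0^\omega\}$ is a random closed set, provided that it is non-empty. (ii) For every random closed set $C\subseteq 2^\omega$ there is a random continuous function $F$ such that $C=Z_F$.
   Context: For $n\ge 2$, $n^\omega$ carries the product topology and the uniform measure $\lambda_n$ with $\lambda_n(\llbracket\sigma\rrbracket)=n^{-|\sigma|}$, where $\llbracket\sigma\rrbracket$ is the set of sequences extending the finite string $\sigma$. A sequence $x\in n^\omega$ is Martin-Löf random if for every uniformly effectively open (uniformly $\Sigma^0_1$) sequence $(U_i)_{i\in\omega}$ of subsets of $n^\omega$ with $\lambda_n(U_i)\le 2^{-i}$ we have $x\notin\bigcap_i U_i$. Random continuous functions: let $\sigma_0=\epsilon,\sigma_1=0,\sigma_2=1,\sigma_3=00,\dots$ be the length-lexicographic enumeration of $2^{<\omega}$. For $x\in 3^\omega$ label each node $\sigma_i$ ($i\ge1$) by $\ell_x(\sigma_i)=x(i-1)$. The partial function $F_x:\subseteq 2^\omega\to 2^\omega$ is defined by letting $F_x(y)$ be the sequence obtained from $\ell_x(y\restriction 1),\ell_x(y\restriction 2),\ell_x(y\restriction 3),\dots$ by deleting all $2$'s; $F_x(y)$ is undefined if only finitely many entries remain. A function $F$ is a random continuous function if $F=F_x$ for some Martin-Löf random $x\in 3^\omega$. Random closed sets: for $x\in 3^\omega$ define a tree $T_x\subseteq 2^{<\omega}$ inductively: $\epsilon\in T_x$, and if $\sigma$ is the $(i+1)$-st node of $T_x$ (nodes being handled in length-lexicographic order), then $\sigma0\in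 T_x,\sigma1\notin T_x$ if $x(i)=0$; $\sigma0\notin T_x,\sigma1\in T_x$ if $x(i)=1$; and $\sigma0,\sigma1\in T_x$ if $x(i)=2$. A non-empty closed set $C\subseteq 2^\omega$ is a random closed set if $C=[T_x]$ (the set of infinite paths through $T_x$) for some Martin-Löf random $x\in 3^\omega$. *)

theory Defs
  imports "HOL-Probability.Probability" "HOL-Library.Nat_Bijection" "HOL-Library.Infinite_Set"
begin

datatype recf = Zf | Sf | Idf nat | Cnf recf "recf list" | Prf recf recf | Mnf recf

inductive reval :: "recf \<Rightarrow> nat list \<Rightarrow> nat \<Rightarrow> bool" where
  reval_Z: "reval Zf xs 0"
| reval_S: "reval Sf (x # xs) (Suc x)"
| reval_Id: "i < length xs \<Longrightarrow> reval (Idf i) xs (xs ! i)"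
| reval_Cn: "list_all2 (\<lambda>g y. reval g xs y) gs ys \<Longrightarrow> reval f ys z \<Longrightarrow> reval (Cnf f gs) xs z"
| reval_Pr0: "reval f xs y \<Longrightarrow> reval (Prf f g) (0 # xs) y"
| reval_PrS: "reval (Prf f g) (n # xs) y \<Longrightarrow> reval g (n # y # xs) z \<Longrightarrow> reval (Prf f g) (Suc n # xs) z"
| reval_Mn: "reval f (n # xs) 0 \<Longrightarrow> (\<forall>m<n. \<exists>y. reval f (m # xs) y \<and> y \<noteq> 0) \<Longrightarrow> reval (Mnf f) xs n"

definition ce_set :: "nat set \<Rightarrow> bool" where
  "ce_set W \<longleftrightarrow> (\<exists>f. \<forall>n. n \<in> W \<longleftrightarrow> (\<exists>v. reval f [n] v))"

text \<open>Elements of 3^omega are functions nat => nat with values below 3; finite strings are nat lists.\<close>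
definition cyl :: "nat list \<Rightarrow> (nat \<Rightarrow> nat) set" where
  "cyl \<sigma> = {x. \<forall>i<length \<sigma>. x i = \<sigma> ! i}"

definition lambda3 :: "(nat \<Rightarrow> nat) measure" where
  "lambda3 = (\<Pi>\<^sub>M i\<in>(UNIV::nat set). measure_pmf (pmf_of_set {0..<3::nat}))"

definition unif_sigma01 :: "(nat \<Rightarrow> (nat \<Rightarrow> nat) set) \<Rightarrow> bool" where
  "unif_sigma01 U \<longleftrightarrow> (\<exists>W. ce_set W \<and>
     (\<forall>i. U i = \<Union>{cyl \<sigma> | \<sigma>. set \<sigma> \<subseteq> {0..<3} \<and> prod_encode (i, list_encode \<sigma>) \<in> W}))"

definition mlof_test :: "(nat \<Rightarrow> (nat \<Rightarrow> nat) set) \<Rightarrow> bool" where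
  "mlof_test U \<longleftrightarrow> unif_sigma01 U \<and> (\<forall>i. emeasure lambda3 (U i) \<le> ennreal ((1/2) ^ i))"

definition mlof_random3 :: "(nat \<Rightarrow> nat) \<Rightarrow> bool" where
  "mlof_random3 x \<longleftrightarrow> (\<forall>i. x i < 3) \<and> (\<forall>U. mlof_test U \<longrightarrow> x \<notin> (\<Inter>i. U i))"

text \<open>Elements of 2^omega are nat => bool (True = 1); binary strings are bool lists.\<close>
definition prefix :: "(nat \<Rightarrow> bool) \<Rightarrow> nat \<Rightarrow> bool list" where
  "prefix y n = map y [0..<n]"

definition binval :: "bool list \<Rightarrow> nat" where
  "binval \<sigma> = foldl (\<lambda>a b. 2 * a + (if b then 1 else 0)) 0 \<sigma>"

text \<open>Index of a string in the length-lexicographic enumeration sigma_0 = empty, sigma_1 = 0, ...\<close>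
definition llex_index :: "bool list \<Rightarrow> nat" where
  "llex_index \<sigma> = 2 ^ length \<sigma> - 1 + binval \<sigma>"

definition label :: "(nat \<Rightarrow> nat) \<Rightarrow> bool list \<Rightarrow> nat" where
  "label x \<sigma> = x (llex_index \<sigma> - 1)"

definition Ffun :: "(nat \<Rightarrow> nat) \<Rightarrow> (nat \<Rightarrow> bool) \<Rightarrow> (nat \<Rightarrow> bool) option" where
  "Ffun x y = (let S = {k. label x (prefix y (Suc k)) \<noteq> 2} in
     if infinite S then Some (\<lambda>m. label x (prefix y (Suc (enumerate S m))) = 1) else None)"

definition random_cont_fun :: "((nat \<Rightarrow> bool) \<Rightarrow> (nat \<Rightarrow> bool) option) \<Rightarrow> bool" where
  "random_cont_fun F \<longleftrightarrow> (\<exists>x. mlof_random3 x \<and> F = Ffun x)"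

definition zeros :: "((nat \<Rightarrow> bool) \<Rightarrow> (nat \<Rightarrow> bool) option) \<Rightarrow> (nat \<Rightarrow> bool) set" where
  "zeros F = {y. F y = Some (\<lambda>_. False)}"

definition children :: "nat \<Rightarrow> bool list \<Rightarrow> bool list list" where
  "children c \<sigma> = (if c = 0 then [\<sigma> @ [False]] else if c = 1 then [\<sigma> @ [True]]
                    else [\<sigma> @ [False], \<sigma> @ [True]])"

text \<open>levels x n = (nodes of T_x of length n in lexicographic order,
  number of nodes of T_x of length < n). The node at overall (0-based) position i gets x i.\<close>
fun levels :: "(nat \<Rightarrow> nat) \<Rightarrow> nat \<Rightarrow> bool list list \<times> nat" where
  "levels x 0 = ([[]], 0)"
| "levels x (Suc n) = (let (L, off) = levels x n in
     (concat (map (\<lambda>(j, \<sigma>). children (x (off + j)) \<sigma>) (zip [0..<length L] L)), off + length L))"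

definition tree :: "(nat \<Rightarrow> nat) \<Rightarrow> bool list set" where
  "tree x = {\<sigma>. \<sigma> \<in> set (fst (levels x (length \<sigma>)))}"

definition paths :: "bool list set \<Rightarrow> (nat \<Rightarrow> bool) set" where
  "paths T = {y. \<forall>n. prefix y n \<in> T}"

definition random_closed :: "(nat \<Rightarrow> bool) set \<Rightarrow> bool" where
  "random_closed C \<longleftrightarrow> C \<noteq> {} \<and> (\<exists>x. mlof_random3 x \<and> C = paths (tree x))"

end

theory Submission
  imports Defs
begin

text \<open>
  The binary strings none of whose prefixes is labelled 1 form a Galton-Watson tree in which each child
  survives with probability 2/3. Its extinction probability is 1/4, so conditionally on survival
  each child has infinite descent with probability 1/2, and the subtree of nodes with
  infinite descent branches left, right or both ways with probability 1/3 each: exactly the law of a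
  random closed set. A random labelling has no branch that ends in 2s, hence its zeros are
  precisely the infinite branches of this subtree.

  For the effective content, couple the two random objects: from a code z and independent dice r one builds
  a labelling whose surviving tree is almost surely the tree of z, and lambda3 is 3/4 times the law of this
  labelling plus 1/4 times the law obtained from the empty tree. For (i), a test that z fails pulls back
  to a test for x, because the surviving tree up to a given level is determined by finitely many labels
  except on an event of computably small measure. For (ii), a test for labellings yields, by Markov's
  inequality, a test for z: the set of z for which many r lead into the test. Hence if z is random, almost
  every r avoids each of the countably many tests.
\<close>

subsection \<open>Recursive functions\<close>

text \<open>The extinction probability q solves q = (1/3 + 2/3 q)^2, whose root below 1 is 1/4.
  Before conditioning, a child has infinite descent with probability 2/3 * 3/4 = 1/2; the three
  non-empty patterns of surviving children thus have probability 1/4 each, that is 1/3 each given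
  survival. The obstacle is effectivity: a finite part of a labelling can refute that a node
  survives but never confirm it, so the passage from labellings to codes is not given by a
  computable map. In the opposite direction a finite part of z and r determines the corresponding
  labels, and all measures are computed in this direction. Hence (i) pays for guessing the surviving
  tree with an error set of dice, while the guess at x itself is correct from some stage on, without
  any rate. In (ii) one would like r to be random relative to z; instead of relative randomness, the
  countability of the set of tests is used. No conditional measure is formed: the law of the mixture
  is compared with \<open>lambda3\<close> on cylinders, where the claim is an identity between
  finite products.\<close>

lemma reval_Z_iff: "reval Zf xs v \<longleftrightarrow> v = 0"
  by (subst reval.simps) auto

lemma reval_S_iff: "reval Sf (x # xs) v \<longleftrightarrow> v = Suc x"
  by (subst reval.simps) auto

lemma reval_Id_iff: "i < length xs \<Longrightarrow> reval (Idf i) xs v \<longleftrightarrow> v = xs ! i"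
  by (subst reval.simps) auto

lemma reval_Cn_iff:
  "reval (Cnf f gs) xs z \<longleftrightarrow> (\<exists>ys. list_all2 (\<lambda>g y. reval g xs y) gs ys \<and> reval f ys z)"
  by (subst reval.simps) auto

lemma reval_Pr_0_iff: "reval (Prf f g) (0 # xs) z \<longleftrightarrow> reval f xs z"
  by (subst reval.simps) auto

lemma reval_Pr_Suc_iff:
  "reval (Prf f g) (Suc n # xs) z \<longleftrightarrow> (\<exists>y. reval (Prf f g) (n # xs) y \<and> reval g (n # y # xs) z)"
  by (subst reval.simps) auto

lemma reval_Mn_iff:
  "reval (Mnf f) xs n \<longleftrightarrow> reval f (n # xs) 0 \<and> (\<forall>m<n. \<exists>y. reval f (m # xs) y \<and> y \<noteq> 0)"
  by (subst reval.simps) auto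

text \<open>The equivalence demands existence and uniqueness of the value at once. Only lists of
  length n count, so \<open>hd\<close>, \<open>tl\<close> and \<open>!\<close> can serve as
  variables without regard to their values on other lists.\<close>

definition computes :: "nat \<Rightarrow> recf \<Rightarrow> (nat list \<Rightarrow> nat) \<Rightarrow> bool" where
  "computes n e f \<longleftrightarrow> (\<forall>xs v. length xs = n \<longrightarrow> (reval e xs v \<longleftrightarrow> v = f xs))"

definition comp :: "nat \<Rightarrow> (nat list \<Rightarrow> nat) \<Rightarrow> bool" where
  "comp n f \<longleftrightarrow> (\<exists>e. computes n e f)"

definition dec :: "nat \<Rightarrow> (nat list \<Rightarrow> bool) \<Rightarrow> bool" where
  "dec n P \<longleftrightarrow> comp n (\<lambda>xs. of_bool (P xs))"

lemma computesD: "computes n e f \<Longrightarrow> length xs = n \<Longrightarrow> reval e xs v \<longleftrightarrow> v = f xs"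
  by (simp add: computes_def)

lemma comp_cong: "comp n f \<Longrightarrow> (\<And>xs. length xs = n \<Longrightarrow> f xs = g xs) \<Longrightarrow> comp n g"
  by (simp add: comp_def computes_def)

lemma dec_cong: "dec n P \<Longrightarrow> (\<And>xs. length xs = n \<Longrightarrow> P xs \<longleftrightarrow> Q xs) \<Longrightarrow> dec n Q"
  unfolding dec_def by (erule comp_cong) simp

lemma list_all2_computes:
  assumes "list_all2 (computes n) es fs" "length xs = n"
  shows "list_all2 (\<lambda>g y. reval g xs y) es ys \<longleftrightarrow> ys = map (\<lambda>f. f xs) fs"
  using assms(1)
proof (induction es fs arbitrary: ys rule: list_all2_induct)
  case (Cons e es f fs)
  then show ?case using assms(2)
    by (cases ys) (auto simp: computesD)
qed simp

lemma computes_Cn: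
  assumes "computes (length fs) e h" "list_all2 (computes n) es fs"
  shows "computes n (Cnf e es) (\<lambda>xs. h (map (\<lambda>f. f xs) fs))"
  using assms by (auto simp: computes_def reval_Cn_iff list_all2_computes)

lemma comp_list:
  assumes "\<And>f. f \<in> set fs \<Longrightarrow> comp n f"
  obtains es where "list_all2 (computes n) es fs"
proof -
  have "\<exists>es. list_all2 (computes n) es fs" using assms
  proof (induction fs)
    case (Cons f fs)
    then show ?case by (auto simp: comp_def list_all2_Cons2)
  qed auto
  then show thesis using that by auto
qed

lemma comp_compose:
  assumes "comp (length fs) h" "\<And>f. f \<in> set fs \<Longrightarrow> comp n f"
  shows "comp n (\<lambda>xs. h (map (\<lambda>f. f xs) fs))"
  using assms comp_list[of fs n] computes_Cn unfolding comp_def by metis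

lemma computes_nth: "i < n \<Longrightarrow> computes n (Idf i) (\<lambda>xs. xs ! i)"
  by (simp add: computes_def reval_Id_iff)

lemma comp_nth: "i < n \<Longrightarrow> comp n (\<lambda>xs. xs ! i)"
  using computes_nth comp_def by blast

lemma comp_hd: "comp (Suc n) hd"
  by (rule comp_cong[OF comp_nth[of 0]]) (auto simp: hd_conv_nth length_Suc_conv)

text \<open>Weakening. Variables are positional: a newly bound variable is put in front, and terms
  of the old context see the tail. Stating all closure rules in this
  \<open>hd\<close>/\<open>tl\<close> form makes later computability proofs syntax-directed, by
  \<open>intro\<close>.\<close>

lemma comp_tl: "comp n f \<Longrightarrow> comp (Suc n) (\<lambda>xs. f (tl xs))"
proof -
  assume f: "comp n f"
  let ?fs = "map (\<lambda>i xs. xs ! Suc i) [0..<n] :: (nat list \<Rightarrow> nat) list"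
  have "comp (Suc n) (\<lambda>xs. f (map (\<lambda>g. g xs) ?fs))"
    by (rule comp_compose) (use f in \<open>auto intro!: comp_nth\<close>)
  then show ?thesis
    by (rule comp_cong)
       (auto simp: length_Suc_conv comp_def intro!: arg_cong[of _ _ f] nth_equalityI)
qed

lemma comp_Cons:
  assumes "comp (Suc n) (\<lambda>ys. F (hd ys) (tl ys))" "comp n b"
  shows "comp n (\<lambda>xs. F (b xs) xs)"
proof -
  let ?fs = "b # map (\<lambda>i xs. xs ! i) [0..<n]"
  have "comp n (\<lambda>xs. F (hd (map (\<lambda>f. f xs) ?fs)) (tl (map (\<lambda>f. f xs) ?fs)))"
    by (rule comp_compose[where fs = ?fs and h = "\<lambda>ys. F (hd ys) (tl ys)"])
      (use assms in \<open>auto intro: comp_nth\<close>)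
  then show ?thesis
    by (rule comp_cong) (auto simp: o_def map_nth)
qed

lemma comp_comp1:
  assumes "comp 1 (\<lambda>ys. F (hd ys))" "comp n a"
  shows "comp n (\<lambda>xs. F (a xs))"
  using comp_compose[of "[a]" "\<lambda>ys. F (hd ys)" n] assms by simp

lemma comp_const: "comp n (\<lambda>_. c)"
proof (induction c)
  case 0
  show ?case unfolding comp_def computes_def by (rule exI[of _ Zf]) (simp add: reval_Z_iff)
next
  case (Suc c)
  have "comp 1 (\<lambda>ys. Suc (hd ys))"
    unfolding comp_def computes_def
    by (rule exI[of _ Sf]) (auto simp: length_Suc_conv reval_S_iff)
  from comp_comp1[OF this Suc] show ?case .
qed

lemma comp_Suc: "comp n a \<Longrightarrow> comp n (\<lambda>xs. Suc (a xs))"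
proof (rule comp_comp1[where F = Suc])
  show "comp 1 (\<lambda>ys. Suc (hd ys))"
    unfolding comp_def computes_def
    by (rule exI[of _ Sf]) (auto simp: length_Suc_conv reval_S_iff)
qed

lemma comp_rec:
  assumes "comp n a" "comp (Suc (Suc n)) (\<lambda>ys. G (hd ys) (hd (tl ys)) (tl (tl ys)))" "comp n b"
  shows "comp n (\<lambda>xs. rec_nat (a xs) (\<lambda>i v. G i v xs) (b xs))"
proof -
  obtain ea where ea: "computes n ea a" using assms(1) by (auto simp: comp_def)
  obtain eg where eg: "computes (Suc (Suc n)) eg (\<lambda>ys. G (hd ys) (hd (tl ys)) (tl (tl ys)))"
    using assms(2) by (auto simp: comp_def)
  have *: "reval (Prf ea eg) (m # xs) v \<longleftrightarrow> v = rec_nat (a xs) (\<lambda>i v. G i v xs) m"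
    if "length xs = n" for xs m v
    using that
    by (induction m arbitrary: v)
       (auto simp: reval_Pr_0_iff reval_Pr_Suc_iff computesD[OF ea] computesD[OF eg])
  have "comp (Suc n) (\<lambda>ys. rec_nat (a (tl ys)) (\<lambda>i v. G i v (tl ys)) (hd ys))"
    unfolding comp_def computes_def
    by (rule exI[of _ "Prf ea eg"]) (auto simp: length_Suc_conv *)
  from comp_Cons[OF this assms(3)] show ?thesis .
qed

lemma comp_pred: "comp n a \<Longrightarrow> comp n (\<lambda>xs. a xs - 1)"
proof -
  assume a: "comp n a"
  have "comp n (\<lambda>xs. rec_nat 0 (\<lambda>i v. i) (a xs))"
    by (rule comp_rec[where a = "\<lambda>_. 0" and G = "\<lambda>i v xs. i"]) (auto intro: comp_const comp_hd a)
  then show ?thesis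
  proof (rule comp_cong)
    fix xs show "rec_nat 0 (\<lambda>i v. i) (a xs) = a xs - 1" by (cases "a xs") auto
  qed
qed

lemma comp_add: "comp n a \<Longrightarrow> comp n b \<Longrightarrow> comp n (\<lambda>xs. a xs + b xs)"
proof -
  assume ab: "comp n a" "comp n b"
  have "comp n (\<lambda>xs. rec_nat (a xs) (\<lambda>i v. Suc v) (b xs))"
    by (rule comp_rec[where G = "\<lambda>i v xs. Suc v"]) (intro comp_Suc comp_tl comp_hd ab)+
  then show ?thesis
  proof (rule comp_cong)
    fix xs
    have "rec_nat (a xs) (\<lambda>i v. Suc v) m = a xs + m" for m by (induction m) auto
    then show "rec_nat (a xs) (\<lambda>i v. Suc v) (b xs) = a xs + b xs" by simp
  qed
qed

lemma comp_diff: "comp n a \<Longrightarrow> comp n b \<Longrightarrow> comp n (\<lambda>xs. a xs - b xs)"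
proof -
  assume ab: "comp n a" "comp n b"
  have "comp n (\<lambda>xs. rec_nat (a xs) (\<lambda>i v. v - 1) (b xs))"
    by (rule comp_rec[where G = "\<lambda>i v xs. v - 1"]) (intro comp_pred comp_tl comp_hd ab)+
  then show ?thesis
  proof (rule comp_cong)
    fix xs
    have "rec_nat (a xs) (\<lambda>i v. v - 1) m = a xs - m" for m by (induction m) auto
    then show "rec_nat (a xs) (\<lambda>i v. v - 1) (b xs) = a xs - b xs" by simp
  qed
qed

lemma comp_mult: "comp n a \<Longrightarrow> comp n b \<Longrightarrow> comp n (\<lambda>xs. a xs * b xs)"
proof -
  assume ab: "comp n a" "comp n b"
  have "comp n (\<lambda>xs. rec_nat 0 (\<lambda>i v. v + a xs) (b xs))"
    by (rule comp_rec[where G = "\<lambda>i v xs. v + a xs"])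
       (intro comp_add comp_const comp_tl comp_hd ab)+
  then show ?thesis
  proof (rule comp_cong)
    fix xs
    have "rec_nat 0 (\<lambda>i v. v + a xs) m = a xs * m" for m by (induction m) auto
    then show "rec_nat 0 (\<lambda>i v. v + a xs) (b xs) = a xs * b xs" by simp
  qed
qed

lemma comp_power: "comp n a \<Longrightarrow> comp n b \<Longrightarrow> comp n (\<lambda>xs. a xs ^ b xs)"
proof -
  assume ab: "comp n a" "comp n b"
  have "comp n (\<lambda>xs. rec_nat 1 (\<lambda>i v. v * a xs) (b xs))"
    by (rule comp_rec[where G = "\<lambda>i v xs. v * a xs"])
       (intro comp_mult comp_const comp_tl comp_hd ab)+
  then show ?thesis
  proof (rule comp_cong)
    fix xs
    have "rec_nat 1 (\<lambda>i v. v * a xs) m = a xs ^ m" for m by (induction m) auto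
    then show "rec_nat 1 (\<lambda>i v. v * a xs) (b xs) = a xs ^ b xs" by simp
  qed
qed

lemma comp_sum:
  assumes "comp (Suc n) (\<lambda>ys. F (hd ys) (tl ys))" "comp n b"
  shows "comp n (\<lambda>xs. \<Sum>i<b xs. F i xs)"
proof -
  \<comment> \<open>In the recursion step the accumulator stands between the index and the context,
    so \<open>F\<close> has to skip position 1.\<close>
  have F': "comp (Suc (Suc n)) (\<lambda>ys. F (hd ys) (tl (tl ys)))"
  proof -
    let ?fs = "hd # map (\<lambda>i xs. xs ! Suc (Suc i)) [0..<n] :: (nat list \<Rightarrow> nat) list"
    have "comp (Suc (Suc n)) (\<lambda>xs. F (hd (map (\<lambda>f. f xs) ?fs)) (tl (map (\<lambda>f. f xs) ?fs)))"
      by (rule comp_compose[where fs = ?fs and h = "\<lambda>ys. F (hd ys) (tl ys)"])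
        (use assms in \<open>auto intro: comp_nth comp_hd\<close>)
    then show ?thesis
      by (rule comp_cong) (auto simp: length_Suc_conv intro!: arg_cong[of _ _ "F _"] nth_equalityI)
  qed
  have "comp n (\<lambda>xs. rec_nat 0 (\<lambda>i v. v + F i xs) (b xs))"
    by (rule comp_rec[where G = "\<lambda>i v xs. v + F i xs"])
       (intro comp_add comp_const comp_tl[OF comp_hd] F' assms(2))+
  then show ?thesis
  proof (rule comp_cong)
    fix xs
    have "rec_nat 0 (\<lambda>i v. v + F i xs) m = (\<Sum>i<m. F i xs)" for m by (induction m) auto
    then show "rec_nat 0 (\<lambda>i v. v + F i xs) (b xs) = (\<Sum>i<b xs. F i xs)" by simp
  qed
qed

section \<open>Decidable predicates as computable functions with values 0 and 1\<close>

lemma comp_of_bool: "dec n P \<Longrightarrow> comp n (\<lambda>xs. of_bool (P xs))"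
  by (simp add: dec_def)

lemma dec_le: "comp n a \<Longrightarrow> comp n b \<Longrightarrow> dec n (\<lambda>xs. a xs \<le> b xs)"
proof -
  assume ab: "comp n a" "comp n b"
  have "comp n (\<lambda>xs. 1 - (a xs - b xs))" by (intro comp_diff comp_const ab)
  then show ?thesis unfolding dec_def by (rule comp_cong) auto
qed

lemma dec_not: "dec n P \<Longrightarrow> dec n (\<lambda>xs. \<not> P xs)"
proof -
  assume "dec n P"
  then have "comp n (\<lambda>xs. 1 - of_bool (P xs))" by (intro comp_diff comp_const comp_of_bool)
  then show ?thesis unfolding dec_def by (rule comp_cong) auto
qed

lemma dec_conj: "dec n P \<Longrightarrow> dec n Q \<Longrightarrow> dec n (\<lambda>xs. P xs \<and> Q xs)"
proof -
  assume "dec n P" "dec n Q"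
  then have "comp n (\<lambda>xs. of_bool (P xs) * of_bool (Q xs))" by (intro comp_mult comp_of_bool)
  then show ?thesis unfolding dec_def by (rule comp_cong) auto
qed

lemma dec_disj: "dec n P \<Longrightarrow> dec n Q \<Longrightarrow> dec n (\<lambda>xs. P xs \<or> Q xs)"
  by (rule dec_cong[of n "\<lambda>xs. \<not> (\<not> P xs \<and> \<not> Q xs)"], intro dec_not dec_conj) simp_all

lemma dec_imp: "dec n P \<Longrightarrow> dec n Q \<Longrightarrow> dec n (\<lambda>xs. P xs \<longrightarrow> Q xs)"
  by (rule dec_cong[of n "\<lambda>xs. \<not> (P xs \<and> \<not> Q xs)"], intro dec_not dec_conj) simp_all

lemma dec_iff: "dec n P \<Longrightarrow> dec n Q \<Longrightarrow> dec n (\<lambda>xs. P xs \<longleftrightarrow> Q xs)"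
  by (rule dec_cong[of n "\<lambda>xs. (P xs \<longrightarrow> Q xs) \<and> (Q xs \<longrightarrow> P xs)"], intro dec_imp dec_conj) auto

lemma dec_less: "comp n a \<Longrightarrow> comp n b \<Longrightarrow> dec n (\<lambda>xs. a xs < b xs)"
  by (rule dec_cong[of n "\<lambda>xs. \<not> b xs \<le> a xs"]) (auto intro: dec_not dec_le)

lemma dec_eq: "comp n a \<Longrightarrow> comp n b \<Longrightarrow> dec n (\<lambda>xs. a xs = b xs)"
  by (rule dec_cong[of n "\<lambda>xs. a xs \<le> b xs \<and> b xs \<le> a xs"]) (auto intro: dec_conj dec_le)

lemma dec_ex:
  assumes "dec (Suc n) (\<lambda>ys. P (hd ys) (tl ys))" "comp n b"
  shows "dec n (\<lambda>xs. \<exists>i<b xs. P i xs)"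
proof -
  have "dec n (\<lambda>xs. (1::nat) \<le> (\<Sum>i<b xs. of_bool (P i xs)))"
  proof (rule dec_le[OF comp_const])
    show "comp n (\<lambda>xs. \<Sum>i<b xs. of_bool (P i xs))"
      by (rule comp_sum[where F = "\<lambda>i xs. of_bool (P i xs)"]) (intro comp_of_bool assms)+
  qed
  then show ?thesis
    by (rule dec_cong) (auto simp: Suc_le_eq sum_pos2 simp flip: neq0_conv)
qed

lemma dec_all:
  assumes "dec (Suc n) (\<lambda>ys. P (hd ys) (tl ys))" "comp n b"
  shows "dec n (\<lambda>xs. \<forall>i<b xs. P i xs)"
  by (rule dec_cong[of n "\<lambda>xs. \<not> (\<exists>i<b xs. \<not> P i xs)"])
     (rule dec_not, rule dec_ex[where P = "\<lambda>i xs. \<not> P i xs"], auto intro: dec_not assms)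

lemma comp_if: "dec n P \<Longrightarrow> comp n a \<Longrightarrow> comp n b \<Longrightarrow> comp n (\<lambda>xs. if P xs then a xs else b xs)"
proof -
  assume *: "dec n P" "comp n a" "comp n b"
  have "comp n (\<lambda>xs. of_bool (P xs) * a xs + of_bool (\<not> P xs) * b xs)"
    by (intro comp_add comp_mult comp_of_bool dec_not *)
  then show ?thesis by (rule comp_cong) auto
qed

lemma comp_div: "comp n a \<Longrightarrow> comp n b \<Longrightarrow> comp n (\<lambda>xs. a xs div b xs)"
proof -
  assume ab: "comp n a" "comp n b"
  \<comment> \<open>A quotient a div b counts the k < a with (k + 1) * b <= a. The factor in front
    covers b = 0, where the quotient is 0 by convention.\<close>
  have "comp n (\<lambda>xs. of_bool (0 < b xs) * (\<Sum>k<a xs. of_bool (Suc k * b xs \<le> a xs)))"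
    by (intro comp_mult comp_of_bool dec_less comp_const comp_sum dec_le comp_Suc comp_hd comp_tl ab)
  then show ?thesis
  proof (rule comp_cong)
    fix xs
    have "{k. k < a xs \<and> Suc k * b xs \<le> a xs} = {..<a xs div b xs}" if "0 < b xs"
    proof -
      have "k < a xs" if "Suc k * b xs \<le> a xs" for k
        using that \<open>0 < b xs\<close> by (metis Suc_le_lessD le_trans mult_le_mono2 nat_mult_1_right Suc_leI One_nat_def)
      then show ?thesis using that by (auto simp: less_eq_div_iff_mult_less_eq Suc_le_eq[symmetric])
    qed
    then show "of_bool (0 < b xs) * (\<Sum>k<a xs. of_bool (Suc k * b xs \<le> a xs)) = a xs div b xs"
      by (cases "b xs = 0") (auto simp: of_bool_def sum.If_cases Int_def)
  qed
qed

lemma comp_mod: "comp n a \<Longrightarrow> comp n b \<Longrightarrow> comp n (\<lambda>xs. a xs mod b xs)"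
  by (rule comp_cong[of n "\<lambda>xs. a xs - b xs * (a xs div b xs)"])
     (rule comp_diff comp_mult comp_div | assumption | simp add: minus_mult_div_eq_mod)+

lemmas comp_basic =
  comp_add comp_diff comp_mult comp_power comp_div comp_mod comp_Suc comp_if comp_of_bool
  dec_le dec_less dec_eq dec_not dec_conj dec_disj dec_imp dec_iff

subsection \<open>Codes of pairs, lists and finite sets\<close>

abbreviation pfst :: "nat \<Rightarrow> nat" where "pfst c \<equiv> fst (prod_decode c)"
abbreviation psnd :: "nat \<Rightarrow> nat" where "psnd c \<equiv> snd (prod_decode c)"

lemma comp_prod_encode: "comp n a \<Longrightarrow> comp n b \<Longrightarrow> comp n (\<lambda>xs. prod_encode (a xs, b xs))"
proof -
  assume ab: "comp n a" "comp n b"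
  have "comp n (\<lambda>xs. (a xs + b xs) * Suc (a xs + b xs) div 2 + a xs)"
    by (intro comp_basic comp_const ab)
  then show ?thesis by (rule comp_cong) (simp add: prod_encode_def triangle_def)
qed

lemma pfst_le: "pfst c \<le> c" and psnd_le: "psnd c \<le> c"
  using le_prod_encode_1[of "pfst c" "psnd c"] le_prod_encode_2[of "psnd c" "pfst c"] by auto

lemma prod_encode_iff: "prod_encode (u, v) = c \<longleftrightarrow> u = pfst c \<and> v = psnd c"
  by (metis fst_conv prod.collapse prod_decode_inverse prod_encode_inverse snd_conv)

text \<open>Brute force: both components are bounded by the code and exactly one pair has this code,
  so the double sum has a single non-zero term at most.\<close>

lemma comp_pfst: "comp n a \<Longrightarrow> comp n (\<lambda>xs. pfst (a xs))"
proof -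
  assume a: "comp n a"
  have "comp n (\<lambda>xs. \<Sum>u<Suc (a xs). \<Sum>v<Suc (a xs). u * of_bool (prod_encode (u, v) = a xs))"
    by (intro comp_sum comp_basic comp_prod_encode comp_hd comp_tl a)
  then show ?thesis
  proof (rule comp_cong)
    fix xs
    have "(\<Sum>u<Suc (a xs). \<Sum>v<Suc (a xs). u * of_bool (prod_encode (u, v) = a xs)) =
        (\<Sum>u<Suc (a xs). \<Sum>v<Suc (a xs). if v = psnd (a xs) then (if u = pfst (a xs) then u else 0) else 0)"
      by (intro sum.cong refl) (simp add: prod_encode_iff)
    also have "\<dots> = pfst (a xs)"
      using pfst_le[of "a xs"] psnd_le[of "a xs"] by (simp add: less_Suc_eq_le del: sum.lessThan_Suc)
    finally show "(\<Sum>u<Suc (a xs). \<Sum>v<Suc (a xs). u * of_bool (prod_encode (u, v) = a xs)) = pfst (a xs)" .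
  qed
qed

lemma comp_psnd: "comp n a \<Longrightarrow> comp n (\<lambda>xs. psnd (a xs))"
proof -
  assume a: "comp n a"
  have "comp n (\<lambda>xs. \<Sum>u<Suc (a xs). \<Sum>v<Suc (a xs). v * of_bool (prod_encode (u, v) = a xs))"
    by (intro comp_sum comp_basic comp_prod_encode comp_hd comp_tl a)
  then show ?thesis
  proof (rule comp_cong)
    fix xs
    have "(\<Sum>u<Suc (a xs). \<Sum>v<Suc (a xs). v * of_bool (prod_encode (u, v) = a xs)) =
        (\<Sum>u<Suc (a xs). \<Sum>v<Suc (a xs). if v = psnd (a xs) then (if u = pfst (a xs) then v else 0) else 0)"
      by (intro sum.cong refl) (simp add: prod_encode_iff)
    also have "\<dots> = psnd (a xs)"
      using pfst_le[of "a xs"] psnd_le[of "a xs"] by (simp add: less_Suc_eq_le del: sum.lessThan_Suc)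
    finally show "(\<Sum>u<Suc (a xs). \<Sum>v<Suc (a xs). v * of_bool (prod_encode (u, v) = a xs)) = psnd (a xs)" .
  qed
qed

text \<open>A non-empty list is coded by the successor of the pair of its head and the code of its
  tail, and \<open>[]\<close> by 0. Because 0 decodes to (0, 0), the tail of the empty list stays 0,
  and \<open>lnth\<close> is 0 beyond the end.\<close>

definition ltail :: "nat \<Rightarrow> nat \<Rightarrow> nat" where
  "ltail c k = rec_nat c (\<lambda>_ v. psnd (v - 1)) k"

definition lnth :: "nat \<Rightarrow> nat \<Rightarrow> nat" where
  "lnth c k = pfst (ltail c k - 1)"

definition llen :: "nat \<Rightarrow> nat" where
  "llen c = length (list_decode c)"

lemma prod_decode_0: "prod_decode 0 = (0, 0)"
  by (simp add: prod_decode_def prod_decode_aux.simps)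

lemma ltail_drop: "ltail c k = list_encode (drop k (list_decode c))"
proof (induction k)
  case (Suc k)
  have "ltail c (Suc k) = psnd (list_encode (drop k (list_decode c)) - 1)"
    using Suc by (simp add: ltail_def)
  also have "\<dots> = list_encode (tl (drop k (list_decode c)))"
    by (cases "drop k (list_decode c)") (auto simp: prod_decode_0)
  finally show ?case by (simp add: drop_Suc tl_drop)
qed (simp add: ltail_def)

lemma lnth_eq: "k < llen c \<Longrightarrow> lnth c k = list_decode c ! k"
  using Cons_nth_drop_Suc[of k "list_decode c", symmetric] by (simp add: lnth_def ltail_drop llen_def)

lemma list_encode_length: "length xs \<le> list_encode xs"
proof (induction xs)
  case (Cons x xs)
  then show ?case using le_prod_encode_2[of "list_encode xs" x] by simp
qed simp

lemma list_encode_member: "x \<in> set xs \<Longrightarrow> x < list_encode xs"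
proof (induction xs)
  case (Cons y xs)
  then show ?case using le_prod_encode_2[of "list_encode xs" y] le_prod_encode_1[of y "list_encode xs"]
    by auto
qed simp

lemma llen_le: "llen c \<le> c"
  using list_encode_length[of "list_decode c"] by (simp add: llen_def)

lemma llen_sum: "llen c = (\<Sum>k<c. of_bool (ltail c k \<noteq> 0))"
proof -
  have "list_encode xs = 0 \<longleftrightarrow> xs = []" for xs by (cases xs) auto
  then have "(ltail c k \<noteq> 0) = (k < llen c)" for k by (simp add: ltail_drop llen_def not_le)
  moreover have "{k. k < c \<and> k < llen c} = {..<llen c}" using llen_le[of c] by auto
  ultimately show ?thesis by (simp add: of_bool_def sum.If_cases Int_def)
qed

lemma comp_ltail: "comp n a \<Longrightarrow> comp n b \<Longrightarrow> comp n (\<lambda>xs. ltail (a xs) (b xs))"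
  unfolding ltail_def
  by (rule comp_rec[where G = "\<lambda>i v xs. psnd (v - 1)"])
     (intro comp_psnd comp_pred comp_tl comp_hd | assumption)+

lemma comp_lnth: "comp n a \<Longrightarrow> comp n b \<Longrightarrow> comp n (\<lambda>xs. lnth (a xs) (b xs))"
  unfolding lnth_def by (intro comp_pfst comp_pred comp_ltail)

lemma comp_llen: "comp n a \<Longrightarrow> comp n (\<lambda>xs. llen (a xs))"
  unfolding llen_sum by (intro comp_sum comp_of_bool dec_not dec_eq comp_const comp_ltail comp_hd comp_tl)

lemma dec_set_decode: "comp n a \<Longrightarrow> comp n b \<Longrightarrow> dec n (\<lambda>xs. a xs \<in> set_decode (b xs))"
proof -
  assume ab: "comp n a" "comp n b"
  have "dec n (\<lambda>xs. b xs div 2 ^ a xs mod 2 = 1)"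
    by (intro dec_eq comp_mod comp_div comp_power comp_const ab)
  then show ?thesis by (rule dec_cong) (simp add: set_decode_def odd_iff_mod_2_eq_one)
qed

lemmas comp_codes = comp_prod_encode comp_pfst comp_psnd comp_lnth comp_llen dec_set_decode

subsection \<open>Enumerable sets and tests\<close>

text \<open>Composition is strict: it halts only if every argument does. So conjunctions of halting
  conditions are again halting conditions, and a bounded conjunction is a primitive recursion over
  its index.\<close>

lemma ce_set_bounded_all:
  assumes "ce_set W" "dec 1 (\<lambda>xs. D (hd xs))" "comp 1 (\<lambda>xs. len (hd xs))"
    "comp 2 (\<lambda>xs. g (hd xs) (hd (tl xs)))"
  shows "ce_set {n. D n \<and> (\<forall>l<len n. g l n \<in> W)}"
proof -
  obtain fW where fW: "n \<in> W \<longleftrightarrow> (\<exists>v. reval fW [n] v)" for n using assms(1) by (auto simp: ce_set_def)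
  obtain el where el: "computes 1 el (\<lambda>xs. len (hd xs))" using assms(3) by (auto simp: comp_def)
  obtain eg where eg: "computes 2 eg (\<lambda>xs. g (hd xs) (hd (tl xs)))" using assms(4) by (auto simp: comp_def)
  have "comp 2 (\<lambda>xs. 1 - of_bool (D (hd (tl xs))))"
    using comp_tl[OF comp_of_bool[OF assms(2)]]
    by (intro comp_diff comp_const) (simp add: numeral_2_eq_2)
  then obtain ed where ed: "computes 2 ed (\<lambda>xs. 1 - of_bool (D (hd (tl xs))))" by (auto simp: comp_def)
  \<comment> \<open>\<open>ed\<close> ignores the variable being minimised, so the search stops at
    once if \<open>D n\<close> holds and never stops otherwise.\<close>
  have guard: "(\<exists>v. reval (Mnf ed) [n] v) \<longleftrightarrow> D n" for n
  proof
    assume "\<exists>v. reval (Mnf ed) [n] v"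
    then obtain v where "reval ed [v, n] 0" by (auto simp: reval_Mn_iff)
    then show "D n" using computesD[OF ed, of "[v, n]" 0] by (auto simp: of_bool_def split: if_splits)
  next
    assume "D n"
    then have "reval (Mnf ed) [n] 0" using computesD[OF ed, of "[0, n]" 0] by (auto simp: reval_Mn_iff)
    then show "\<exists>v. reval (Mnf ed) [n] v" by blast
  qed
  \<comment> \<open>The value of \<open>fW\<close> is discarded by \<open>Zf\<close>; only its
    halting matters. Position 1 is the previous result of the loop.\<close>
  define step where "step = Cnf Zf [Cnf fW [Cnf eg [Idf 0, Idf 2]]]"
  have step: "reval step [m, y, n] v \<longleftrightarrow> v = 0 \<and> g m n \<in> W" for m y n v
    using computesD[OF eg, of "[m, n]"]
    by (auto simp: step_def reval_Cn_iff list_all2_Cons1 reval_Z_iff reval_Id_iff fW)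
  define loop where "loop = Prf Zf step"
  have loop: "reval loop [m, n] v \<longleftrightarrow> v = 0 \<and> (\<forall>l<m. g l n \<in> W)" for m n v
    by (induction m arbitrary: v)
       (auto simp: loop_def reval_Pr_0_iff reval_Z_iff reval_Pr_Suc_iff step less_Suc_eq)
  have "(\<exists>v. reval (Cnf Zf [Cnf loop [el, Idf 0], Mnf ed]) [n] v) \<longleftrightarrow> D n \<and> (\<forall>l<len n. g l n \<in> W)" for n
    using computesD[OF el, of "[n]"] guard[of n]
    by (auto simp: reval_Cn_iff list_all2_Cons1 reval_Z_iff reval_Id_iff loop)
  then show ?thesis unfolding ce_set_def by auto
qed

lemma ce_set_vimage:
  assumes "ce_set W" "dec 1 (\<lambda>xs. D (hd xs))" "comp 1 (\<lambda>xs. g (hd xs))"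
  shows "ce_set {n. D n \<and> g n \<in> W}"
proof -
  have "ce_set {n. D n \<and> (\<forall>l<1::nat. g n \<in> W)}"
    using comp_tl[OF assms(3)]
    by (intro ce_set_bounded_all[where g = "\<lambda>l n. g n" and len = "\<lambda>_. 1"] comp_const assms(1,2)) (simp add: numeral_2_eq_2)
  then show ?thesis by (auto simp: less_Suc_eq intro: back_subst[of ce_set])
qed

lemma ce_set_dec:
  assumes "dec 1 (\<lambda>xs. D (hd xs))"
  shows "ce_set {n. D n}"
proof -
  have "ce_set UNIV" unfolding ce_set_def by (rule exI[of _ Zf]) (auto simp: reval_Z_iff)
  from ce_set_vimage[OF this assms, of "\<lambda>_. 0"] show ?thesis by (simp add: comp_const)
qed

instance recf :: countable
  by countable_datatype

lemma countable_ce_sets: "countable {W. ce_set W}"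
proof -
  have "{W. ce_set W} \<subseteq> range (\<lambda>f. {n. \<exists>v. reval f [n] v})"
    by (auto simp: ce_set_def)
  then show ?thesis by (rule countable_subset) simp
qed

definition string_union :: "nat set \<Rightarrow> nat \<Rightarrow> (nat \<Rightarrow> nat) set" where
  "string_union W i = \<Union>{cyl \<sigma> |\<sigma>. set \<sigma> \<subseteq> {0..<3} \<and> prod_encode (i, list_encode \<sigma>) \<in> W}"

lemma unif_sigma01_iff: "unif_sigma01 U \<longleftrightarrow> (\<exists>W. ce_set W \<and> U = string_union W)"
  by (auto simp: unif_sigma01_def string_union_def fun_eq_iff)

lemma in_string_union:
  "x \<in> string_union W i \<longleftrightarrow>
    (\<exists>c. set (list_decode c) \<subseteq> {0..<3} \<and> prod_encode (i, c) \<in> W \<and> x \<in> cyl (list_decode c))"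
  unfolding string_union_def
  by auto (metis list_encode_inverse, metis list_decode_inverse)

lemma mlof_random3_string_union:
  assumes "mlof_random3 x" "ce_set W"
    "\<And>i. emeasure lambda3 (string_union W i) \<le> ennreal ((1/2) ^ i)"
  shows "\<exists>i. x \<notin> string_union W i"
proof -
  have "mlof_test (string_union W)"
    using assms by (auto simp: mlof_test_def unif_sigma01_iff)
  then show ?thesis using assms(1) by (auto simp: mlof_random3_def)
qed

subsection \<open>Heap indices of binary strings\<close>

text \<open>
  Strings are numbered like the nodes of a heap: the root is 1 and the children of h are 2h and 2h+1.
  This is one more than the length-lexicographic index, and the root has no label, so the label of node
  h is x (h - 2).
\<close>

definition hidx :: "bool list \<Rightarrow> nat" where
  "hidx \<sigma> = 2 ^ length \<sigma> + binval \<sigma>"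

lemma hidx_Nil [simp]: "hidx [] = 1"
  by (simp add: hidx_def binval_def)

lemma hidx_snoc [simp]: "hidx (\<sigma> @ [b]) = 2 * hidx \<sigma> + of_bool b"
  by (simp add: hidx_def binval_def)

lemma hidx_bounds: "2 ^ length \<sigma> \<le> hidx \<sigma> \<and> hidx \<sigma> < 2 ^ Suc (length \<sigma>)"
proof (induction \<sigma> rule: rev_induct)
  case (snoc b \<sigma>)
  then show ?case by (cases b) auto
qed simp

lemma hidx_pos [simp]: "0 < hidx \<sigma>"
  using hidx_bounds[of \<sigma>] less_le_trans[of 0 "2 ^ length \<sigma>"] by auto

lemma hidx_nonzero [simp]: "hidx \<sigma> \<noteq> 0"
  using hidx_pos[of \<sigma>] by simp

lemma pow2_less_iff: "(2::nat) ^ a < 2 ^ b \<longleftrightarrow> a < b"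
  by (rule power_strict_increasing_iff) simp

lemma pow2_interval_unique:
  assumes "2 ^ m \<le> (d::nat)" "d < 2 ^ Suc m" "2 ^ l \<le> d" "d < 2 ^ Suc l"
  shows "m = l"
proof -
  have "(2::nat) ^ m < 2 ^ Suc l" "(2::nat) ^ l < 2 ^ Suc m" using assms by linarith+
  then have "m < Suc l" "l < Suc m" unfolding pow2_less_iff .
  then show ?thesis by simp
qed

lemma hidx_inj: "hidx \<sigma> = hidx \<tau> \<longleftrightarrow> \<sigma> = \<tau>"
proof
  assume eq: "hidx \<sigma> = hidx \<tau>"
  have "length \<sigma> = length \<tau>"
    using pow2_interval_unique[of "length \<sigma>" "hidx \<sigma>" "length \<tau>"] hidx_bounds[of \<sigma>] hidx_bounds[of \<tau>] eq
    by auto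
  then show "\<sigma> = \<tau>" using eq
  proof (induction \<sigma> arbitrary: \<tau> rule: rev_induct)
    case (snoc b \<sigma>)
    then obtain \<rho> c where \<tau>: "\<tau> = \<rho> @ [c]" by (cases \<tau> rule: rev_cases) auto
    have "(2 * hidx \<sigma> + of_bool b) div 2 = (2 * hidx \<rho> + of_bool c) div 2" 
      using snoc.prems by (simp add: \<tau>)
    then have "hidx \<sigma> = hidx \<rho>" by (cases b; cases c) auto
    then show ?case using snoc.IH[of \<rho>] snoc.prems by (cases b; cases c) (auto simp: \<tau>)
  qed simp
qed simp

lemma hidx_surj: "0 < h \<Longrightarrow> \<exists>\<sigma>. hidx \<sigma> = h"
proof (induction h rule: less_induct)
  case (less h)
  show ?case
  proof (cases "h = 1")
    case True
    then show ?thesis using hidx_Nil by blast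
  next
    case False
    then obtain \<sigma> where "hidx \<sigma> = h div 2" using less.IH[of "h div 2"] less.prems by auto
    then have "hidx (\<sigma> @ [odd h]) = h" by (simp add: of_bool_odd_eq_mod_2)
    then show ?thesis by blast
  qed
qed

lemma label_hidx: "label x \<sigma> = x (hidx \<sigma> - 2)"
proof -
  have "2 ^ length \<sigma> - 1 + binval \<sigma> - 1 = 2 ^ length \<sigma> + binval \<sigma> - 2"
    using one_le_power[of "2::nat" "length \<sigma>"] by linarith
  then show ?thesis by (simp add: label_def llex_index_def hidx_def)
qed

lemma prefix_Suc: "prefix y (Suc n) = prefix y n @ [y n]"
  by (simp add: prefix_def)

lemma length_prefix [simp]: "length (prefix y n) = n"
  by (simp add: prefix_def)

lemma hidx_prefix_div: "hidx (prefix y (n + k)) div 2 ^ k = hidx (prefix y n)"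
proof (induction k)
  case (Suc k)
  have "hidx (prefix y (n + Suc k)) div 2 ^ Suc k = hidx (prefix y (n + Suc k)) div 2 div 2 ^ k"
    by (simp add: div_mult2_eq)
  also have "hidx (prefix y (n + Suc k)) div 2 = hidx (prefix y (n + k))"
    by (simp add: prefix_Suc)
  finally show ?case using Suc by simp
qed simp

lemma level_div:
  assumes "2 ^ m \<le> (d::nat)" "d < 2 ^ Suc m" "j \<le> m"
  shows "2 ^ (m - j) \<le> d div 2 ^ j" "d div 2 ^ j < 2 ^ Suc (m - j)"
proof -
  have "2 ^ (m - j) * 2 ^ j = (2::nat) ^ m" using assms(3) by (simp flip: power_add)
  then show "2 ^ (m - j) \<le> d div 2 ^ j" "d div 2 ^ j < 2 ^ Suc (m - j)"
    using assms by (simp_all add: less_eq_div_iff_mult_less_eq div_less_iff_less_mult)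
qed

lemma level_of: "0 < (h::nat) \<Longrightarrow> \<exists>l. 2 ^ l \<le> h \<and> h < 2 ^ Suc l"
  using ex_power_ivl1[of 2 h] by auto

lemma div_pow2_Suc: "(h::nat) div 2 ^ Suc j = (h div 2) div 2 ^ j"
  by (simp add: div_mult2_eq)

lemma div_pow2_add: "(h::nat) div 2 ^ (i + j) = (h div 2 ^ i) div 2 ^ j"
  by (simp add: power_add div_mult2_eq)

lemma all_nat_Suc: "(\<forall>j. P j) \<longleftrightarrow> P 0 \<and> (\<forall>j. P (Suc j))"
  by (metis not0_implies_Suc)

subsection \<open>The nodes all of whose labels differ from 1\<close>

definition alive :: "(nat \<Rightarrow> nat) \<Rightarrow> nat \<Rightarrow> bool" where
  "alive x h \<longleftrightarrow> (\<forall>j. 2 \<le> h div 2 ^ j \<longrightarrow> x (h div 2 ^ j - 2) \<noteq> 1)"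

lemma alive_rec: "alive x h \<longleftrightarrow> (2 \<le> h \<longrightarrow> x (h - 2) \<noteq> 1 \<and> alive x (h div 2))"
proof (cases "2 \<le> h")
  case True
  have "(\<forall>j. Q (h div 2 ^ j)) \<longleftrightarrow> Q h \<and> (\<forall>j. Q (h div 2 div 2 ^ j))" for Q
    using all_nat_Suc[of "\<lambda>j. Q (h div 2 ^ j)"] by (simp add: div_pow2_Suc del: power_Suc)
  from this[of "\<lambda>a. 2 \<le> a \<longrightarrow> x (a - 2) \<noteq> 1"] show ?thesis using True by (simp add: alive_def)
next
  case False
  have "h div 2 ^ j \<le> h" for j by simp
  then show ?thesis using False unfolding alive_def by (meson le_trans)
qed

lemma alive_even: "0 < h \<Longrightarrow> alive x (2 * h) \<longleftrightarrow> alive x h \<and> x (2 * h - 2) \<noteq> 1"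
  by (subst alive_rec) auto

lemma alive_odd: "0 < h \<Longrightarrow> alive x (Suc (2 * h)) \<longleftrightarrow> alive x h \<and> x (2 * h - 1) \<noteq> 1"
  by (subst alive_rec) auto

lemma alive_1 [simp]: "alive x (Suc 0)"
  by (subst alive_rec) auto

lemma alive_div: "alive x h \<Longrightarrow> alive x (h div 2 ^ j)"
  unfolding alive_def by (auto simp flip: div_pow2_add)

text \<open>
  The prefixes of the level m nodes that are still alive, a finite approximation from above to the tree
  of surviving nodes.
\<close>

definition alive_pre :: "nat \<Rightarrow> (nat \<Rightarrow> nat) \<Rightarrow> nat set" where
  "alive_pre m x = {h. \<exists>d. 2 ^ m \<le> d \<and> d < 2 ^ Suc m \<and> alive x d \<and> (\<exists>j\<le>m. d div 2 ^ j = h)}"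

lemma alive_preI:
  assumes "2 ^ l \<le> h" "h < 2 ^ Suc l" "l \<le> m" "d div 2 ^ (m - l) = h" "alive x d"
  shows "h \<in> alive_pre m x"
proof -
  have "2 ^ l * 2 ^ (m - l) = (2::nat) ^ m" "2 ^ Suc l * 2 ^ (m - l) = (2::nat) ^ Suc m"
    using assms(3) by (simp_all flip: power_add)
  moreover have "2 ^ l * 2 ^ (m - l) \<le> d" using assms(1,4)
    by (metis less_eq_div_iff_mult_less_eq zero_less_numeral zero_less_power)
  moreover have "d < 2 ^ Suc l * 2 ^ (m - l)" using assms(2,4)
    by (metis div_less_iff_less_mult zero_less_numeral zero_less_power)
  ultimately have "2 ^ m \<le> d" "d < 2 ^ Suc m" by simp_all
  moreover have "\<exists>j\<le>m. d div 2 ^ j = h" using assms(4) by (intro exI[of _ "m - l"]) simp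
  ultimately show ?thesis unfolding alive_pre_def using assms(5) by blast
qed

text \<open>Infinite descent, expressed by living descendants at every depth. By Konig's lemma this
  amounts to an infinite living path through h; the pigeonhole step behind it is in
  \<open>surv_dendless\<close>.\<close>

definition surv :: "(nat \<Rightarrow> nat) \<Rightarrow> nat set" where
  "surv x = {h. 0 < h \<and> (\<forall>k. \<exists>d. d div 2 ^ k = h \<and> alive x d)}"

text \<open>Pruned trees in heap numbering. The empty set qualifies: it is the tree behind the
  extinct quarter of the mixture.\<close>

definition dendless :: "nat set \<Rightarrow> bool" where
  "dendless S \<longleftrightarrow> 0 \<notin> S \<and> (\<forall>h>0. h \<in> S \<longleftrightarrow> 2 * h \<in> S \<or> Suc (2 * h) \<in> S)"

lemma dendless_0: "dendless S \<Longrightarrow> 0 \<notin> S"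
  unfolding dendless_def by blast

lemma dendless_iff: "dendless S \<Longrightarrow> 0 < h \<Longrightarrow> h \<in> S \<longleftrightarrow> 2 * h \<in> S \<or> Suc (2 * h) \<in> S"
  unfolding dendless_def by blast

lemma dendless_pos: "dendless S \<Longrightarrow> h \<in> S \<Longrightarrow> 0 < h"
  using dendless_0 gr0I by metis

lemma dendless_div:
  assumes "dendless S" "h \<in> S" "0 < h div 2 ^ j"
  shows "h div 2 ^ j \<in> S"
  using assms(3)
proof (induction j)
  case (Suc j)
  let ?a = "h div 2 ^ j"
  have eq: "h div 2 ^ Suc j = ?a div 2" using div_pow2_add[of h j 1] by simp
  have "0 < ?a" using Suc.prems eq by (auto intro: gr0I)
  then have "?a \<in> S" by (rule Suc.IH)
  moreover have "a = 2 * (a div 2) \<or> a = Suc (2 * (a div 2))" for a :: nat by presburger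
  then have "?a = 2 * (?a div 2) \<or> ?a = Suc (2 * (?a div 2))" .
  ultimately show ?case using assms(1) Suc.prems unfolding eq dendless_def by metis
qed (use assms in simp)

lemma dendless_descendant:
  assumes "dendless S" "h \<in> S"
  shows "\<exists>d\<in>S. d div 2 ^ k = h"
proof (induction k)
  case (Suc k)
  then obtain d where d: "d \<in> S" "d div 2 ^ k = h" by auto
  have "\<exists>e\<in>S. e div 2 = d"
    using assms(1) d(1) dendless_pos[OF assms(1) d(1)] unfolding dendless_def
    by (metis nonzero_mult_div_cancel_left even_Suc_div_two even_mult_iff dvd_refl zero_neq_numeral)
  then obtain e where e: "e \<in> S" "e div 2 = d" by blast
  have "e div 2 ^ Suc k = h" unfolding div_pow2_Suc using e(2) d(2) by simp
  then show ?case using e(1) by blast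
qed (use assms in auto)

lemma surv_dendless: "dendless (surv x)"
  unfolding dendless_def
proof (intro conjI allI impI)
  fix h :: nat assume h: "0 < h"
  have kid: "h \<in> surv x" if "c \<in> surv x" "c div 2 = h" for c
  proof -
    have "\<exists>d. d div 2 ^ k = h \<and> alive x d" for k
    proof -
      obtain d where "d div 2 ^ k = c" "alive x d" using \<open>c \<in> surv x\<close> by (auto simp: surv_def)
      moreover from this have "(d div 2) div 2 ^ k = h"
        using that(2) by (metis div_pow2_add[of d k 1] div_pow2_Suc power_one_right add.commute plus_1_eq_Suc)
      ultimately show ?thesis using alive_div[of x d 1] by auto
    qed
    then show ?thesis using h by (auto simp: surv_def)
  qed
  show "h \<in> surv x \<longleftrightarrow> 2 * h \<in> surv x \<or> Suc (2 * h) \<in> surv x"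
  proof
    assume hs: "h \<in> surv x"
    show "2 * h \<in> surv x \<or> Suc (2 * h) \<in> surv x"
    proof (rule ccontr)
      assume "\<not> ?thesis"
      then obtain k1 k2 where k: "\<And>d. d div 2 ^ k1 = 2 * h \<Longrightarrow> \<not> alive x d"
        "\<And>d. d div 2 ^ k2 = Suc (2 * h) \<Longrightarrow> \<not> alive x d"
        using h by (auto simp: surv_def)
      \<comment> \<open>If neither child survived, each would be extinct at some depth; at the
        larger of the two depths h itself would have no living descendant.\<close>
      define K where "K = max k1 k2"
      obtain d where d: "d div 2 ^ Suc K = h" "alive x d" using hs unfolding surv_def by blast
      have "d div 2 ^ K div 2 = h" using d(1) div_pow2_add[of d K 1] by simp
      then consider "d div 2 ^ K = 2 * h" | "d div 2 ^ K = Suc (2 * h)" by linarith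
      then show False
      proof cases
        case 1
        have "d div 2 ^ (K - k1) div 2 ^ k1 = 2 * h" using 1 by (simp add: K_def flip: div_pow2_add)
        then show False using k(1) alive_div[OF d(2)] by blast
      next
        case 2
        have "d div 2 ^ (K - k2) div 2 ^ k2 = Suc (2 * h)" using 2 by (simp add: K_def flip: div_pow2_add)
        then show False using k(2) alive_div[OF d(2)] by blast
      qed
    qed
  next
    assume "2 * h \<in> surv x \<or> Suc (2 * h) \<in> surv x"
    then show "h \<in> surv x" using kid[of "2 * h"] kid[of "Suc (2 * h)"] by auto
  qed
qed (simp add: surv_def)

text \<open>A node outside \<open>surv x\<close> is exposed at some finite depth, and only finitely
  many nodes lie below \<open>2 ^ Suc n\<close>. The stage comes without a rate; rates are available
  only for relabelled trees, through \<open>bad\<close>.\<close>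

lemma alive_pre_surv:
  "\<exists>m0. \<forall>m\<ge>m0. \<forall>h<2 ^ Suc n. h \<in> alive_pre m x \<longleftrightarrow> h \<in> surv x"
proof -
  have "\<exists>m0. \<forall>m\<ge>m0. h \<in> alive_pre m x \<longleftrightarrow> h \<in> surv x" for h
  proof (cases "0 < h")
    case False
    have "0 \<notin> alive_pre m x" for m
      using level_div(1)[of m] by (fastforce simp: alive_pre_def)
    then show ?thesis using False by (auto simp: surv_def)
  next
    case True
    then obtain l where l: "2 ^ l \<le> h" "h < 2 ^ Suc l" using level_of by blast
    have *: "j = m - l \<and> l \<le> m" if "2 ^ m \<le> d" "d < 2 ^ Suc m" "j \<le> m" "d div 2 ^ j = h" for m d j
      using pow2_interval_unique[OF _ _ l, of "m - j"] level_div[OF that(1-3)] that(3,4) by auto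
    show ?thesis
    proof (cases "h \<in> surv x")
      case h: True
      have "h \<in> alive_pre m x" if "m \<ge> l" for m
      proof -
        obtain d where d: "d div 2 ^ (m - l) = h" "alive x d" using h unfolding surv_def by blast
        show ?thesis by (rule alive_preI[OF l that d])
      qed
      then show ?thesis using h by blast
    next
      case h: False
      then obtain k where k: "\<And>d. d div 2 ^ k = h \<Longrightarrow> \<not> alive x d" using True by (auto simp: surv_def)
      have "h \<notin> alive_pre m x" if "m \<ge> l + k" for m
      proof
        assume "h \<in> alive_pre m x"
        then obtain d j where d: "2 ^ m \<le> d" "d < 2 ^ Suc m" "alive x d" "j \<le> m" "d div 2 ^ j = h"
          by (auto simp: alive_pre_def)
        have "k \<le> j" using *[OF d(1,2,4,5)] that by auto
        then have "d div 2 ^ (j - k) div 2 ^ k = h" using d(5) by (simp flip: div_pow2_add)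
        then show False using k alive_div[OF d(3)] by blast
      qed
      then show ?thesis using h by blast
    qed
  qed
  then obtain f where f: "\<And>h m. m \<ge> f h \<Longrightarrow> h \<in> alive_pre m x \<longleftrightarrow> h \<in> surv x" by metis
  have "f h \<le> Max (f ` {..<2 ^ Suc n})" if "h < 2 ^ Suc n" for h using that by simp
  then show ?thesis using f by (intro exI[of _ "Max (f ` {..<2 ^ Suc n})"]) (meson le_trans)
qed

subsection \<open>Trees without dead ends and their codes\<close>

text \<open>The digit that a code assigns to a node. A node without children would also get 0, so
  the value is meaningful only in trees without dead ends.\<close>

definition kids :: "nat set \<Rightarrow> nat \<Rightarrow> nat" where
  "kids S h = (if Suc (2 * h) \<notin> S then 0 else if 2 * h \<notin> S then 1 else 2)"

abbreviation rank :: "nat set \<Rightarrow> nat \<Rightarrow> nat" where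
  "rank S h \<equiv> card (S \<inter> {..<h})"

text \<open>Describes the tree of z without recursion over levels: heap order is
  length-lexicographic order, so \<open>rank S h\<close> is the position of z that is read at h. As
  in \<open>children\<close>, every value above 1 means both children, hence the \<open>min\<close>
  with 2 below.\<close>

definition is_code :: "(nat \<Rightarrow> nat) \<Rightarrow> nat set \<Rightarrow> bool" where
  "is_code z S \<longleftrightarrow> 0 \<notin> S \<and> Suc 0 \<in> S \<and>
     (\<forall>h>0. (2 * h \<in> S \<longleftrightarrow> h \<in> S \<and> z (rank S h) \<noteq> 1) \<and>
            (Suc (2 * h) \<in> S \<longleftrightarrow> h \<in> S \<and> z (rank S h) \<noteq> 0))"

lemma is_code_dendless: "is_code z S \<Longrightarrow> dendless S"
  by (auto simp: is_code_def dendless_def)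

lemma is_code_kids: "is_code z S \<Longrightarrow> h \<in> S \<Longrightarrow> kids S h = min (z (rank S h)) 2"
proof -
  assume *: "is_code z S" "h \<in> S"
  then have "0 < h" by (auto simp: is_code_def intro: gr0I)
  with * show ?thesis by (auto simp: is_code_def kids_def min_def)
qed

lemma is_codeI:
  assumes "dendless S" "Suc 0 \<in> S" "\<And>h. h \<in> S \<Longrightarrow> min (z (rank S h)) 2 = kids S h"
  shows "is_code z S"
  unfolding is_code_def
proof (intro conjI allI impI)
  fix h :: nat assume "0 < h"
  then have "h \<in> S \<longleftrightarrow> 2 * h \<in> S \<or> Suc (2 * h) \<in> S" using assms(1) by (intro dendless_iff)
  then show "2 * h \<in> S \<longleftrightarrow> h \<in> S \<and> z (rank S h) \<noteq> 1" "Suc (2 * h) \<in> S \<longleftrightarrow> h \<in> S \<and> z (rank S h) \<noteq> 0"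
    using assms(3)[of h] by (auto simp: kids_def min_def split: if_splits)
qed (use assms dendless_0 in auto)

text \<open>Membership of a node depends only on its parent and on the number of nodes before the
  parent, so it is settled by strong induction on the heap index.\<close>

lemma is_code_unique:
  assumes "is_code z S" "is_code z T"
  shows "S = T"
proof -
  have "h \<in> S \<longleftrightarrow> h \<in> T" for h
  proof (induction h rule: less_induct)
    case (less h)
    show ?case
    proof (cases "h \<le> 1")
      case True
      then show ?thesis using assms by (cases h) (auto simp: is_code_def)
    next
      case False
      define p where "p = h div 2"
      have p: "0 < p" "p < h" using False by (auto simp: p_def)
      have "S \<inter> {..<p} = T \<inter> {..<p}" using less.IH p(2) by auto
      then have r: "rank S p = rank T p" by simp
      have pST: "p \<in> S \<longleftrightarrow> p \<in> T" using less.IH p(2) by blast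
      have "h = 2 * p \<or> h = Suc (2 * p)" unfolding p_def by presburger
      moreover have "2 * p \<in> S \<longleftrightarrow> 2 * p \<in> T" "Suc (2 * p) \<in> S \<longleftrightarrow> Suc (2 * p) \<in> T"
        using assms p(1) r pST unfolding is_code_def by simp_all
      ultimately show ?thesis by blast
    qed
  qed
  then show ?thesis by blast
qed

lemma rank_mono: "h \<le> h' \<Longrightarrow> rank S h \<le> rank S h'"
  by (intro card_mono) auto

lemma rank_strict_mono: "h \<in> S \<Longrightarrow> h < h' \<Longrightarrow> rank S h < rank S h'"
  by (intro psubset_card_mono) auto

lemma rank_inj: "h \<in> S \<Longrightarrow> h' \<in> S \<Longrightarrow> rank S h = rank S h' \<Longrightarrow> h = h'"
  by (metis nat_neq_iff rank_strict_mono)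

text \<open>A node h of the tree has a child in it, so the next node in heap order is at most 2h +
  1. Positions therefore translate into a computable bound on the depth at which they are
  found.\<close>

lemma ex_rank:
  assumes "dendless S" "Suc 0 \<in> S"
  shows "\<exists>h\<in>S. h < 2 ^ Suc j \<and> rank S h = j"
proof (induction j)
  case 0
  have "S \<inter> {..<Suc 0} = {}" using dendless_0[OF assms(1)] by auto
  then show ?case using assms(2) by (intro bexI[of _ "Suc 0"]) auto
next
  case (Suc j)
  then obtain h where h: "h \<in> S" "h < 2 ^ Suc j" "rank S h = j" by blast
  define h' where "h' = (LEAST a. a \<in> S \<and> h < a)"
  have pos: "0 < h" using assms(1) h(1) by (rule dendless_pos)
  then have "2 * h \<in> S \<or> Suc (2 * h) \<in> S" using dendless_iff[OF assms(1) pos] h(1) by blast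
  then obtain a where "a \<in> S" "a = 2 * h \<or> a = Suc (2 * h)" by blast
  then have a: "a \<in> S" "h < a" "a \<le> Suc (2 * h)" using pos by auto
  have h': "h' \<in> S \<and> h < h'" unfolding h'_def by (rule LeastI[of _ a]) (use a in auto)
  have "h' \<le> a" unfolding h'_def by (rule Least_le) (use a in auto)
  moreover have "b \<le> h" if "b \<in> S" "b < h'" for b
    using not_less_Least[of b "\<lambda>a. a \<in> S \<and> h < a"] that unfolding h'_def[symmetric] by auto
  then have "S \<inter> {..<h'} = insert h (S \<inter> {..<h})" using h' h(1) by fastforce
  then have "rank S h' = Suc j" using h(3) by simp
  ultimately show ?case using a(3) h(2) h' by (intro bexI[of _ h']) auto
qed

lemma rank_lower:
  assumes "dendless S" "Suc 0 \<in> S" "2 ^ n \<le> h"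
  shows "n \<le> rank S h"
proof (cases n)
  case (Suc j)
  then obtain a where a: "a \<in> S" "a < 2 ^ n" "rank S a = j" using ex_rank[OF assms(1,2), of j] by auto
  then have "rank S a < rank S h" using assms(3) by (intro rank_strict_mono) auto
  then show ?thesis using a(3) Suc by simp
qed simp

definition code_of :: "nat set \<Rightarrow> nat \<Rightarrow> nat" where
  "code_of S j = kids S (SOME h. h \<in> S \<and> rank S h = j)"

lemma code_of_less: "code_of S j < 3"
  by (simp add: code_of_def kids_def)

lemma is_code_code_of:
  assumes "dendless S" "Suc 0 \<in> S"
  shows "is_code (code_of S) S"
proof (rule is_codeI)
  fix h assume h: "h \<in> S"
  have "(SOME a. a \<in> S \<and> rank S a = rank S h) = h"
    by (rule some_equality) (use h rank_inj in auto)
  then show "min (code_of S (rank S h)) 2 = kids S h" by (simp add: code_of_def kids_def)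
qed (use assms in auto)

text \<open>Membership of the code in \<open>cyl \<sigma>\<close>, read off an approximation P to
  its tree. Demanding the root keeps the empty approximation from matching anything, even the empty
  string; this controls the extinct part of the mixture.\<close>

definition matches :: "nat set \<Rightarrow> nat list \<Rightarrow> bool" where
  "matches P \<sigma> \<longleftrightarrow> Suc 0 \<in> P \<and> (\<forall>h\<in>P. rank P h < length \<sigma> \<longrightarrow> kids P h = \<sigma> ! rank P h)"

lemma kids_cong:
  assumes "\<And>h. h < 2 ^ Suc n \<Longrightarrow> h \<in> P \<longleftrightarrow> h \<in> S" "h < 2 ^ n"
  shows "kids P h = kids S h" "rank P h = rank S h" "h \<in> P \<longleftrightarrow> h \<in> S"
proof -
  have "P \<inter> {..<h} = S \<inter> {..<h}" using assms by (auto simp del: power_Suc simp: power_Suc)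
  then show "rank P h = rank S h" by simp
qed (use assms in \<open>auto simp: kids_def\<close>)

text \<open>The positions inside the string are occupied by nodes below \<open>2 ^ n\<close>
  (\<open>ex_rank\<close>), and nodes from \<open>2 ^ n\<close> on have too large a position
  (\<open>rank_lower\<close>). The children that have to be inspected then lie below
  \<open>2 ^ Suc n\<close>, where P and S agree.\<close>

lemma matches_iff_cyl:
  assumes S: "dendless S" "Suc 0 \<in> S" "is_code z S" and z: "\<And>i. z i < 3"
    and P: "\<And>h. h < 2 ^ Suc n \<Longrightarrow> h \<in> P \<longleftrightarrow> h \<in> S" and n: "length \<sigma> \<le> n"
  shows "matches P \<sigma> \<longleftrightarrow> z \<in> cyl \<sigma>"
proof
  assume m: "matches P \<sigma>"
  show "z \<in> cyl \<sigma>" unfolding cyl_def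
  proof (intro CollectI allI impI)
    fix j assume j: "j < length \<sigma>"
    obtain h where h: "h \<in> S" "h < 2 ^ Suc j" "rank S h = j" using ex_rank[OF S(1,2)] by blast
    have "(2::nat) ^ Suc j \<le> 2 ^ n" using j n by (intro power_increasing) auto
    then have hn: "h < 2 ^ n" using h(2) by linarith
    note c = kids_cong[of n P S h, OF P hn]
    have "kids P h = \<sigma> ! j" using m c h j by (auto simp: matches_def)
    then show "z j = \<sigma> ! j" using is_code_kids[OF S(3) h(1)] c(1) h(3) z[of j] by simp
  qed
next
  assume zc: "z \<in> cyl \<sigma>"
  show "matches P \<sigma>" unfolding matches_def
  proof (intro conjI ballI impI)
    have "(1::nat) < 2 ^ Suc n" by (rule one_less_power) auto
    then show "Suc 0 \<in> P" using P[of 1] S(2) by simp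
  next
    fix h assume h: "h \<in> P" "rank P h < length \<sigma>"
    have hn: "h < 2 ^ n"
    proof (rule ccontr)
      assume "\<not> h < 2 ^ n"
      then have "rank P (2 ^ n) \<le> rank P h" by (intro rank_mono) simp
      moreover have "P \<inter> {..<2 ^ n} = S \<inter> {..<2 ^ n}" using P by auto
      moreover have "n \<le> rank S (2 ^ n)" using rank_lower[OF S(1,2)] by simp
      ultimately show False using h n by simp
    qed
    note c = kids_cong[of n P S h, OF P hn]
    show "kids P h = \<sigma> ! rank P h"
      using is_code_kids[OF S(3), of h] c h zc z[of "rank P h"] by (auto simp: cyl_def)
  qed
qed

subsection \<open>The tree of a code\<close>

definition Tset :: "(nat \<Rightarrow> nat) \<Rightarrow> nat set" where
  "Tset z = hidx ` tree z"

lemma Tset_iff: "hidx \<sigma> \<in> Tset z \<longleftrightarrow> \<sigma> \<in> tree z"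
  by (auto simp: Tset_def hidx_inj)

lemma paths_tree: "paths (tree z) = {y. \<forall>n. hidx (prefix y n) \<in> Tset z}"
  by (simp add: paths_def Tset_iff)

lemma snoc_in_children: "\<sigma> @ [b] \<in> set (children c \<tau>) \<longleftrightarrow> \<sigma> = \<tau> \<and> (if b then c \<noteq> 0 else c \<noteq> 1)"
  by (auto simp: children_def)

lemma children_hidx: "\<rho> \<in> set (children c \<sigma>) \<Longrightarrow> 2 * hidx \<sigma> \<le> hidx \<rho> \<and> hidx \<rho> \<le> Suc (2 * hidx \<sigma>)"
  by (auto simp: children_def split: if_splits)

lemma sorted_children:
  assumes "length js = length L" "sorted_wrt (<) (map hidx L)"
  shows "sorted_wrt (<) (map hidx (concat (map (\<lambda>(j, \<sigma>). children (c j) \<sigma>) (zip js L))))"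
  using assms
proof (induction js L rule: list_induct2)
  case (Cons j js \<sigma> L)
  have *: "hidx \<rho> < hidx \<rho>'" if a: "\<rho> \<in> set (children (c j) \<sigma>)"
    and b: "(i, \<tau>) \<in> set (zip js L)" "\<rho>' \<in> set (children (c i) \<tau>)" for \<rho> \<rho>' i \<tau>
  proof -
    have "hidx \<sigma> < hidx \<tau>" using Cons.prems set_zip_rightD[OF b(1)] by auto
    then show ?thesis using children_hidx[OF a] children_hidx[OF b(2)] by linarith
  qed
  have "sorted_wrt (<) (map hidx (children (c j) \<sigma>))" by (auto simp: children_def)
  then show ?case using Cons.IH Cons.prems * by (fastforce simp: sorted_wrt_append)
qed simp

lemma levels_spec:
  assumes "levels z n = (L, off)"
  shows "sorted_wrt (<) (map hidx L) \<and> set L = {\<sigma> \<in> tree z. length \<sigma> = n} \<and> off = rank (Tset z) (2 ^ n)"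
  using assms
proof (induction n arbitrary: L off)
  case 0
  have "Tset z \<inter> {..<2 ^ 0} = {}" by (auto simp: Tset_def)
  then show ?case using 0 by (auto simp: tree_def)
next
  case (Suc n)
  obtain M o' where M: "levels z n = (M, o')" by fastforce
  note IH = Suc.IH[OF M]
  have L: "L = concat (map (\<lambda>(j, \<sigma>). children (z (o' + j)) \<sigma>) (zip [0..<0 + length M] M))"
    and off: "off = o' + length M"
    using Suc.prems M by auto
  have len: "length \<sigma> = Suc n" if "\<sigma> \<in> set L" for \<sigma>
    using that IH by (fastforce simp: L children_def dest: set_zip_rightD split: if_splits)
  then have "set L = {\<sigma> \<in> tree z. length \<sigma> = Suc n}"
    using Suc.prems by (auto simp: tree_def simp del: levels.simps)
  moreover have "sorted_wrt (<) (map hidx L)" unfolding L by (rule sorted_children) (use IH in auto)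
  moreover have "off = rank (Tset z) (2 ^ Suc n)"
  proof -
    have "Tset z \<inter> {..<2 ^ Suc n} = (Tset z \<inter> {..<2 ^ n}) \<union> hidx ` set M" (is "?l = ?r")
    proof
      show "?l \<subseteq> ?r"
      proof
        fix h assume "h \<in> ?l"
        then obtain \<sigma> where \<sigma>: "h = hidx \<sigma>" "\<sigma> \<in> tree z" "hidx \<sigma> < 2 ^ Suc n" by (auto simp: Tset_def)
        show "h \<in> ?r"
        proof (cases "hidx \<sigma> < 2 ^ n")
          case False
          then have "length \<sigma> = n"
            using pow2_interval_unique[of n "hidx \<sigma>" "length \<sigma>"] hidx_bounds[of \<sigma>] \<sigma>(3) by auto
          then show ?thesis using IH \<sigma> by auto
        qed (use \<sigma> in \<open>auto simp: Tset_def\<close>)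
      qed
      have "hidx \<sigma> < 2 ^ Suc n" if "\<sigma> \<in> set M" for \<sigma> using hidx_bounds[of \<sigma>] that IH by auto
      then show "?r \<subseteq> ?l" using IH by (auto simp: Tset_def)
    qed
    moreover have "(Tset z \<inter> {..<2 ^ n}) \<inter> hidx ` set M = {}"
    proof -
      have "2 ^ n \<le> hidx \<sigma>" if "\<sigma> \<in> set M" for \<sigma> using hidx_bounds[of \<sigma>] that IH by auto
      then show ?thesis by (auto dest: leD)
    qed
    moreover have "card (hidx ` set M) = length M"
    proof -
      have "distinct (map hidx M)" using IH strict_sorted_iff by blast
      then show ?thesis using distinct_card[of "map hidx M"] by simp
    qed
    ultimately have "rank (Tset z) (2 ^ Suc n) = rank (Tset z) (2 ^ n) + length M"
      by (metis card_Un_disjoint finite_Int finite_lessThan finite_imageI finite_set)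
    moreover have "o' = rank (Tset z) (2 ^ n)" using IH by blast
    ultimately show ?thesis using off by metis
  qed
  ultimately show ?case by blast
qed

text \<open>In heap order all shorter nodes come first and a level is listed in increasing order. So
  the nodes before \<open>L ! j\<close> are the \<open>off\<close> shorter ones and j entries of
  L.\<close>

lemma levels_rank:
  assumes L: "levels z n = (L, off)" and j: "j < length L"
  shows "rank (Tset z) (hidx (L ! j)) = off + j"
proof -
  note spec = levels_spec[OF L]
  have lt: "hidx (L ! i) < hidx (L ! k) \<longleftrightarrow> i < k" if "i < length L" "k < length L" for i k
  proof -
    have s: "sorted_wrt (<) (map hidx L)" using spec by blast
    show ?thesis
      using sorted_wrt_nth_less[OF s, of i k] sorted_wrt_nth_less[OF s, of k i] that
      by (cases i k rule: linorder_cases) auto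
  qed
  have len: "length (L ! i) = n" if "i < length L" for i using spec nth_mem[OF that] by auto
  have "Tset z \<inter> {..<hidx (L ! j)} = (Tset z \<inter> {..<2 ^ n}) \<union> (\<lambda>i. hidx (L ! i)) ` {..<j}" (is "?l = ?r")
  proof
    show "?l \<subseteq> ?r"
    proof
      fix h assume "h \<in> ?l"
      then obtain \<sigma> where \<sigma>: "h = hidx \<sigma>" "\<sigma> \<in> tree z" "hidx \<sigma> < hidx (L ! j)" by (auto simp: Tset_def)
      show "h \<in> ?r"
      proof (cases "hidx \<sigma> < 2 ^ n")
        case False
        then have "length \<sigma> = n"
          using pow2_interval_unique[of n "hidx \<sigma>" "length \<sigma>"] hidx_bounds[of \<sigma>] \<sigma>(3)
            hidx_bounds[of "L ! j"] len[OF j] by auto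
        then have "\<sigma> \<in> set L" using spec \<sigma>(2) by auto
        then obtain i where "i < length L" "L ! i = \<sigma>" by (metis in_set_conv_nth)
        then show ?thesis using lt[of i j] \<sigma> j by auto
      qed (use \<sigma> in \<open>auto simp: Tset_def\<close>)
    qed
    have "2 ^ n \<le> hidx (L ! j)" using hidx_bounds[of "L ! j"] len[OF j] by auto
    moreover have "hidx (L ! i) \<in> Tset z" if "i < j" for i
      using spec nth_mem[of i L] that j by (auto simp: Tset_def)
    ultimately show "?r \<subseteq> ?l" using lt j by auto
  qed
  moreover have "(Tset z \<inter> {..<2 ^ n}) \<inter> (\<lambda>i. hidx (L ! i)) ` {..<j} = {}"
  proof -
    have "2 ^ n \<le> hidx (L ! i)" if "i < j" for i using hidx_bounds[of "L ! i"] len[of i] that j by auto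
    then show ?thesis by (auto dest: leD)
  qed
  moreover have "card ((\<lambda>i. hidx (L ! i)) ` {..<j}) = j"
  proof -
    have "inj_on (\<lambda>i. hidx (L ! i)) {..<j}"
    proof (rule inj_onI)
      fix i k assume "i \<in> {..<j}" "k \<in> {..<j}" "hidx (L ! i) = hidx (L ! k)"
      then show "i = k" using lt[of i k] lt[of k i] j by simp
    qed
    then show ?thesis by (simp add: card_image)
  qed
  ultimately have "rank (Tset z) (hidx (L ! j)) = rank (Tset z) (2 ^ n) + j"
    by (metis card_Un_disjoint finite_Int finite_lessThan finite_imageI)
  then show ?thesis using spec by metis
qed

lemma is_code_Tset: "is_code z (Tset z)"
  unfolding is_code_def
proof (intro conjI allI impI)
  show "0 \<notin> Tset z" unfolding Tset_def using hidx_pos by (metis image_iff less_irrefl)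
  have "[] \<in> tree z" by (simp add: tree_def)
  then show "Suc 0 \<in> Tset z" by (force simp: Tset_def)
next
  fix h :: nat assume "0 < h"
  then obtain \<sigma> where h: "h = hidx \<sigma>" using hidx_surj by blast
  obtain L off where L: "levels z (length \<sigma>) = (L, off)" by fastforce
  have snoc: "\<sigma> @ [b] \<in> tree z \<longleftrightarrow> \<sigma> \<in> tree z \<and> (if b then z (rank (Tset z) h) \<noteq> 0 else z (rank (Tset z) h) \<noteq> 1)" for b
  proof -
    have "\<sigma> @ [b] \<in> tree z \<longleftrightarrow> (\<exists>(j, \<tau>)\<in>set (zip [0..<length L] L). \<sigma> @ [b] \<in> set (children (z (off + j)) \<tau>))"
      using L by (auto simp: tree_def)
    also have "\<dots> \<longleftrightarrow> (\<exists>j<length L. \<sigma> @ [b] \<in> set (children (z (off + j)) (L ! j)))"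
    proof -
      have "zip [0..<length L] L = map (\<lambda>j. (j, L ! j)) [0..<length L]" by (rule nth_equalityI) auto
      then show ?thesis by auto
    qed
    also have "\<dots> \<longleftrightarrow> (\<exists>j<length L. \<sigma> = L ! j \<and> (if b then z (rank (Tset z) h) \<noteq> 0 else z (rank (Tset z) h) \<noteq> 1))"
      using levels_rank[OF L] by (auto simp: snoc_in_children h)
    also have "\<dots> \<longleftrightarrow> \<sigma> \<in> set L \<and> (if b then z (rank (Tset z) h) \<noteq> 0 else z (rank (Tset z) h) \<noteq> 1)"
      by (auto simp: in_set_conv_nth)
    finally show ?thesis using levels_spec[OF L] by auto
  qed
  show "2 * h \<in> Tset z \<longleftrightarrow> h \<in> Tset z \<and> z (rank (Tset z) h) \<noteq> 1"
    using snoc[of False] Tset_iff[of "\<sigma> @ [False]" z] Tset_iff[of \<sigma> z] by (simp add: h)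
  show "Suc (2 * h) \<in> Tset z \<longleftrightarrow> h \<in> Tset z \<and> z (rank (Tset z) h) \<noteq> 0"
    using snoc[of True] Tset_iff[of "\<sigma> @ [True]" z] Tset_iff[of \<sigma> z] by (simp add: h)
qed

subsection \<open>Zeros\<close>

lemma alive_hidx_prefix:
  "alive x (hidx (prefix y n)) \<longleftrightarrow> (\<forall>k<n. label x (prefix y (Suc k)) \<noteq> 1)"
proof (induction n)
  case 0
  show ?case by (simp add: prefix_def)
next
  case (Suc n)
  have "2 \<le> hidx (prefix y (Suc n))" using hidx_pos[of "prefix y n"] by (simp add: prefix_Suc del: hidx_pos)
  moreover have "hidx (prefix y (Suc n)) div 2 = hidx (prefix y n)" by (simp add: prefix_Suc)
  ultimately show ?case using Suc by (subst alive_rec) (auto simp: label_hidx less_Suc_eq)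
qed

text \<open>The assumption makes \<open>Ffun x\<close> total. Otherwise a branch without label 1 and
  with only finitely many labels 0 would be alive, but no zero.\<close>

lemma zeros_Ffun:
  assumes "\<And>y n0. \<exists>n\<ge>n0. label x (prefix y (Suc n)) \<noteq> 2"
  shows "zeros (Ffun x) = {y. \<forall>n. alive x (hidx (prefix y n))}"
proof -
  have "Ffun x y = Some (\<lambda>_. False) \<longleftrightarrow> (\<forall>k. label x (prefix y (Suc k)) \<noteq> 1)" for y
  proof -
    let ?S = "{k. label x (prefix y (Suc k)) \<noteq> 2}"
    have inf: "infinite ?S" unfolding infinite_nat_iff_unbounded_le using assms by blast
    then have "Ffun x y = Some (\<lambda>_. False) \<longleftrightarrow> (\<forall>m. label x (prefix y (Suc (enumerate ?S m))) \<noteq> 1)"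
      unfolding Ffun_def Let_def by (simp add: fun_eq_iff)
    also have "\<dots> \<longleftrightarrow> (\<forall>k\<in>?S. label x (prefix y (Suc k)) \<noteq> 1)"
      using range_enumerate[OF inf] by (metis (no_types, lifting) rangeI imageE)
    also have "\<dots> \<longleftrightarrow> (\<forall>k. label x (prefix y (Suc k)) \<noteq> 1)"
    proof -
      have "k \<in> ?S" if "label x (prefix y (Suc k)) = 1" for k using that by simp
      then show ?thesis by blast
    qed
    finally show ?thesis .
  qed
  then show ?thesis by (auto simp: zeros_def alive_hidx_prefix)
qed

lemma alive_path_surv:
  "(\<forall>n. alive x (hidx (prefix y n))) \<longleftrightarrow> (\<forall>n. hidx (prefix y n) \<in> surv x)"
proof
  assume *: "\<forall>n. alive x (hidx (prefix y n))"
  show "\<forall>n. hidx (prefix y n) \<in> surv x"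
    unfolding surv_def using * hidx_prefix_div[of y] by (auto intro!: hidx_pos)
next
  assume *: "\<forall>n. hidx (prefix y n) \<in> surv x"
  show "\<forall>n. alive x (hidx (prefix y n))"
  proof
    fix n
    have "\<exists>d. d div 2 ^ 0 = hidx (prefix y n) \<and> alive x d" using * unfolding surv_def by blast
    then show "alive x (hidx (prefix y n))" by simp
  qed
qed

subsection \<open>Relabelling\<close>

text \<open>
  Given the tree S of nodes that shall survive and dice r with six faces, the labels are drawn from their
  conditional distributions: 0 and 2 with probability 1/2 each inside S; outside S the labels 1, 0, 2 with
  probabilities 2/3, 1/6, 1/6, until a node outside S gets label 1 (its roll is below 4), after which
  everything below is released and labelled uniformly.
\<close>

definition released :: "nat set \<Rightarrow> (nat \<Rightarrow> nat) \<Rightarrow> nat \<Rightarrow> bool" where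
  "released S r h \<longleftrightarrow> (\<exists>j. 2 \<le> h div 2 ^ Suc j \<and> h div 2 ^ Suc j \<notin> S \<and> r (h div 2 ^ Suc j - 2) < 4)"

definition relabel :: "nat set \<Rightarrow> (nat \<Rightarrow> nat) \<Rightarrow> nat \<Rightarrow> nat" where
  "relabel S r i = (if i + 2 \<in> S then 2 * (r i mod 2)
     else if released S r (i + 2) then r i mod 3
     else if r i < 4 then 1 else 2 * (r i mod 2))"

lemma relabel_less: "relabel S r i < 3"
  by (auto simp: relabel_def)

lemma released_rec:
  "released S r h \<longleftrightarrow>
    2 \<le> h div 2 \<and> ((h div 2 \<notin> S \<and> r (h div 2 - 2) < 4) \<or> released S r (h div 2))"
proof -
  have "(\<exists>j. Q (h div 2 ^ Suc j)) \<longleftrightarrow> Q (h div 2) \<or> (\<exists>j. Q (h div 2 div 2 ^ Suc j))" for Q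
    using all_nat_Suc[of "\<lambda>j. \<not> Q (h div 2 div 2 ^ j)"] by (simp add: div_pow2_Suc del: power_Suc) blast
  from this[of "\<lambda>a. 2 \<le> a \<and> a \<notin> S \<and> r (a - 2) < 4"]
  have "released S r h \<longleftrightarrow> (2 \<le> h div 2 \<and> h div 2 \<notin> S \<and> r (h div 2 - 2) < 4) \<or> released S r (h div 2)"
    by (simp add: released_def)
  moreover have "2 \<le> h div 2" if "released S r (h div 2)"
    using that div_le_dividend le_trans unfolding released_def by blast
  ultimately show ?thesis by blast
qed

text \<open>A node that is not released gets label 1 exactly if it lies outside S and rolls below 4;
  so the first label 1 on the way down is what triggers the release. Hence \<open>released\<close>
  can be read off the labels x instead of the dice r.\<close>

lemma released_iff_not_alive:
  assumes "\<And>i. i < L \<Longrightarrow> relabel S r i = x i" "h div 2 < L + 2"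
  shows "released S r h \<longleftrightarrow> \<not> alive x (h div 2)"
  using assms(2)
proof (induction h rule: less_induct)
  case (less h)
  define p where "p = h div 2"
  show ?case
  proof (cases "2 \<le> p")
    case False
    then show ?thesis by (subst released_rec, subst alive_rec) (auto simp: p_def)
  next
    case True
    have IH: "released S r p \<longleftrightarrow> \<not> alive x (p div 2)"
      using less.IH[of p] less.prems True unfolding p_def by linarith
    have "relabel S r (p - 2) = x (p - 2)" using assms(1)[of "p - 2"] less.prems True by (simp add: p_def)
    then have "\<not> released S r p \<Longrightarrow> x (p - 2) = 1 \<longleftrightarrow> p \<notin> S \<and> r (p - 2) < 4"
    proof -
      have "p - 2 + 2 = p" using True by simp
      then show "x (p - 2) = 1 \<longleftrightarrow> p \<notin> S \<and> r (p - 2) < 4" if "\<not> released S r p"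
        using that \<open>relabel S r (p - 2) = x (p - 2)\<close> unfolding relabel_def by (auto split: if_splits)
    qed
    then show ?thesis using IH True released_rec[of S r h] alive_rec[of x p] by (auto simp: p_def)
  qed
qed

text \<open>The rolls that produce \<open>x i\<close> when all earlier labels agree with x. Death of
  the parent is a condition on x alone, so the preimage of a cylinder is a box in r and its measure
  is a product.\<close>

definition wset :: "nat set \<Rightarrow> (nat \<Rightarrow> nat) \<Rightarrow> nat \<Rightarrow> nat set" where
  "wset S x i = (if i + 2 \<in> S then {v. 2 * (v mod 2) = x i}
     else if \<not> alive x ((i + 2) div 2) then {v. v mod 3 = x i}
     else {v. (if v < 4 then 1 else 2 * (v mod 2)) = x i})"

lemma relabel_box: "(\<forall>i<L. relabel S r i = x i) \<longleftrightarrow> (\<forall>i<L. r i \<in> wset S x i)"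
proof (induction L)
  case (Suc L)
  have "relabel S r L = x L \<longleftrightarrow> r L \<in> wset S x L" if "\<forall>i<L. relabel S r i = x i"
  proof -
    have "released S r (L + 2) \<longleftrightarrow> \<not> alive x ((L + 2) div 2)"
      using released_iff_not_alive[of L S r x "L + 2"] that by auto
    then show ?thesis by (auto simp: relabel_def wset_def)
  qed
  then show ?case using Suc by (auto simp: less_Suc_eq)
qed simp

lemma alive_relabel:
  assumes "dendless S" "h \<in> S"
  shows "alive (relabel S r) h"
proof -
  have "relabel S r (h div 2 ^ j - 2) \<noteq> 1" if "2 \<le> h div 2 ^ j" for j
  proof -
    have "h div 2 ^ j \<in> S" using that by (intro dendless_div assms) auto
    moreover have "h div 2 ^ j - 2 + 2 = h div 2 ^ j" using that by simp
    ultimately show ?thesis by (simp add: relabel_def)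
  qed
  then show ?thesis by (simp add: alive_def)
qed

text \<open>Rolls below 4 kill a node outside S that has not been released. So staying alive outside
  S costs a factor 1/3 per level.\<close>

lemma relabel_dying:
  assumes "alive (relabel S r) h" "2 \<le> h" "h \<notin> S"
  shows "4 \<le> r (h - 2)"
proof -
  have "\<not> released S r h"
    using released_iff_not_alive[of h S r "relabel S r" h] alive_div[OF assms(1), of 1] by auto
  moreover have "relabel S r (h - 2) \<noteq> 1" using alive_rec[of _ h] assms(1,2) by blast
  moreover have "h - 2 + 2 = h" using assms(2) by simp
  ultimately show ?thesis using assms(3) unfolding relabel_def by (auto split: if_splits)
qed

text \<open>Some branch of length m shows only values from B on its levels n + 1 to m. It is applied
  to dice with B = {4..} and to labels with B = {2}; in both cases one value in three lies in B, and
  3^-(m - n) beats the number 2^m of branches.\<close>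

definition bad :: "nat set \<Rightarrow> nat \<Rightarrow> nat \<Rightarrow> (nat \<Rightarrow> nat) set" where
  "bad B n m = {r. \<exists>d. 2 ^ m \<le> d \<and> d < 2 ^ Suc m \<and> (\<forall>i<m - n. r (d div 2 ^ i - 2) \<in> B)}"

lemma bad_antimono:
  assumes "n \<le> m" "m \<le> m'"
  shows "bad B n m' \<subseteq> bad B n m"
proof
  fix r assume "r \<in> bad B n m'"
  then obtain d where d: "2 ^ m' \<le> d" "d < 2 ^ Suc m'" "\<And>i. i < m' - n \<Longrightarrow> r (d div 2 ^ i - 2) \<in> B"
    by (auto simp: bad_def)
  define e where "e = d div 2 ^ (m' - m)"
  have "2 ^ m \<le> e" "e < 2 ^ Suc m" using level_div[OF d(1,2), of "m' - m"] assms by (auto simp: e_def)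
  moreover have "r (e div 2 ^ i - 2) \<in> B" if "i < m - n" for i
    unfolding e_def div_pow2_add[symmetric] using d(3) that assms by auto
  ultimately show "r \<in> bad B n m" by (auto simp: bad_def)
qed

text \<open>If a node of level at most n lies outside S and has a living descendant on level m, then
  the levels n + 1 to m of that branch are outside S and alive, so by \<open>relabel_dying\<close>
  all their rolls are at least 4.\<close>

lemma alive_pre_relabel:
  assumes S: "dendless S" and nm: "n \<le> m" and r: "r \<notin> bad {4..} n m" and h: "h < 2 ^ Suc n"
  shows "h \<in> alive_pre m (relabel S r) \<longleftrightarrow> h \<in> S"
proof
  assume hS: "h \<in> S"
  then have "0 < h" using S by (rule dendless_pos[rotated])
  then obtain l where l: "2 ^ l \<le> h" "h < 2 ^ Suc l" using level_of by blast
  have "(2::nat) ^ l < 2 ^ Suc n" using l(1) h by linarith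
  then have "l < Suc n" unfolding pow2_less_iff .
  then have lm: "l \<le> m" using nm by simp
  obtain d where d: "d \<in> S" "d div 2 ^ (m - l) = h" using dendless_descendant[OF S hS] by blast
  show "h \<in> alive_pre m (relabel S r)" by (rule alive_preI[OF l lm d(2) alive_relabel[OF S d(1)]])
next
  assume "h \<in> alive_pre m (relabel S r)"
  then obtain d j where d: "2 ^ m \<le> d" "d < 2 ^ Suc m" "alive (relabel S r) d" "j \<le> m" "d div 2 ^ j = h"
    by (auto simp: alive_pre_def)
  have h0: "0 < h" using level_div(1)[OF d(1,2,4)] d(5) by (metis gr0I le_zero_eq power_eq_0_iff zero_neq_numeral)
  show "h \<in> S"
  proof (rule ccontr)
    assume hS: "h \<notin> S"
    have "4 \<le> r (d div 2 ^ i - 2)" if i: "i < m - n" for i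
    proof -
      let ?a = "d div 2 ^ i"
      have "2 ^ Suc n \<le> (2::nat) ^ (m - i)" using i by (intro power_increasing) auto
      then have a: "2 ^ Suc n \<le> ?a" using level_div(1)[OF d(1,2), of i] i by linarith
      have "i < j"
      proof (rule ccontr)
        assume "\<not> i < j"
        then have "?a = h div 2 ^ (i - j)" using div_pow2_add[of d j "i - j"] d(5) by simp
        then show False using a h div_le_dividend[of h "2 ^ (i - j)"] by linarith
      qed
      then have "?a div 2 ^ (j - i) = h" using div_pow2_add[of d i "j - i"] d(5) by simp
      then have "?a \<notin> S" using dendless_div[OF S, of ?a "j - i"] hS h0 by auto
      moreover have "2 \<le> (2::nat) ^ Suc n" using one_le_power[of "2::nat" n] by simp
      then have "2 \<le> ?a" using a by (rule le_trans)
      ultimately show ?thesis using relabel_dying[OF alive_div[OF d(3), of i]] by blast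
    qed
    then show False using r d(1,2) by (auto simp: bad_def)
  qed
qed

subsection \<open>Finite approximations of trees without dead ends\<close>

text \<open>Finite pruned trees with possible inner nodes 1 to H and possible leaves H + 1 to 2H +
  1. Cutting at an arbitrary heap index instead of a full level lets \<open>tree_weight\<close>
  proceed by opening a single node.\<close>

definition ftrees :: "nat \<Rightarrow> nat set set" where
  "ftrees H = {S. S \<subseteq> {1..2 * H + 1} \<and> (\<forall>h\<in>{1..H}. h \<in> S \<longleftrightarrow> 2 * h \<in> S \<or> Suc (2 * h) \<in> S)}"

lemma finite_ftrees: "finite (ftrees H)"
  by (rule finite_subset[of _ "Pow {1..2 * H + 1}"]) (auto simp: ftrees_def)

lemma ftreesD: "S \<in> ftrees H \<Longrightarrow> 0 < h \<Longrightarrow> h \<le> H \<Longrightarrow> h \<in> S \<longleftrightarrow> 2 * h \<in> S \<or> Suc (2 * h) \<in> S"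
  unfolding ftrees_def by auto

lemma ftrees_le: "S \<in> ftrees H \<Longrightarrow> h \<in> S \<Longrightarrow> 0 < h \<and> h \<le> 2 * H + 1"
  unfolding ftrees_def by fastforce

lemma dendless_ftrees: "dendless S \<Longrightarrow> S \<inter> {..2 * H + 1} \<in> ftrees H"
proof -
  assume S: "dendless S"
  have "h \<in> S \<inter> {..2 * H + 1} \<longleftrightarrow> 2 * h \<in> S \<inter> {..2 * H + 1} \<or> Suc (2 * h) \<in> S \<inter> {..2 * H + 1}"
    if "h \<in> {1..H}" for h
    using dendless_iff[OF S, of h] that by simp
  moreover have "S \<inter> {..2 * H + 1} \<subseteq> {1..2 * H + 1}" using dendless_pos[OF S] by (auto simp: Suc_le_eq)
  ultimately show ?thesis unfolding ftrees_def by blast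
qed

lemma ftrees_root:
  assumes "S \<in> ftrees H" "h \<in> S"
  shows "1 \<in> S"
  using assms(2)
proof (induction h rule: less_induct)
  case (less h)
  show ?case
  proof (cases "h = 1")
    case False
    have "0 < h" "h \<le> 2 * H + 1" using ftrees_le[OF assms(1) less.prems] by auto
    then have p: "0 < h div 2" "h div 2 \<le> H" "h div 2 < h" using False by auto
    have "h = 2 * (h div 2) \<or> h = Suc (2 * (h div 2))" by presburger
    then have "h div 2 \<in> S" using ftreesD[OF assms(1) p(1,2)] less.prems by metis
    then show ?thesis using less.IH p(3) by blast
  qed (use less.prems in simp)
qed

lemma ftrees_without_root: "S \<in> ftrees H \<Longrightarrow> 1 \<notin> S \<Longrightarrow> S = {}"
  using ftrees_root by blast

lemma empty_ftrees: "{} \<in> ftrees H"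
  by (simp add: ftrees_def)

text \<open>An inner node belongs to the tree exactly if some leaf below it does, so the set of
  leaves is arbitrary and determines the tree.\<close>

lemma bij_betw_ftrees: "bij_betw (\<lambda>S. S \<inter> {Suc H..2 * H + 1}) (ftrees H) (Pow {Suc H..2 * H + 1})"
proof -
  let ?F = "{Suc H..2 * H + 1}"
  have "inj_on (\<lambda>S. S \<inter> ?F) (ftrees H)"
  proof (rule inj_onI)
    fix S T assume S: "S \<in> ftrees H" and T: "T \<in> ftrees H" and eq: "S \<inter> ?F = T \<inter> ?F"
    have "h \<in> S \<longleftrightarrow> h \<in> T" if "0 < h" "h \<le> 2 * H + 1" for h
      using that
    proof (induction "2 * H + 1 - h" arbitrary: h rule: less_induct)
      case less
      show ?case
      proof (cases "h \<le> H")
        case True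
        then have "2 * h \<in> S \<longleftrightarrow> 2 * h \<in> T" "Suc (2 * h) \<in> S \<longleftrightarrow> Suc (2 * h) \<in> T"
          using less.hyps[of "2 * h"] less.hyps[of "Suc (2 * h)"] less.prems by simp_all
        then show ?thesis using ftreesD[OF S less.prems(1) True] ftreesD[OF T less.prems(1) True] by blast
      next
        case False
        then have "h \<in> ?F" using less.prems by auto
        then show ?thesis using eq by blast
      qed
    qed
    then show "S = T" using ftrees_le[OF S] ftrees_le[OF T] by blast
  qed
  moreover have "(\<lambda>S. S \<inter> ?F) ` ftrees H = Pow ?F"
  proof (intro equalityI subsetI)
    fix B assume B: "B \<in> Pow ?F"
    \<comment> \<open>The tree with leaf set B consists of all ancestors of B; the case j = 0
      contributes the leaves themselves.\<close>
    define S where "S = {a. 0 < a \<and> (\<exists>f\<in>B. \<exists>j. f div 2 ^ j = a)}"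
    have sub: "S \<subseteq> {1..2 * H + 1}"
    proof
      fix a assume "a \<in> S"
      then obtain f j where f: "f \<in> B" "f div 2 ^ j = a" "0 < a" by (auto simp: S_def)
      then have "a \<le> f" using div_le_dividend by blast
      moreover have "f \<le> 2 * H + 1" using f(1) B by auto
      ultimately show "a \<in> {1..2 * H + 1}" using f(3) by auto
    qed
    have "h \<in> S \<longleftrightarrow> 2 * h \<in> S \<or> Suc (2 * h) \<in> S" if h: "h \<in> {1..H}" for h
    proof
      assume "h \<in> S"
      then obtain f j where f: "f \<in> B" "f div 2 ^ j = h" by (auto simp: S_def)
      have "H < f" using f(1) B by auto
      then obtain i where j: "j = Suc i" using f(2) h by (cases j) auto
      have "f div 2 ^ i div 2 = h" using f(2) div_pow2_add[of f i 1] by (simp add: j)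
      then have "f div 2 ^ i = 2 * h \<or> f div 2 ^ i = Suc (2 * h)" by linarith
      then show "2 * h \<in> S \<or> Suc (2 * h) \<in> S" using f(1) h unfolding S_def by fastforce
    next
      have "h \<in> S" if "f \<in> B" "f div 2 ^ j = 2 * h \<or> f div 2 ^ j = Suc (2 * h)" for f j
      proof -
        have "f div 2 ^ Suc j = h" using that(2) div_pow2_add[of f j 1] by auto
        then show ?thesis using that(1) h unfolding S_def by fastforce
      qed
      moreover assume "2 * h \<in> S \<or> Suc (2 * h) \<in> S"
      ultimately show "h \<in> S" unfolding S_def by blast
    qed
    then have "S \<in> ftrees H" using sub by (auto simp: ftrees_def)
    moreover have "S \<inter> ?F = B"
    proof (intro equalityI subsetI)
      fix a assume a: "a \<in> S \<inter> ?F"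
      then obtain f j where f: "f \<in> B" "f div 2 ^ j = a" by (auto simp: S_def)
      have "j = 0"
      proof (rule ccontr)
        assume "j \<noteq> 0"
        then obtain i where "j = Suc i" by (cases j) auto
        then have "a = f div 2 div 2 ^ i" using f(2) by (simp only: div_pow2_Suc)
        then have "a \<le> f div 2" using div_le_dividend by blast
        moreover have "f \<le> 2 * H + 1" using f(1) B by auto
        ultimately show False using a by auto
      qed
      then show "a \<in> B" using f by simp
    next
      fix a assume "a \<in> B"
      moreover have "a div 2 ^ 0 = a" by simp
      ultimately show "a \<in> S \<inter> ?F" using B unfolding S_def by fastforce
    qed
    ultimately show "B \<in> (\<lambda>S. S \<inter> ?F) ` ftrees H" by blast
  qed auto
  ultimately show ?thesis by (simp add: bij_betw_def)
qed

subsection \<open>Weights\<close>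

text \<open>
  Survival has probability 3/4, extinction 1/4; a branch that has met the label 1 is dead with certainty.
\<close>

definition leafw :: "(nat \<Rightarrow> nat) \<Rightarrow> nat set \<Rightarrow> nat \<Rightarrow> real" where
  "leafw x S f = (if f \<in> S then (if alive x f then 3 / 4 else 0) else (if alive x f then 1 / 4 else 1))"

definition labw :: "(nat \<Rightarrow> nat) \<Rightarrow> nat set \<Rightarrow> nat \<Rightarrow> real" where
  "labw x S i = real (card (wset S x i \<inter> {0..<6})) / 6"

lemma card_filter_6: "card ({v. P v} \<inter> {0..<6}) = length (filter P [0..<6])"
proof -
  have "{v. P v} \<inter> {0..<6} = set (filter P [0..<6])" by auto
  then show ?thesis by (simp only: distinct_card[OF distinct_filter[OF distinct_upt]])
qed

text \<open>These are conditional probabilities. A surviving child has label 0 or 2 equally often. A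
  child of a living node fails to survive with probability 1/2: by label 1 (1/3), or by label 0 or 2
  followed by extinction (1/12 each); dividing gives 2/3, 1/6, 1/6. All values are multiples of 1/6,
  whence six faces.\<close>

lemma labw_eq:
  assumes "x i < 3"
  shows "labw x S i = (if i + 2 \<in> S then (if x i = 1 then 0 else 1 / 2)
     else if \<not> alive x ((i + 2) div 2) then 1 / 3 else if x i = 1 then 2 / 3 else 1 / 6)"
proof -
  have 6: "[0..<6] = [0, 1, 2, 3, 4, 5::nat]" by (simp add: upt_rec)
  consider "x i = 0" | "x i = 1" | "x i = 2" using assms by linarith
  then show ?thesis
    by cases (simp_all add: labw_def wset_def card_filter_6 6)
qed

text \<open>Bayes' rule at one branching. On the left: the status of h, its digit (1/3 if h is in
  the tree), and the two labels given the pattern. On the right: the two uniform labels (1/9) and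
  the status of the children given these labels.\<close>

lemma node_weight:
  assumes h: "0 < h" and x: "x (2 * h - 2) < 3" "x (2 * h - 1) < 3"
    and S: "h \<in> S \<longleftrightarrow> 2 * h \<in> S \<or> Suc (2 * h) \<in> S"
  shows "(if h \<in> S then 1 / 3 else 1) * labw x S (2 * h - 2) * labw x S (2 * h - 1) * leafw x S h =
    1 / 9 * leafw x S (2 * h) * leafw x S (Suc (2 * h))"
proof -
  have i: "2 * h - 2 + 2 = 2 * h" "2 * h - 1 + 2 = Suc (2 * h)" "Suc (2 * h) div 2 = h" using h by auto
  show ?thesis
    unfolding labw_eq[of x, OF x(1)] labw_eq[of x, OF x(2)] i leafw_def alive_even[OF h] alive_odd[OF h]
    using S by (cases "alive x h"; cases "2 * h \<in> S"; cases "Suc (2 * h) \<in> S"; simp)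
qed

text \<open>Opening one leaf at a time by \<open>node_weight\<close>. The factors
  \<open>4 / 3\<close> and \<open>4\<close> are the reciprocals of the root's own weight 3/4 or 1/4,
  since the left side is conditioned on whether the root survives.\<close>

lemma tree_weight:
  assumes "S \<in> ftrees H" "\<And>i. i < 2 * H \<Longrightarrow> x i < 3"
  shows "(1 / 3) ^ card (S \<inter> {1..H}) * (\<Prod>i<2 * H. labw x S i) =
    (if 1 \<in> S then 4 / 3 else 4) * (1 / 9) ^ H * (\<Prod>f=Suc H..2 * H + 1. leafw x S f)"
proof -
  have "(1 / 3) ^ card (S \<inter> {1..G}) * (\<Prod>i<2 * G. labw x S i) =
      (if 1 \<in> S then 4 / 3 else 4) * (1 / 9) ^ G * (\<Prod>f=Suc G..2 * G + 1. leafw x S f)" if "G \<le> H" for G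
    using that
  proof (induction G)
    case 0
    show ?case by (simp add: leafw_def)
  next
    case (Suc G)
    define h where "h = Suc G"
    have h: "0 < h" "h \<le> H" "2 * G = 2 * h - 2" "Suc (2 * G) = 2 * h - 1" using Suc.prems by (auto simp: h_def)
    \<comment> \<open>The leaves common to both stages: opening \<open>h\<close> removes it from the
      leaves and adds \<open>2 * h\<close> and \<open>Suc (2 * h)\<close>.\<close>
    define p where "p = (\<Prod>f=Suc h..2 * G + 1. leafw x S f)"
    let ?c = "if h \<in> S then 1 / 3 else 1 :: real"
    have nw: "?c * labw x S (2 * h - 2) * labw x S (2 * h - 1) * leafw x S h =
        1 / 9 * leafw x S (2 * h) * leafw x S (Suc (2 * h))"
      using assms h by (intro node_weight ftreesD) auto
    have c: "(1 / 3 :: real) ^ card (S \<inter> {1..Suc G}) = ?c * (1 / 3) ^ card (S \<inter> {1..G})"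
    proof -
      have "S \<inter> {1..Suc G} = (if h \<in> S then insert h (S \<inter> {1..G}) else S \<inter> {1..G})"
        by (auto simp: h_def le_Suc_eq)
      then show ?thesis by (simp add: h_def)
    qed
    have p1: "(\<Prod>f=Suc G..2 * G + 1. leafw x S f) = leafw x S h * p"
      unfolding p_def h_def by (subst prod.atLeast_Suc_atMost) auto
    have p2: "(\<Prod>f=Suc (Suc G)..2 * Suc G + 1. leafw x S f) = p * leafw x S (2 * h) * leafw x S (Suc (2 * h))"
      unfolding p_def h_def by (simp add: prod.nat_ivl_Suc')
    have l: "(\<Prod>i<2 * Suc G. labw x S i) = (\<Prod>i<2 * G. labw x S i) * labw x S (2 * h - 2) * labw x S (2 * h - 1)"
      unfolding h(3)[symmetric] h(4)[symmetric] by simp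
    have "(1 / 3) ^ card (S \<inter> {1..Suc G}) * (\<Prod>i<2 * Suc G. labw x S i) =
        (?c * labw x S (2 * h - 2) * labw x S (2 * h - 1)) *
        ((1 / 3) ^ card (S \<inter> {1..G}) * (\<Prod>i<2 * G. labw x S i))"
      unfolding c l by (simp only: mult_ac)
    also have "\<dots> = (?c * labw x S (2 * h - 2) * labw x S (2 * h - 1) * leafw x S h) *
        ((if 1 \<in> S then 4 / 3 else 4) * (1 / 9) ^ G * p)"
      using Suc.IH Suc.prems unfolding p1 by (simp only: mult_ac Suc_leD)
    also have "\<dots> = (if 1 \<in> S then 4 / 3 else 4) * (1 / 9) ^ Suc G * (p * leafw x S (2 * h) * leafw x S (Suc (2 * h)))"
      unfolding nw by simp
    finally show ?case unfolding p2 .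
  qed
  then show ?thesis by blast
qed

text \<open>Given the labels, leaves are in or out independently, and the two weights of a leaf sum
  to 1 whether it is alive (3/4 + 1/4) or dead (0 + 1).\<close>

lemma sum_ftrees_leafw:
  "(\<Sum>S\<in>ftrees H. \<Prod>f=Suc H..2 * H + 1. leafw x S f) = 1"
proof -
  let ?F = "{Suc H..2 * H + 1}"
  let ?a = "\<lambda>f. if alive x f then 3 / 4 else 0 :: real"
  let ?b = "\<lambda>f. if alive x f then 1 / 4 else 1 :: real"
  have "(\<Sum>S\<in>ftrees H. \<Prod>f\<in>?F. leafw x S f) = (\<Sum>S\<in>ftrees H. \<Prod>f\<in>?F. leafw x (S \<inter> ?F) f)"
    by (intro sum.cong prod.cong refl) (simp add: leafw_def)
  also have "\<dots> = (\<Sum>B\<in>Pow ?F. \<Prod>f\<in>?F. leafw x B f)"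
    by (rule sum.reindex_bij_betw[OF bij_betw_ftrees])
  also have "\<dots> = (\<Sum>B\<in>Pow ?F. (\<Prod>f\<in>B. ?a f) * (\<Prod>f\<in>?F - B. ?b f))"
  proof (rule sum.cong[OF refl])
    fix B assume B: "B \<in> Pow ?F"
    have "(\<Prod>f\<in>?F. leafw x B f) = (\<Prod>f\<in>B. leafw x B f) * (\<Prod>f\<in>?F - B. leafw x B f)"
      using B prod.subset_diff[of B ?F "leafw x B"] by (simp add: mult.commute)
    also have "(\<Prod>f\<in>B. leafw x B f) = (\<Prod>f\<in>B. ?a f)" by (intro prod.cong refl) (simp add: leafw_def)
    also have "(\<Prod>f\<in>?F - B. leafw x B f) = (\<Prod>f\<in>?F - B. ?b f)" by (intro prod.cong refl) (simp add: leafw_def)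
    finally show "(\<Prod>f\<in>?F. leafw x B f) = (\<Prod>f\<in>B. ?a f) * (\<Prod>f\<in>?F - B. ?b f)" .
  qed
  also have "\<dots> = (\<Prod>f\<in>?F. ?a f + ?b f)" by (rule prod_add[symmetric]) simp
  also have "\<dots> = 1" by (intro prod.neutral) auto
  finally show ?thesis .
qed

text \<open>Turns a beginning of the tree into conditions on single digits, one for each inner node
  of S; this makes its probability a power of 1/3.\<close>

lemma Tset_trunc_iff:
  assumes S: "S \<in> ftrees H" "1 \<in> S"
  shows "Tset z \<inter> {..2 * H + 1} = S \<longleftrightarrow> (\<forall>h\<in>S \<inter> {1..H}. min (z (rank S h)) 2 = kids S h)"
proof
  assume eq: "Tset z \<inter> {..2 * H + 1} = S"
  show "\<forall>h\<in>S \<inter> {1..H}. min (z (rank S h)) 2 = kids S h"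
  proof
    fix h assume h: "h \<in> S \<inter> {1..H}"
    have "kids (Tset z) h = min (z (rank (Tset z) h)) 2"
      using is_code_kids[OF is_code_Tset, of h z] eq h by auto
    moreover have "kids (Tset z) h = kids S h" using eq h by (auto simp: kids_def)
    moreover have "Tset z \<inter> {..<h} = S \<inter> {..<h}" using eq h by auto
    ultimately show "min (z (rank S h)) 2 = kids S h" by simp
  qed
next
  assume z: "\<forall>h\<in>S \<inter> {1..H}. min (z (rank S h)) 2 = kids S h"
  have T: "is_code z (Tset z)" by (rule is_code_Tset)
  have "h \<in> Tset z \<longleftrightarrow> h \<in> S" if "h \<le> 2 * H + 1" for h
    using that
  proof (induction h rule: less_induct)
    case (less h)
    show ?case
    proof (cases "h \<le> 1")
      case True
      have "0 \<notin> S" using ftrees_le[OF S(1)] by blast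
      then show ?thesis using True T S(2) by (cases h) (auto simp: is_code_def)
    next
      case False
      define p where "p = h div 2"
      have p: "0 < p" "p \<le> H" "p < h" using False less.prems by (auto simp: p_def)
      have IH: "p \<in> Tset z \<longleftrightarrow> p \<in> S" using less.IH[of p] p by simp
      have "Tset z \<inter> {..<p} = S \<inter> {..<p}" using less.IH p by auto
      then have r: "rank (Tset z) p = rank S p" by simp
      have "(2 * p \<in> Tset z \<longleftrightarrow> 2 * p \<in> S) \<and> (Suc (2 * p) \<in> Tset z \<longleftrightarrow> Suc (2 * p) \<in> S)"
      proof (cases "p \<in> S")
        case True
        then have "min (z (rank S p)) 2 = kids S p" using z p by auto
        moreover have "2 * p \<in> S \<or> Suc (2 * p) \<in> S" using ftreesD[OF S(1) p(1,2)] True by blast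
        moreover have "2 * p \<in> Tset z \<longleftrightarrow> z (rank S p) \<noteq> 1" "Suc (2 * p) \<in> Tset z \<longleftrightarrow> z (rank S p) \<noteq> 0"
          using T p(1) r IH True unfolding is_code_def by simp_all
        ultimately show ?thesis by (auto simp: kids_def min_def split: if_splits)
      next
        case False
        then show ?thesis using ftreesD[OF S(1) p(1,2)] T p(1) IH unfolding is_code_def by auto
      qed
      moreover have "h = 2 * p \<or> h = Suc (2 * p)" unfolding p_def by presburger
      ultimately show ?thesis by blast
    qed
  qed
  then show "Tset z \<inter> {..2 * H + 1} = S" using ftrees_le[OF S(1)] by blast
qed

lemma released_cong:
  assumes "S \<inter> {..M} = T \<inter> {..M}" "\<And>i. i + 2 \<le> M \<Longrightarrow> r i = s i" "h \<le> Suc M"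
  shows "released S r h \<longleftrightarrow> released T s h"
proof -
  have "a \<in> S \<longleftrightarrow> a \<in> T" if "a \<le> M" for a using assms(1) that by blast
  moreover have "r (a - 2) = s (a - 2)" if "2 \<le> a" "a \<le> M" for a using assms(2)[of "a - 2"] that by simp
  moreover have "h div 2 ^ Suc j \<le> M" for j
  proof -
    have "h div 2 ^ Suc j \<le> h div 2" unfolding div_pow2_Suc by (rule div_le_dividend)
    then show ?thesis using assms(3) by linarith
  qed
  ultimately show ?thesis unfolding released_def by metis
qed

lemma relabel_cong:
  assumes "S \<inter> {..i + 2} = T \<inter> {..i + 2}" "\<And>k. k \<le> i \<Longrightarrow> r k = s k"
  shows "relabel S r i = relabel T s i"
proof -
  have "released S r (i + 2) \<longleftrightarrow> released T s (i + 2)" using assms by (intro released_cong[of _ "i + 2"]) auto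
  moreover have "i + 2 \<in> S \<longleftrightarrow> i + 2 \<in> T" using assms(1) by blast
  ultimately show ?thesis using assms(2)[of i] by (simp add: relabel_def)
qed

lemma Tset_cong:
  assumes "\<And>i. i < H \<Longrightarrow> z i = z' i"
  shows "Tset z \<inter> {..2 * H + 1} = Tset z' \<inter> {..2 * H + 1}"
proof -
  let ?S = "Tset z \<inter> {..2 * H + 1}"
  have S: "?S \<in> ftrees H" by (rule dendless_ftrees[OF is_code_dendless[OF is_code_Tset]])
  have 1: "1 \<in> ?S" using is_code_Tset[of z] by (simp add: is_code_def)
  \<comment> \<open>Since 0 is not a node, h has at most h - 1 predecessors, so digits from position
    H on are not consulted.\<close>
  have "rank ?S h < H" if "h \<in> {1..H}" for h
  proof -
    have "?S \<inter> {..<h} \<subseteq> {1..<h}" using ftrees_le[OF S] by (auto simp: Suc_le_eq)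
    then have "rank ?S h \<le> card {1..<h}" by (intro card_mono) auto
    then show ?thesis using that by auto
  qed
  then have "\<forall>h\<in>?S \<inter> {1..H}. min (z' (rank ?S h)) 2 = kids ?S h"
    using Tset_trunc_iff[OF S 1, of z] assms by (metis (no_types, lifting) IntD2)
  then show ?thesis using Tset_trunc_iff[OF S 1, of z'] by simp
qed

subsection \<open>Uniform measures on sequences\<close>

definition unifq :: "nat \<Rightarrow> (nat \<Rightarrow> nat) measure" where
  "unifq q = (\<Pi>\<^sub>M i\<in>(UNIV::nat set). measure_pmf (pmf_of_set {0..<q}))"

lemma lambda3_unifq: "lambda3 = unifq 3"
  by (simp add: lambda3_def unifq_def)

lemma product_prob_space_unif: "product_prob_space (\<lambda>_::nat. measure_pmf (pmf_of_set {0..<q::nat}))"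
  by unfold_locales

lemma prob_space_unifq: "prob_space (unifq q)"
  unfolding unifq_def by (intro prob_space_PiM prob_space_measure_pmf)

lemma space_unifq [simp]: "space (unifq q) = UNIV"
  by (simp add: unifq_def space_PiM)

lemma box_sets:
  assumes "finite J"
  shows "{x. \<forall>i\<in>J. x i \<in> B i} \<in> sets (unifq q)"
proof -
  have "{x. \<forall>i\<in>J. x i \<in> B i} = prod_emb UNIV (\<lambda>_::nat. measure_pmf (pmf_of_set {0..<q::nat})) J (Pi\<^sub>E J B)"
    by (auto simp: prod_emb_def Pi_iff)
  then show ?thesis unfolding unifq_def using assms by (simp add: sets_PiM_I)
qed

lemma measure_box:
  assumes "finite J" "0 < q"
  shows "measure (unifq q) {x. \<forall>i\<in>J. x i \<in> B i} = (\<Prod>i\<in>J. real (card (B i \<inter> {0..<q})) / real q)"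
proof -
  interpret P: product_prob_space "\<lambda>_::nat. measure_pmf (pmf_of_set {0..<q::nat})" UNIV
    by (rule product_prob_space_unif)
  have "{x. \<forall>i\<in>J. x i \<in> B i} = prod_emb UNIV (\<lambda>_::nat. measure_pmf (pmf_of_set {0..<q::nat})) J (Pi\<^sub>E J B)"
    by (auto simp: prod_emb_def Pi_iff)
  then have "measure (unifq q) {x. \<forall>i\<in>J. x i \<in> B i} = (\<Prod>i\<in>J. measure (measure_pmf (pmf_of_set {0..<q})) (B i))"
    unfolding unifq_def using assms by (simp add: P.measure_PiM_emb)
  also have "\<dots> = (\<Prod>i\<in>J. real (card (B i \<inter> {0..<q})) / real q)"
    using assms by (intro prod.cong refl) (simp add: measure_pmf_of_set Int_commute)
  finally show ?thesis .
qed

definition Cyl :: "nat \<Rightarrow> (nat \<Rightarrow> nat) \<Rightarrow> (nat \<Rightarrow> nat) set" where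
  "Cyl n x = {y. \<forall>i<n. y i = x i}"

lemma Cyl_sets: "Cyl n x \<in> sets (unifq q)"
  using box_sets[of "{..<n}" "\<lambda>i. {x i}" q] by (simp add: Cyl_def Ball_def)

definition ext :: "nat list \<Rightarrow> nat \<Rightarrow> nat" where
  "ext \<tau> i = (if i < length \<tau> then \<tau> ! i else 0)"

lemma cyl_Cyl: "cyl \<tau> = Cyl (length \<tau>) (ext \<tau>)"
  by (auto simp: cyl_def Cyl_def ext_def)

lemma cyl_sets: "cyl \<tau> \<in> sets (unifq q)"
  unfolding cyl_Cyl by (rule Cyl_sets)

lemma ext_map: "i < n \<Longrightarrow> ext (map x [0..<n]) i = x i"
  by (simp add: ext_def)

lemma string_union_sets: "string_union W i \<in> sets (unifq q)"
proof -
  have "string_union W i = (\<Union>\<sigma>\<in>{\<sigma>. set \<sigma> \<subseteq> {0..<3} \<and> prod_encode (i, list_encode \<sigma>) \<in> W}. cyl \<sigma>)"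
    by (auto simp: string_union_def)
  then show ?thesis by (auto intro!: sets.countable_UN' cyl_sets)
qed

text \<open>An event that depends on finitely many coordinates is a union of rectangles of
  cylinders, indexed by the countably many pairs of finite strings.\<close>

lemma pair_finite_dep_sets:
  assumes "\<And>z z' r r'. P z r \<Longrightarrow> (\<And>i. i < n \<Longrightarrow> z i = z' i) \<Longrightarrow> (\<And>i. i < n \<Longrightarrow> r i = r' i) \<Longrightarrow> P z' r'"
  shows "{(z, r). P z r} \<in> sets (unifq p \<Otimes>\<^sub>M unifq q)"
proof -
  let ?I = "{v. length (fst v) = n \<and> length (snd v) = n \<and> P (ext (fst v)) (ext (snd v))}"
  let ?C = "\<lambda>v. Cyl n (ext (fst v)) \<times> Cyl n (ext (snd v))"
  have "{(z, r). P z r} = (\<Union>v\<in>?I. ?C v)"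
  proof (intro equalityI subsetI)
    fix u assume "u \<in> {(z, r). P z r}"
    then have u: "P (fst u) (snd u)" by (simp add: case_prod_beta)
    let ?v = "(map (fst u) [0..<n], map (snd u) [0..<n])"
    have "P (ext (fst ?v)) (ext (snd ?v))" by (rule assms[OF u]) (simp_all add: ext_map)
    then have "?v \<in> ?I" by simp
    moreover have "u \<in> ?C ?v" by (simp add: mem_Times_iff Cyl_def ext_map)
    ultimately show "u \<in> (\<Union>v\<in>?I. ?C v)" by (rule UN_I)
  next
    fix u assume "u \<in> (\<Union>v\<in>?I. ?C v)"
    then obtain v where v: "v \<in> ?I" "u \<in> ?C v" by (rule UN_E)
    have "P (fst u) (snd u)"
    proof (rule assms)
      show "P (ext (fst v)) (ext (snd v))" using v(1) by simp
    qed (use v(2) in \<open>simp_all add: mem_Times_iff Cyl_def\<close>)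
    then show "u \<in> {(z, r). P z r}" by (simp add: case_prod_beta)
  qed
  moreover have "(\<Union>v\<in>?I. ?C v) \<in> sets (unifq p \<Otimes>\<^sub>M unifq q)"
    by (rule sets.countable_UN''[OF countableI_type]) (intro pair_measureI Cyl_sets)
  ultimately show ?thesis by simp
qed

text \<open>Even lengths only: the inner nodes 1 to H have exactly 2H labelled children, and only
  for these cylinders is the law of the mixture computed. They still form an intersection-stable
  generator.\<close>

definition evcyls :: "(nat \<Rightarrow> nat) set set" where
  "evcyls = insert {} {Cyl (2 * H) x |H x. True}"

lemma Cyl_Int: "n \<le> m \<Longrightarrow> Cyl n x \<inter> Cyl m y = (if \<forall>i<n. x i = y i then Cyl m y else {})"
  by (auto simp: Cyl_def)

lemma Int_stable_evcyls: "Int_stable evcyls"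
proof (rule Int_stableI)
  fix a b assume "a \<in> evcyls" "b \<in> evcyls"
  then consider "a = {} \<or> b = {}" | H x K y where "a = Cyl (2 * H) x" "b = Cyl (2 * K) y"
    by (auto simp: evcyls_def)
  then show "a \<inter> b \<in> evcyls"
  proof cases
    case (2 H x K y)
    show ?thesis
    proof (cases "H \<le> K")
      case True
      then show ?thesis using Cyl_Int[of "2 * H" "2 * K" x y] 2 by (auto simp: evcyls_def)
    next
      case False
      then show ?thesis using Cyl_Int[of "2 * K" "2 * H" y x] 2 by (auto simp: evcyls_def Int_commute)
    qed
  qed (auto simp: evcyls_def)
qed

lemma sets_unifq_evcyls: "sets (unifq q) = sigma_sets UNIV evcyls"
proof
  have "sigma_sets (space (unifq q)) evcyls \<subseteq> sets (unifq q)"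
    by (rule sets.sigma_sets_subset) (auto simp: evcyls_def Cyl_sets)
  then show "sigma_sets UNIV evcyls \<subseteq> sets (unifq q)" by simp
  interpret S: sigma_algebra UNIV "sigma_sets UNIV evcyls"
    by (rule sigma_algebra_sigma_sets) (rule subset_UNIV[of evcyls, folded Pow_UNIV])
  have "{f :: nat \<Rightarrow> nat. f i \<in> A} \<in> sigma_sets UNIV evcyls" for i A
  proof -
    have "{f :: nat \<Rightarrow> nat. f i \<in> A} = (\<Union>\<tau>\<in>{\<tau>. length \<tau> = 2 * Suc i \<and> \<tau> ! i \<in> A}. Cyl (2 * Suc i) (ext \<tau>))"
    proof (intro equalityI subsetI)
      fix f assume f: "f \<in> {f :: nat \<Rightarrow> nat. f i \<in> A}"
      let ?t = "map f [0..<2 * Suc i]"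
      have "f \<in> Cyl (2 * Suc i) (ext ?t)" unfolding Cyl_def by (auto simp: ext_map simp del: upt_Suc)
      moreover have "length ?t = 2 * Suc i" "?t ! i \<in> A" using f by (auto simp del: upt_Suc)
      ultimately show "f \<in> (\<Union>\<tau>\<in>{\<tau>. length \<tau> = 2 * Suc i \<and> \<tau> ! i \<in> A}. Cyl (2 * Suc i) (ext \<tau>))" by blast
    qed (auto simp: Cyl_def ext_def)
    also have "\<dots> \<in> sigma_sets UNIV evcyls"
    proof (rule S.countable_UN')
      have "Cyl (2 * H) x \<in> sigma_sets UNIV evcyls" for H x
        by (rule sigma_sets.Basic) (unfold evcyls_def, blast)
      then show "(\<lambda>\<tau>. Cyl (2 * Suc i) (ext \<tau>)) ` {\<tau>. length \<tau> = 2 * Suc i \<and> \<tau> ! i \<in> A} \<subseteq> sigma_sets UNIV evcyls"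
        by blast
    qed auto
    finally show ?thesis .
  qed
  then have "{{f :: nat \<Rightarrow> nat. f i \<in> A} |i A. True} \<subseteq> sigma_sets UNIV evcyls" by blast
  then have "sigma_sets UNIV {{f :: nat \<Rightarrow> nat. f i \<in> A} |i A. True} \<subseteq> sigma_sets UNIV evcyls"
    by (rule S.sigma_sets_subset)
  then show "sets (unifq q) \<subseteq> sigma_sets UNIV evcyls"
    unfolding unifq_def sets_PiM_single by (simp add: PiE_UNIV_domain)
qed

subsection \<open>The law of the relabelled tree\<close>

lemma measure_pair_Times:
  assumes "prob_space M" "prob_space N" "A \<in> sets M" "B \<in> sets N"
  shows "measure (M \<Otimes>\<^sub>M N) (A \<times> B) = measure M A * measure N B"
proof -
  interpret N: prob_space N by fact
  show ?thesis using assms(3,4) by (simp add: measure_def N.emeasure_pair_measure_Times enn2real_mult)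
qed

abbreviation zr :: "((nat \<Rightarrow> nat) \<times> (nat \<Rightarrow> nat)) measure" where
  "zr \<equiv> unifq 3 \<Otimes>\<^sub>M unifq 6"

text \<open>The additional coin decides whether the root survives.\<close>

abbreviation bzr :: "(bool \<times> (nat \<Rightarrow> nat) \<times> (nat \<Rightarrow> nat)) measure" where
  "bzr \<equiv> measure_pmf (bernoulli_pmf (3 / 4)) \<Otimes>\<^sub>M zr"

definition mix :: "bool \<times> (nat \<Rightarrow> nat) \<times> (nat \<Rightarrow> nat) \<Rightarrow> nat \<Rightarrow> nat" where
  "mix = (\<lambda>(b, z, r). relabel (if b then Tset z else {}) r)"

lemma prob_space_zr: "prob_space zr"
  by (intro prob_space_pair prob_space_unifq)

lemma prob_space_bzr: "prob_space bzr"
  by (intro prob_space_pair prob_space_zr prob_space_measure_pmf)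

lemma relabel_Tset_cong:
  assumes "i < 2 * H" "\<And>k. k < 2 * H \<Longrightarrow> z k = z' k" "\<And>k. k < 2 * H \<Longrightarrow> r k = r' k"
  shows "relabel (Tset z) r i = relabel (Tset z') r' i"
proof (rule relabel_cong)
  have "Tset z \<inter> {..2 * H + 1} = Tset z' \<inter> {..2 * H + 1}" using assms(2) by (intro Tset_cong) auto
  then have "Tset z \<inter> {..2 * H + 1} \<inter> {..i + 2} = Tset z' \<inter> {..2 * H + 1} \<inter> {..i + 2}" by simp
  moreover have "{..2 * H + 1} \<inter> {..i + 2} = {..i + 2}" using assms(1) by auto
  ultimately show "Tset z \<inter> {..i + 2} = Tset z' \<inter> {..i + 2}" by (simp only: Int_assoc)
qed (use assms in auto)

lemma relabel_Tset_Cyl_sets: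
  "{(z, r). relabel (Tset z) r \<in> Cyl (2 * H) x} \<in> sets zr"
proof (rule pair_finite_dep_sets[of _ "2 * H"])
  fix z z' r r' :: "nat \<Rightarrow> nat"
  assume *: "relabel (Tset z) r \<in> Cyl (2 * H) x" "\<And>i. i < 2 * H \<Longrightarrow> z i = z' i" "\<And>i. i < 2 * H \<Longrightarrow> r i = r' i"
  have "relabel (Tset z) r i = relabel (Tset z') r' i" if "i < 2 * H" for i
    by (rule relabel_Tset_cong[OF that *(2,3)])
  then show "relabel (Tset z') r' \<in> Cyl (2 * H) x"
    using *(1) by (simp add: Cyl_def)
qed

lemma relabel_Cyl_box: "relabel S r \<in> Cyl n x \<longleftrightarrow> r \<in> {r. \<forall>i\<in>{..<n}. r i \<in> wset S x i}"
  using relabel_box[of n S r x] by (simp add: Cyl_def Ball_def)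

lemma relabel_empty_Cyl_sets: "{r. relabel {} r \<in> Cyl n x} \<in> sets (unifq 6)"
  unfolding relabel_Cyl_box using box_sets[of "{..<n}"] by simp

lemma measure_relabel_Cyl:
  "measure (unifq 6) {r. relabel S r \<in> Cyl n x} = (\<Prod>i<n. labw x S i)"
  unfolding relabel_Cyl_box by (simp add: measure_box labw_def)

lemma measure_Tset:
  assumes S: "S \<in> ftrees H" "1 \<in> S"
  shows "{z. Tset z \<inter> {..2 * H + 1} = S} \<in> sets (unifq 3)"
    and "measure (unifq 3) {z. Tset z \<inter> {..2 * H + 1} = S} = (1 / 3) ^ card (S \<inter> {1..H})"
proof -
  let ?J = "rank S ` (S \<inter> {1..H})"
  have inj: "inj_on (rank S) (S \<inter> {1..H})" by (intro inj_onI) (auto dest: rank_inj)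
  \<comment> \<open>Injectivity of ranks is enough here, so \<open>code_of\<close> can be applied to
    the finite S; it names the prescribed digit by its position.\<close>
  have code: "code_of S (rank S h) = kids S h" if "h \<in> S" for h
  proof -
    have "(SOME a. a \<in> S \<and> rank S a = rank S h) = h"
      by (rule some_equality) (use that rank_inj in auto)
    then show ?thesis by (simp add: code_of_def)
  qed
  have eq: "{z. Tset z \<inter> {..2 * H + 1} = S} = {z. \<forall>j\<in>?J. z j \<in> {v. min v 2 = code_of S j}}"
    unfolding Tset_trunc_iff[OF S] by (auto simp: code)
  show "{z. Tset z \<inter> {..2 * H + 1} = S} \<in> sets (unifq 3)"
    unfolding eq by (rule box_sets) simp
  have "{v. min v 2 = c} \<inter> {0..<3} = {c}" if "c < 3" for c :: nat using that by (auto simp: min_def)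
  then have c: "card ({v. min v 2 = code_of S j} \<inter> {0..<3}) = 1" for j
    using code_of_less[of S j] by simp
  have "finite ?J" by simp
  then have "measure (unifq 3) {z. Tset z \<inter> {..2 * H + 1} = S} = (\<Prod>j\<in>?J. 1 / 3)"
    unfolding eq by (simp only: measure_box[of _ 3] c zero_less_numeral of_nat_1 of_nat_numeral)
  also have "\<dots> = (1 / 3) ^ card (S \<inter> {1..H})" using card_image[OF inj] by simp
  finally show "measure (unifq 3) {z. Tset z \<inter> {..2 * H + 1} = S} = (1 / 3) ^ card (S \<inter> {1..H})" .
qed

text \<open>Total probability over the beginnings S of the tree. The prior of the root cancels the
  factor from \<open>tree_weight\<close>: 3/4 * 4/3 = 1/4 * 4 = 1. What remains is (1/9)^H times a
  sum of leaf weights, which is 1.\<close>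

lemma measure_mix_Cyl:
  assumes x: "\<And>i. i < 2 * H \<Longrightarrow> x i < 3"
  shows "3 / 4 * measure zr {(z, r). relabel (Tset z) r \<in> Cyl (2 * H) x} +
     1 / 4 * measure (unifq 6) {r. relabel {} r \<in> Cyl (2 * H) x} = (1 / 9) ^ H"
proof -
  interpret Z: prob_space zr by (rule prob_space_zr)
  let ?R = "\<lambda>S. {r. relabel S r \<in> Cyl (2 * H) x}"
  let ?A = "\<lambda>S. {z. Tset z \<inter> {..2 * H + 1} = S}"
  let ?V = "ftrees H - {{}}"
  let ?lw = "\<lambda>S. \<Prod>f=Suc H..2 * H + 1. leafw x S f"
  have root: "1 \<in> S" if "S \<in> ?V" for S using ftrees_without_root that by blast
  have R_sets: "?R S \<in> sets (unifq 6)" for S unfolding relabel_Cyl_box using box_sets[of "{..<2 * H}"] by simp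
  have "{(z, r). relabel (Tset z) r \<in> Cyl (2 * H) x} = (\<Union>S\<in>?V. ?A S \<times> ?R S)"
  proof (intro equalityI subsetI)
    fix u assume "u \<in> {(z, r). relabel (Tset z) r \<in> Cyl (2 * H) x}"
    then obtain z r where u: "u = (z, r)" "relabel (Tset z) r \<in> Cyl (2 * H) x" by blast
    let ?S = "Tset z \<inter> {..2 * H + 1}"
    have "?S \<in> ftrees H" by (rule dendless_ftrees[OF is_code_dendless[OF is_code_Tset]])
    moreover have "1 \<in> ?S" using is_code_Tset[of z] by (simp add: is_code_def)
    moreover have "relabel ?S r i = relabel (Tset z) r i" if "i < 2 * H" for i
      using that by (intro relabel_cong) auto
    ultimately show "u \<in> (\<Union>S\<in>?V. ?A S \<times> ?R S)" using u by (auto simp: Cyl_def)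
  next
    fix u assume "u \<in> (\<Union>S\<in>?V. ?A S \<times> ?R S)"
    then obtain z r S where u: "u = (z, r)" "Tset z \<inter> {..2 * H + 1} = S" "relabel S r \<in> Cyl (2 * H) x" by blast
    have "relabel S r i = relabel (Tset z) r i" if "i < 2 * H" for i
      using that u(2) by (intro relabel_cong) auto
    then show "u \<in> {(z, r). relabel (Tset z) r \<in> Cyl (2 * H) x}" using u by (auto simp: Cyl_def)
  qed
  then have "measure zr {(z, r). relabel (Tset z) r \<in> Cyl (2 * H) x} = measure zr (\<Union>S\<in>?V. ?A S \<times> ?R S)"
    by (rule arg_cong)
  also have "\<dots> = (\<Sum>S\<in>?V. measure zr (?A S \<times> ?R S))"
  proof (rule Z.finite_measure_finite_Union)
    show "finite ?V" using finite_ftrees by blast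
    have "?A S \<times> ?R S \<in> sets zr" if "S \<in> ?V" for S
      using that root[OF that] by (intro pair_measureI R_sets measure_Tset(1)) blast+
    then show "(\<lambda>S. ?A S \<times> ?R S) ` ?V \<subseteq> sets zr" by blast
    show "disjoint_family_on (\<lambda>S. ?A S \<times> ?R S) ?V" unfolding disjoint_family_on_def by blast
  qed
  also have "\<dots> = (\<Sum>S\<in>?V. (1 / 3) ^ card (S \<inter> {1..H}) * (\<Prod>i<2 * H. labw x S i))"
  proof (rule sum.cong[OF refl])
    fix S assume S: "S \<in> ?V"
    have "measure zr (?A S \<times> ?R S) = measure (unifq 3) (?A S) * measure (unifq 6) (?R S)"
      using S root[OF S] by (intro measure_pair_Times prob_space_unifq R_sets measure_Tset(1)) blast+
    also have "\<dots> = (1 / 3) ^ card (S \<inter> {1..H}) * (\<Prod>i<2 * H. labw x S i)"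
      using S root[OF S] measure_Tset(2)[of S H] measure_relabel_Cyl[of S "2 * H" x] by simp
    finally show "measure zr (?A S \<times> ?R S) = (1 / 3) ^ card (S \<inter> {1..H}) * (\<Prod>i<2 * H. labw x S i)" .
  qed
  also have "\<dots> = (\<Sum>S\<in>?V. 4 / 3 * (1 / 9) ^ H * ?lw S)"
  proof (rule sum.cong[OF refl])
    fix S assume S: "S \<in> ?V"
    then have "S \<in> ftrees H" by blast
    from tree_weight[OF this x] root[OF S]
    show "(1 / 3) ^ card (S \<inter> {1..H}) * (\<Prod>i<2 * H. labw x S i) = 4 / 3 * (1 / 9) ^ H * ?lw S" by simp
  qed
  finally have E1: "measure zr {(z, r). relabel (Tset z) r \<in> Cyl (2 * H) x} = 4 / 3 * (1 / 9) ^ H * (\<Sum>S\<in>?V. ?lw S)"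
    by (simp only: sum_distrib_left)
  have E0: "measure (unifq 6) {r. relabel {} r \<in> Cyl (2 * H) x} = 4 * (1 / 9) ^ H * ?lw {}"
    using tree_weight[OF empty_ftrees x] by (simp add: measure_relabel_Cyl)
  have "(\<Sum>S\<in>?V. ?lw S) + ?lw {} = 1"
    using sum_ftrees_leafw[where H = H and x = x] sum.remove[OF finite_ftrees empty_ftrees, of ?lw H]
    by linarith
  then have "(1 / 9) ^ H * ((\<Sum>S\<in>?V. ?lw S) + ?lw {}) = (1 / 9) ^ H" by (simp only: mult_1_right)
  then show ?thesis unfolding E1 E0 by (simp only: distrib_left)
qed

lemma mix_preimage_sets:
  assumes "{(z, r). relabel (Tset z) r \<in> V} \<in> sets zr" "{r. relabel {} r \<in> V} \<in> sets (unifq 6)"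
  shows "mix -` V \<in> sets bzr"
    and "emeasure bzr (mix -` V) = ennreal (3 / 4) * emeasure zr {(z, r). relabel (Tset z) r \<in> V} +
      ennreal (1 / 4) * emeasure (unifq 6) {r. relabel {} r \<in> V}"
proof -
  interpret U: prob_space "unifq 6" by (rule prob_space_unifq)
  interpret U3: prob_space "unifq 3" by (rule prob_space_unifq)
  interpret Z: prob_space zr by (rule prob_space_zr)
  let ?T = "{True} \<times> {(z, r). relabel (Tset z) r \<in> V}"
  let ?F = "{False} \<times> (UNIV \<times> {r. relabel {} r \<in> V})"
  have eq: "mix -` V = ?T \<union> ?F"
  proof (intro equalityI subsetI)
    fix u assume "u \<in> mix -` V"
    then show "u \<in> ?T \<union> ?F" by (cases u; cases "fst u") (auto simp: mix_def)
  qed (auto simp: mix_def)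
  have UN: "UNIV \<in> sets (unifq 3)" using sets.top[of "unifq 3"] by simp
  have s: "?T \<in> sets bzr" "?F \<in> sets bzr" "UNIV \<times> {r. relabel {} r \<in> V} \<in> sets zr"
    using assms UN by (auto intro!: pair_measureI)
  then show "mix -` V \<in> sets bzr" by (simp add: eq)
  have "emeasure bzr (mix -` V) = emeasure bzr ?T + emeasure bzr ?F"
    unfolding eq using s by (intro plus_emeasure[symmetric]) auto
  also have "emeasure bzr ?T = ennreal (3 / 4) * emeasure zr {(z, r). relabel (Tset z) r \<in> V}"
    using assms by (subst Z.emeasure_pair_measure_Times) (auto simp: emeasure_pmf_single)
  also have "emeasure bzr ?F = ennreal (1 / 4) * emeasure (unifq 6) {r. relabel {} r \<in> V}"
    using assms s(3) UN U3.emeasure_space_1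
    by (subst Z.emeasure_pair_measure_Times) (auto simp: emeasure_pmf_single U.emeasure_pair_measure_Times)
  finally show "emeasure bzr (mix -` V) = ennreal (3 / 4) * emeasure zr {(z, r). relabel (Tset z) r \<in> V} +
      ennreal (1 / 4) * emeasure (unifq 6) {r. relabel {} r \<in> V}" .
qed

lemma space_bzr: "space bzr = UNIV"
  by (simp add: space_pair_measure)

lemma measurable_mix: "mix \<in> measurable bzr (unifq 3)"
proof (rule measurable_sigma_sets[OF sets_unifq_evcyls])
  fix y assume "y \<in> evcyls"
  then consider "y = {}" | H x where "y = Cyl (2 * H) x" by (auto simp: evcyls_def)
  then show "mix -` y \<inter> space bzr \<in> sets bzr"
  proof cases
    case (2 H x)
    show ?thesis unfolding 2 using mix_preimage_sets(1)[OF relabel_Tset_Cyl_sets relabel_empty_Cyl_sets]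
      by (simp add: space_bzr)
  qed simp
qed auto

lemma ennreal_convex:
  assumes "0 \<le> a" "0 \<le> b"
  shows "ennreal (3 / 4) * ennreal a + ennreal (1 / 4) * ennreal b = ennreal (3 / 4 * a + 1 / 4 * b)"
proof -
  have "ennreal (3 / 4) * ennreal a = ennreal (3 / 4 * a)" "ennreal (1 / 4) * ennreal b = ennreal (1 / 4 * b)"
    by (rule ennreal_mult[symmetric]; use assms in simp)+
  moreover have "ennreal (3 / 4 * a) + ennreal (1 / 4 * b) = ennreal (3 / 4 * a + 1 / 4 * b)"
    by (rule ennreal_plus[symmetric]) (use assms in auto)
  ultimately show ?thesis by (simp only:)
qed

lemma distr_mix: "distr bzr (unifq 3) mix = unifq 3"
proof (rule measure_eqI_generator_eq[OF Int_stable_evcyls, where A = "\<lambda>_. Cyl 0 (\<lambda>_. 0)"])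
  interpret B: prob_space bzr by (rule prob_space_bzr)
  interpret Z: prob_space zr by (rule prob_space_zr)
  interpret U: prob_space "unifq 6" by (rule prob_space_unifq)
  interpret U3: prob_space "unifq 3" by (rule prob_space_unifq)
  fix y assume "y \<in> evcyls"
  then consider "y = {}" | H x where "y = Cyl (2 * H) x" by (auto simp: evcyls_def)
  then show "emeasure (distr bzr (unifq 3) mix) y = emeasure (unifq 3) y"
  proof cases
    case (2 H x)
    let ?E1 = "{(z, r). relabel (Tset z) r \<in> Cyl (2 * H) x}"
    let ?E0 = "{r. relabel {} r \<in> Cyl (2 * H) x}"
    have l: "emeasure (distr bzr (unifq 3) mix) y =
        ennreal (3 / 4) * emeasure zr ?E1 + ennreal (1 / 4) * emeasure (unifq 6) ?E0"
      unfolding 2 mix_preimage_sets(2)[OF relabel_Tset_Cyl_sets relabel_empty_Cyl_sets, symmetric]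
      by (subst emeasure_distr[OF measurable_mix Cyl_sets]) (simp add: space_bzr)
    show ?thesis
    proof (cases "\<forall>i<2 * H. x i < 3")
      case True
      have cb: "Cyl (2 * H) x = {y. \<forall>i\<in>{..<2 * H}. y i \<in> {x i}}" by (simp add: Cyl_def Ball_def)
      have "measure (unifq 3) (Cyl (2 * H) x) = (\<Prod>i<2 * H. real (card ({x i} \<inter> {0..<3})) / real 3)"
        unfolding cb by (rule measure_box[where B = "\<lambda>i. {x i}"]) simp_all
      also have "\<dots> = (\<Prod>i<2 * H. 1 / 3)"
      proof (rule prod.cong[OF refl])
        fix i assume "i \<in> {..<2 * H}"
        then have "{x i} \<inter> {0..<3} = {x i}" using True by auto
        then show "real (card ({x i} \<inter> {0..<3})) / real 3 = 1 / 3" by simp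
      qed
      also have "\<dots> = (1 / 9) ^ H"
      proof -
        have "(1 / 3 :: real)\<^sup>2 = 1 / 9" by (simp add: power2_eq_square)
        then show ?thesis unfolding prod_constant card_lessThan power_mult by (rule arg_cong)
      qed
      also have "\<dots> = 3 / 4 * measure zr ?E1 + 1 / 4 * measure (unifq 6) ?E0"
        by (rule measure_mix_Cyl[symmetric]) (use True in blast)
      finally have "ennreal (measure (unifq 3) (Cyl (2 * H) x)) =
          ennreal (3 / 4 * measure zr ?E1 + 1 / 4 * measure (unifq 6) ?E0)" by (simp only:)
      then show ?thesis
        unfolding l unfolding 2 Z.emeasure_eq_measure U.emeasure_eq_measure U3.emeasure_eq_measure
        unfolding ennreal_convex[OF measure_nonneg measure_nonneg] by (rule sym)
    next
      case False
      \<comment> \<open>Sequences may take any natural value here; a cylinder with a digit of 3 or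
        more has measure 0 on both sides.\<close>
      then obtain i where i: "i < 2 * H" "3 \<le> x i" by (auto simp: not_less)
      then have "relabel S r \<notin> Cyl (2 * H) x" for S r
        using relabel_less[of S r i] by (auto simp: Cyl_def)
      then have "?E1 = {}" "?E0 = {}" by simp_all
      moreover have "emeasure (unifq 3) y = 0"
      proof -
        have "emeasure (unifq 3) y \<le> emeasure (unifq 3) {y. \<forall>j\<in>{i}. y j \<in> {x i}}"
        proof (rule emeasure_mono)
          show "y \<subseteq> {y. \<forall>j\<in>{i}. y j \<in> {x i}}" unfolding 2 Cyl_def using i(1) by auto
        qed (rule box_sets, simp)
        also have "{x i} \<inter> {0..<3} = {}" using i by auto
        then have "emeasure (unifq 3) {y. \<forall>j\<in>{i}. y j \<in> {x i}} = 0"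
          unfolding U3.emeasure_eq_measure by (subst measure_box[where B = "\<lambda>_. {x i}"]) simp_all
        finally show ?thesis by simp
      qed
      ultimately show ?thesis unfolding l by simp
    qed
  qed simp
next
  have "Cyl (2 * 0) (\<lambda>_. 0) \<in> evcyls" unfolding evcyls_def by blast
  then show "range (\<lambda>_. Cyl 0 (\<lambda>_. 0)) \<subseteq> evcyls" by auto
  interpret B: prob_space bzr by (rule prob_space_bzr)
  interpret D: prob_space "distr bzr (unifq 3) mix" by (rule B.prob_space_distr[OF measurable_mix])
  show "emeasure (distr bzr (unifq 3) mix) (Cyl 0 (\<lambda>_. 0)) \<noteq> \<infinity>" by simp
qed (auto simp: sets_unifq_evcyls Cyl_def)

lemma relabel_empty_measurable: "relabel {} \<in> measurable (unifq 6) (unifq 3)"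
proof (rule measurable_sigma_sets[OF sets_unifq_evcyls])
  fix y assume "y \<in> evcyls"
  then show "relabel {} -` y \<inter> space (unifq 6) \<in> sets (unifq 6)"
    using relabel_empty_Cyl_sets by (auto simp: evcyls_def vimage_def)
qed auto

lemma relabel_Tset_measurable: "(\<lambda>(z, r). relabel (Tset z) r) \<in> measurable zr (unifq 3)"
proof (rule measurable_sigma_sets[OF sets_unifq_evcyls])
  fix y assume "y \<in> evcyls"
  then show "(\<lambda>(z, r). relabel (Tset z) r) -` y \<inter> space zr \<in> sets zr"
    using relabel_Tset_Cyl_sets by (auto simp: evcyls_def vimage_def space_pair_measure case_prod_beta')
qed auto

lemma relabel_Tset_sets: "V \<in> sets lambda3 \<Longrightarrow> {(z, r). relabel (Tset z) r \<in> V} \<in> sets zr"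
  using measurable_sets[OF relabel_Tset_measurable, of V]
  by (simp add: lambda3_unifq vimage_def space_pair_measure case_prod_beta')

lemma emeasure_lambda3_mix:
  assumes "V \<in> sets lambda3"
  shows "emeasure lambda3 V = ennreal (3 / 4) * emeasure zr {(z, r). relabel (Tset z) r \<in> V} +
      ennreal (1 / 4) * emeasure (unifq 6) {r. relabel {} r \<in> V}"
proof -
  have V: "V \<in> sets (unifq 3)" using assms by (simp add: lambda3_unifq)
  have "emeasure lambda3 V = emeasure bzr (mix -` V)"
    using emeasure_distr[OF measurable_mix V] by (simp add: distr_mix lambda3_unifq space_bzr)
  also have "\<dots> = ennreal (3 / 4) * emeasure zr {(z, r). relabel (Tset z) r \<in> V} +
      ennreal (1 / 4) * emeasure (unifq 6) {r. relabel {} r \<in> V}"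
    using relabel_Tset_sets[OF assms] measurable_sets[OF relabel_empty_measurable V]
    by (intro mix_preimage_sets(2)) (simp_all add: vimage_def)
  finally show ?thesis .
qed

subsection \<open>Long branches with rare labels\<close>

text \<open>A union bound over the 2^m nodes of level m. Along one branch the m - n coordinates lie
  on different levels, so they are distinct and their values independent.\<close>

lemma bad_sets: "bad B n m \<in> sets (unifq q)"
  and measure_bad:
    "n \<le> m \<Longrightarrow> 0 < q \<Longrightarrow> card (B \<inter> {0..<q}) * 3 = q \<Longrightarrow>
     measure (unifq q) (bad B n m) \<le> 2 ^ m * (1 / 3) ^ (m - n)"
proof -
  let ?J = "\<lambda>d. (\<lambda>i. d div 2 ^ i - 2) ` {..<m - n}"
  let ?D = "{2 ^ m..<2 ^ Suc m} :: nat set"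
  have eq: "bad B n m = (\<Union>d\<in>?D. {r. \<forall>j\<in>?J d. r j \<in> B})"
    by (auto simp: bad_def)
  show s: "bad B n m \<in> sets (unifq q)"
    unfolding eq by (intro sets.finite_UN box_sets) auto
  assume nm: "n \<le> m" and q: "0 < q" "card (B \<inter> {0..<q}) * 3 = q"
  interpret U: prob_space "unifq q" by (rule prob_space_unifq)
  have "measure (unifq q) {r. \<forall>j\<in>?J d. r j \<in> B} = (1 / 3) ^ (m - n)" if d: "d \<in> ?D" for d
  proof -
    have lev: "2 ^ (m - i) \<le> d div 2 ^ i" "d div 2 ^ i < 2 ^ Suc (m - i)" if "i < m - n" for i
      using level_div[of m d i] d that by auto
    have ge: "2 \<le> d div 2 ^ i" if "i < m - n" for i
    proof -
      have "(2::nat) ^ 1 \<le> 2 ^ (m - i)" using that by (intro power_increasing) auto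
      then show ?thesis using lev(1)[OF that] by simp
    qed
    have "inj_on (\<lambda>i. d div 2 ^ i - 2) {..<m - n}"
    proof (rule inj_onI)
      fix i j assume ij: "i \<in> {..<m - n}" "j \<in> {..<m - n}" "d div 2 ^ i - 2 = d div 2 ^ j - 2"
      have "d div 2 ^ i = d div 2 ^ j" using ij ge[of i] ge[of j] by simp
      then have "m - i = m - j" using pow2_interval_unique[of "m - i" "d div 2 ^ i" "m - j"] lev[of i] lev[of j] ij by simp
      then show "i = j" using ij by auto
    qed
    then have cJ: "card (?J d) = m - n" by (simp add: card_image)
    have rq: "real (card (B \<inter> {0..<q})) / real q = 1 / 3"
      using q by (simp add: field_simps flip: of_nat_mult) 
    show ?thesis unfolding measure_box[OF finite_imageI[OF finite_lessThan] q(1)] rq by (simp only: prod_constant cJ)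
  qed
  moreover have "measure (unifq q) (bad B n m) \<le> (\<Sum>d\<in>?D. measure (unifq q) {r. \<forall>j\<in>?J d. r j \<in> B})"
    unfolding eq
  proof (rule U.finite_measure_subadditive_finite)
    show "(\<lambda>d. {r. \<forall>j\<in>?J d. r j \<in> B}) ` ?D \<subseteq> sets (unifq q)"
      by (rule image_subsetI, rule box_sets) simp
  qed simp
  ultimately have "measure (unifq q) (bad B n m) \<le> (\<Sum>d\<in>?D. (1 / 3) ^ (m - n))" by simp
  then show "measure (unifq q) (bad B n m) \<le> 2 ^ m * (1 / 3) ^ (m - n)" by simp
qed

text \<open>Two levels at a time gain the factor 4/9, which is below 1/2 and so gives the powers of
  1/2 that tests require.\<close>

lemma measure_bad_le:
  assumes "0 < q" "card (B \<inter> {0..<q}) * 3 = q"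
  shows "measure (unifq q) (bad B n (n + 2 * K)) \<le> 2 ^ n * (1 / 2) ^ K"
proof -
  have "measure (unifq q) (bad B n (n + 2 * K)) \<le> 2 ^ (n + 2 * K) * (1 / 3) ^ (2 * K)"
    using measure_bad[of n "n + 2 * K" q B] assms by simp
  also have "\<dots> = 2 ^ n * (4 / 9) ^ K"
    by (simp add: power_add power_mult power_divide)
  also have "\<dots> \<le> 2 ^ n * (1 / 2) ^ K"
    by (intro mult_left_mono power_mono) auto
  finally show ?thesis .
qed

subsection \<open>Decidability of finite approximations\<close>

lemmas comp_intros = comp_basic comp_codes dec_ex dec_all comp_sum comp_const comp_hd comp_tl

lemma sum_of_bool: "(\<Sum>a<h. of_bool (a \<in> S)) = rank S h"
proof -
  have "{..<h} \<inter> {x. x \<in> S} = S \<inter> {..<h}" by auto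
  then show ?thesis by (simp add: of_bool_def sum.If_cases)
qed

lemma two_le_div_imp: "2 \<le> d div 2 ^ j \<Longrightarrow> j < (d::nat)"
  by (metis (no_types) div_less less_exp less_le_trans not_less not_numeral_le_zero)

lemma alive_bounded: "alive x d \<longleftrightarrow> (\<forall>j<d. 2 \<le> d div 2 ^ j \<longrightarrow> x (d div 2 ^ j - 2) \<noteq> 1)"
  unfolding alive_def using two_le_div_imp by blast

lemma dec_alive:
  assumes "comp n t" "comp n d"
  shows "dec n (\<lambda>xs. alive (lnth (t xs)) (d xs))"
  unfolding alive_bounded by (intro comp_intros assms)

lemma dec_alive_pre:
  assumes "comp n t" "comp n m" "comp n h"
  shows "dec n (\<lambda>xs. h xs \<in> alive_pre (m xs) (lnth (t xs)))"
proof -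
  have "dec n (\<lambda>xs. \<exists>d<2 ^ Suc (m xs). 2 ^ m xs \<le> d \<and> alive (lnth (t xs)) d \<and> (\<exists>j<Suc (m xs). d div 2 ^ j = h xs))"
    by (intro dec_alive comp_intros assms)
  then show ?thesis
    by (rule dec_cong) (unfold alive_pre_def mem_Collect_eq less_Suc_eq_le, blast)
qed

lemma alive_pre_less: "h \<in> alive_pre m x \<Longrightarrow> h < 2 ^ Suc m"
  unfolding alive_pre_def using div_le_dividend le_less_trans by blast

lemma dec_matches:
  assumes "comp n t" "comp n m" "comp n c"
  shows "dec n (\<lambda>xs. matches (alive_pre (m xs) (lnth (t xs))) (list_decode (c xs)))"
proof -
  let ?P = "\<lambda>xs. alive_pre (m xs) (lnth (t xs))"
  let ?r = "\<lambda>h xs. \<Sum>a<h. of_bool (a \<in> ?P xs)"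
  have "dec n (\<lambda>xs. Suc 0 \<in> ?P xs \<and> (\<forall>h<2 ^ Suc (m xs). h \<in> ?P xs \<longrightarrow> ?r h xs < llen (c xs) \<longrightarrow>
     (if Suc (2 * h) \<notin> ?P xs then 0 else if 2 * h \<notin> ?P xs then 1 else 2) = lnth (c xs) (?r h xs)))"
    by (intro dec_alive_pre comp_intros assms)
  then show ?thesis
  proof (rule dec_cong)
    fix xs :: "nat list"
    have "matches (?P xs) (list_decode (c xs)) \<longleftrightarrow> Suc 0 \<in> ?P xs \<and>
      (\<forall>h\<in>?P xs. rank (?P xs) h < llen (c xs) \<longrightarrow> kids (?P xs) h = lnth (c xs) (rank (?P xs) h))"
      unfolding matches_def llen_def[symmetric] by (metis lnth_eq)
    then show "(Suc 0 \<in> ?P xs \<and> (\<forall>h<2 ^ Suc (m xs). h \<in> ?P xs \<longrightarrow> ?r h xs < llen (c xs) \<longrightarrow>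
     (if Suc (2 * h) \<notin> ?P xs then 0 else if 2 * h \<notin> ?P xs then 1 else 2) = lnth (c xs) (?r h xs)))
     \<longleftrightarrow> matches (?P xs) (list_decode (c xs))"
      unfolding sum_of_bool kids_def[symmetric] using alive_pre_less by blast
  qed
qed

lemma alive_cong:
  assumes "\<And>i. i + 2 < M \<Longrightarrow> x i = y i" "d < M"
  shows "alive x d \<longleftrightarrow> alive y d"
proof -
  have "x (d div 2 ^ j - 2) = y (d div 2 ^ j - 2)" if "2 \<le> d div 2 ^ j" for j
  proof -
    have "d div 2 ^ j \<le> d" by (rule div_le_dividend)
    then show ?thesis using assms(2) that by (intro assms(1)) linarith
  qed
  then show ?thesis unfolding alive_def by (intro iff_allI) simp
qed

lemma alive_pre_cong:
  assumes "\<And>i. i + 2 < 2 ^ Suc m \<Longrightarrow> x i = y i"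
  shows "alive_pre m x = alive_pre m y"
proof -
  have "alive x d \<longleftrightarrow> alive y d" if "d < 2 ^ Suc m" for d
    by (rule alive_cong[OF assms that])
  then show ?thesis unfolding alive_pre_def by (simp cong: conj_cong del: power_Suc)
qed

lemma cyl_lnth: "y \<in> cyl (list_decode t) \<Longrightarrow> i < llen t \<Longrightarrow> y i = lnth t i"
  by (simp add: cyl_def llen_def[symmetric] lnth_eq)

lemma in_cyl_map: "x \<in> cyl (map x [0..<L])"
  by (simp add: cyl_def)

lemma string_unionI:
  assumes "\<And>i. x i < 3" "prod_encode (i, list_encode (map x [0..<L])) \<in> W"
  shows "x \<in> string_union W i"
  unfolding in_string_union
proof (intro exI conjI)
  show "set (list_decode (list_encode (map x [0..<L]))) \<subseteq> {0..<3}" using assms(1) by auto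
  show "x \<in> cyl (list_decode (list_encode (map x [0..<L])))" using in_cyl_map[of x L] by simp
qed (rule assms(2))

subsection \<open>No branch of a random labelling ends in 2s\<close>

text \<open>The branch y need not be computable, so the test catches all branches at once: level i
  accepts a string as soon as it shows some long run of labels 2.\<close>

lemma random_label_not_2:
  assumes x: "mlof_random3 x"
  shows "\<exists>n\<ge>n0. label x (prefix y (Suc n)) \<noteq> 2"
proof (rule ccontr)
  assume "\<not> ?thesis"
  then have lab: "x (hidx (prefix y (Suc n)) - 2) = 2" if "n0 \<le> n" for n using that by (auto simp: label_hidx)
  have x3: "x i < 3" for i using x by (simp add: mlof_random3_def)
  \<comment> \<open>With m = n0 + 2 * (n0 + i), \<open>measure_bad_le\<close> yields 2^n0 * 2^-(n0 +
    i) = 2^-i. The summand 2 next to the length reflects that node h has its label at h - 2: the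
    string must show the labels of all nodes below \<open>2 ^ Suc m\<close>.\<close>
  define D where "D = (\<lambda>n. 2 ^ Suc (n0 + 2 * (n0 + pfst n)) \<le> llen (psnd n) + 2 \<and>
    (\<exists>d<2 ^ Suc (n0 + 2 * (n0 + pfst n)). 2 ^ (n0 + 2 * (n0 + pfst n)) \<le> d \<and>
      (\<forall>j<n0 + 2 * (n0 + pfst n) - n0. lnth (psnd n) (d div 2 ^ j - 2) = 2)))"
  have "dec (Suc 0) (\<lambda>xs. D (hd xs))" unfolding D_def by (intro comp_intros)
  then have ce: "ce_set {n. D n}" by (intro ce_set_dec) simp
  have mem: "x \<in> string_union {n. D n} i" for i
  proof -
    define m where "m = n0 + 2 * (n0 + i)"
    define t where "t = list_encode (map x [0..<2 ^ Suc m])"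
    have l: "llen t = 2 ^ Suc m" by (simp add: t_def llen_def)
    have lx: "lnth t k = x k" if "k < 2 ^ Suc m" for k
      using cyl_lnth[of x t k] in_cyl_map[of x "2 ^ Suc m"] that l by (simp add: t_def del: power_Suc upt_Suc)
    let ?d = "hidx (prefix y m)"
    have d: "2 ^ m \<le> ?d" "?d < 2 ^ Suc m" using hidx_bounds[of "prefix y m"] by auto
    have "lnth t (?d div 2 ^ j - 2) = 2" if j: "j < m - n0" for j
    proof -
      obtain k where k: "m - j = Suc k" "n0 \<le> k" using j by (intro that[of "m - j - 1"]) auto
      have mk: "m = Suc k + j" using k(1) by simp
      have "?d div 2 ^ j = hidx (prefix y (Suc k))" unfolding mk by (rule hidx_prefix_div)
      then have "x (?d div 2 ^ j - 2) = 2" using lab[OF k(2)] by simp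
      moreover have "?d div 2 ^ j - 2 < 2 ^ Suc m" using d(2) div_le_dividend[of ?d "2 ^ j"] by linarith
      ultimately show ?thesis using lx by simp
    qed
    then have "D (prod_encode (i, t))"
      unfolding D_def prod_encode_inverse fst_conv snd_conv m_def[symmetric] l using d
      by (intro conjI exI[of _ ?d] allI impI) (simp_all del: power_Suc)
    then show ?thesis unfolding t_def by (intro string_unionI x3) simp
  qed
  have sub: "string_union {n. D n} i \<subseteq> bad {2} n0 (n0 + 2 * (n0 + i))" for i
  proof
    fix u assume "u \<in> string_union {n. D n} i"
    then obtain t where t: "D (prod_encode (i, t))" "u \<in> cyl (list_decode t)" by (auto simp: in_string_union)
    let ?m = "n0 + 2 * (n0 + i)"
    obtain d where d: "2 ^ Suc ?m \<le> llen t + 2" "d < 2 ^ Suc ?m" "2 ^ ?m \<le> d"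
      "\<And>j. j < ?m - n0 \<Longrightarrow> lnth t (d div 2 ^ j - 2) = 2"
      using t(1) unfolding D_def prod_encode_inverse fst_conv snd_conv by blast
    have "u (d div 2 ^ j - 2) \<in> {2}" if j: "j < ?m - n0" for j
    proof -
      have "2 ^ (?m - j) \<le> d div 2 ^ j" using level_div(1)[OF d(3,2), of j] j by simp
      moreover have "(2::nat) ^ 1 \<le> 2 ^ (?m - j)" using j by (intro power_increasing) auto
      ultimately have "2 \<le> d div 2 ^ j" unfolding power_one_right by (rule order_trans[rotated])
      then have "d div 2 ^ j - 2 < llen t"
        using d(1,2) div_le_dividend[of d "2 ^ j"] by linarith
      then show ?thesis using cyl_lnth[OF t(2), of "d div 2 ^ j - 2"] d(4)[OF j] by simp
    qed
    then show "u \<in> bad {2} n0 ?m" unfolding bad_def using d(2,3) by (intro CollectI exI[of _ d] conjI allI impI) simp_all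
  qed
  have "emeasure lambda3 (string_union {n. D n} i) \<le> ennreal ((1/2) ^ i)" for i
  proof -
    interpret U: prob_space "unifq 3" by (rule prob_space_unifq)
    have "emeasure lambda3 (string_union {n. D n} i) \<le> emeasure (unifq 3) (bad {2} n0 (n0 + 2 * (n0 + i)))"
      unfolding lambda3_unifq by (intro emeasure_mono sub bad_sets)
    also have "\<dots> \<le> ennreal (2 ^ n0 * (1 / 2) ^ (n0 + i))"
    proof -
      have "{2} \<inter> {0..<3::nat} = {2}" by auto
      then show ?thesis unfolding U.emeasure_eq_measure
        by (intro ennreal_leI measure_bad_le) simp_all
    qed
    also have "(2::real) ^ n0 * (1 / 2) ^ (n0 + i) = (1 / 2) ^ i"
      by (simp add: power_add power_divide)
    finally show ?thesis .
  qed
  from mlof_random3_string_union[OF x ce this] mem show False by blast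
qed

lemma zeros_random:
  assumes "mlof_random3 x"
  shows "zeros (Ffun x) = {y. \<forall>n. alive x (hidx (prefix y n))}"
  by (rule zeros_Ffun) (rule random_label_not_2[OF assms])

subsection \<open>Codes of zero sets are random\<close>

lemma AE_unifq: "0 < q \<Longrightarrow> AE x in unifq q. \<forall>i. x i < q"
  unfolding AE_all_countable
proof
  fix i assume q: "0 < q"
  interpret U: prob_space "unifq q" by (rule prob_space_unifq)
  have "{q..} \<inter> {0..<q} = {}" by auto
  then have "measure (unifq q) {x. \<forall>j\<in>{i}. x j \<in> {q..}} = 0"
    using q by (subst measure_box) auto
  then have "{x. \<forall>j\<in>{i}. x j \<in> {q..}} \<in> null_sets (unifq q)"
    unfolding null_sets_def U.emeasure_eq_measure using box_sets[of "{i}" "\<lambda>_. {q..}" q] by simp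
  then show "AE x in unifq q. x i < q" by (rule AE_I') auto
qed

lemma emeasure_zr_fst: "A \<in> sets (unifq 3) \<Longrightarrow> emeasure zr (A \<times> UNIV) = emeasure (unifq 3) A"
  and emeasure_zr_snd: "B \<in> sets (unifq 6) \<Longrightarrow> emeasure zr (UNIV \<times> B) = emeasure (unifq 6) B"
proof -
  interpret U: prob_space "unifq 6" by (rule prob_space_unifq)
  interpret U3: prob_space "unifq 3" by (rule prob_space_unifq)
  have s: "UNIV \<in> sets (unifq q)" for q using sets.top[of "unifq q"] by simp
  show "A \<in> sets (unifq 3) \<Longrightarrow> emeasure zr (A \<times> UNIV) = emeasure (unifq 3) A"
    using U.emeasure_space_1 by (simp add: U.emeasure_pair_measure_Times s)
  show "B \<in> sets (unifq 6) \<Longrightarrow> emeasure zr (UNIV \<times> B) = emeasure (unifq 6) B"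
    using U3.emeasure_space_1 by (simp add: U.emeasure_pair_measure_Times s)
qed

text \<open>One exceptional set for all string codes c at once. The string coded by c has length at
  most c, so agreement of the trees up to level c decides it; the c-th summand has measure at most
  2^-(c + i + 3), and the sum is at most 2^-(i + 2).\<close>

definition err :: "nat \<Rightarrow> (nat \<Rightarrow> nat) set" where
  "err i = (\<Union>c. bad {4..} c (c + 2 * (2 * c + i + 3)))"

lemma err_sets: "err i \<in> sets (unifq 6)"
  unfolding err_def by (intro sets.countable_UN'' bad_sets) auto

lemma emeasure_err: "emeasure (unifq 6) (err i) \<le> ennreal ((1 / 2) ^ (i + 2))"
proof -
  interpret U: prob_space "unifq 6" by (rule prob_space_unifq)
  let ?b = "\<lambda>c. bad {4..} c (c + 2 * (2 * c + i + 3))"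
  have c6: "card ({4..} \<inter> {0..<6::nat}) * 3 = 6"
  proof -
    have "{4..} \<inter> {0..<6::nat} = {4, 5}" by auto
    then show ?thesis by simp
  qed
  have "emeasure (unifq 6) (?b c) \<le> ennreal ((1 / 2) ^ (i + 3) * (1 / 2) ^ c)" for c
  proof -
    have "measure (unifq 6) (?b c) \<le> 2 ^ c * (1 / 2) ^ (2 * c + i + 3)" by (rule measure_bad_le) (use c6 in auto)
    also have "\<dots> = (1 / 2) ^ (i + 3) * (1 / 2) ^ c"
    proof -
      have "2 * c + i + 3 = c + (i + 3) + c" by simp
      then have "(2::real) ^ c * (1 / 2) ^ (2 * c + i + 3) = (2 ^ c * (1 / 2) ^ c) * ((1 / 2) ^ (i + 3) * (1 / 2) ^ c)"
        by (simp only: power_add mult_ac)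
      also have "(2::real) ^ c * (1 / 2) ^ c = 1" by (simp add: power_divide)
      finally show ?thesis by simp
    qed
    finally show ?thesis unfolding U.emeasure_eq_measure by (rule ennreal_leI)
  qed
  then have "(\<Sum>c. emeasure (unifq 6) (?b c)) \<le> (\<Sum>c. ennreal ((1 / 2) ^ (i + 3) * (1 / 2) ^ c))"
    by (intro suminf_le) auto
  also have "\<dots> = ennreal ((1 / 2) ^ (i + 2))"
  proof (rule suminf_ennreal_eq)
    have "(\<lambda>c. (1 / 2 :: real) ^ c) sums (1 / (1 - 1 / 2))" by (rule geometric_sums) simp
    then have "(\<lambda>c. (1 / 2 :: real) ^ (i + 3) * (1 / 2) ^ c) sums ((1 / 2) ^ (i + 3) * (1 / (1 - 1 / 2)))"
      by (rule sums_mult)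
    moreover have "(1 / 2 :: real) ^ (i + 3) * (1 / (1 - 1 / 2)) = (1 / 2) ^ (i + 2)"
      by (simp add: power_add power3_eq_cube power2_eq_square)
    ultimately show "(\<lambda>c. (1 / 2 :: real) ^ (i + 3) * (1 / 2) ^ c) sums (1 / 2) ^ (i + 2)" by (simp only:)
  qed simp
  finally show ?thesis
    unfolding err_def using emeasure_subadditive_countably[of ?b "unifq 6"] bad_sets
    by (meson image_subsetI order_trans)
qed

lemma random_code_of_surv:
  assumes x: "mlof_random3 x" and root: "Suc 0 \<in> surv x"
  shows "mlof_random3 (code_of (surv x))"
  unfolding mlof_random3_def
proof (intro conjI allI impI)
  fix U assume U: "mlof_test U"
  let ?S = "surv x" and ?z = "code_of (surv x)"
  have x3: "x i < 3" for i using x by (simp add: mlof_random3_def)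
  note S = surv_dendless[of x] root
  have z: "is_code ?z ?S" by (rule is_code_code_of[OF S])
  obtain W where W: "ce_set W" "U = string_union W" using U by (auto simp: mlof_test_def unif_sigma01_iff)
  txt \<open>
    The witnesses c and m are read off the length of the string, which can always be padded. This makes
    the test the domain of a single recursive function, and no unbounded search over W is needed.
  \<close>
  define cc where "cc = (\<lambda>n. pfst (llen (psnd n)))"
  define mm where "mm = (\<lambda>n. pfst (psnd (llen (psnd n))))"
  define D where "D = (\<lambda>n. 2 ^ Suc (mm n) \<le> llen (psnd n) + 2 \<and>
      cc n + 2 * (2 * cc n + pfst n + 3) \<le> mm n \<and>
      (\<forall>k<llen (cc n). lnth (cc n) k < 3) \<and>
      matches (alive_pre (mm n) (lnth (psnd n))) (list_decode (cc n)))"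
  define W' where "W' = {n. D n \<and> prod_encode (Suc (pfst n), cc n) \<in> W}"
  have "dec (Suc 0) (\<lambda>xs. D (hd xs))" unfolding D_def cc_def mm_def by (intro dec_matches comp_intros)
  moreover have "comp (Suc 0) (\<lambda>xs. prod_encode (Suc (pfst (hd xs)), cc (hd xs)))"
    unfolding cc_def by (intro comp_intros)
  ultimately have ce: "ce_set W'" unfolding W'_def by (intro ce_set_vimage W(1)) simp_all
  have sub: "\<exists>c m. c + 2 * (2 * c + i + 3) \<le> m \<and> set (list_decode c) \<subseteq> {0..<3} \<and>
      prod_encode (Suc i, c) \<in> W \<and> matches (alive_pre m u) (list_decode c)"
    if u: "u \<in> string_union W' i" for u i
  proof -
    obtain t where t: "prod_encode (i, t) \<in> W'" "u \<in> cyl (list_decode t)" using u by (auto simp: in_string_union)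
    let ?c = "pfst (llen t)" and ?m = "pfst (psnd (llen t))"
    have *: "2 ^ Suc ?m \<le> llen t + 2" "?c + 2 * (2 * ?c + i + 3) \<le> ?m" "\<forall>k<llen ?c. lnth ?c k < 3"
      "matches (alive_pre ?m (lnth t)) (list_decode ?c)" "prod_encode (Suc i, ?c) \<in> W"
      using t(1) unfolding W'_def D_def cc_def mm_def mem_Collect_eq prod_encode_inverse fst_conv snd_conv by blast+
    have "alive_pre ?m u = alive_pre ?m (lnth t)"
      by (rule alive_pre_cong, rule cyl_lnth[OF t(2)]) (use *(1) in linarith)
    moreover have "set (list_decode ?c) \<subseteq> {0..<3}"
    proof
      fix v assume "v \<in> set (list_decode ?c)"
      then obtain k where "k < llen ?c" "v = list_decode ?c ! k" by (auto simp: in_set_conv_nth llen_def)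
      then show "v \<in> {0..<3}" using *(3) lnth_eq by simp
    qed
    ultimately show ?thesis using * by metis
  qed
  have sup: "x \<in> string_union W' i"
    if c: "c + 2 * (2 * c + i + 3) \<le> m" "set (list_decode c) \<subseteq> {0..<3}" "prod_encode (Suc i, c) \<in> W"
      "matches (alive_pre m x) (list_decode c)" for c m i
  proof -
    \<comment> \<open>The first two components are the witnesses to be read off the length; the
      third one only makes the string long enough to show all labels up to level m.\<close>
    define L where "L = prod_encode (c, prod_encode (m, 2 ^ Suc m))"
    have L: "2 ^ Suc m \<le> L" unfolding L_def by (meson le_prod_encode_2 le_trans)
    define t where "t = list_encode (map x [0..<L])"
    have lt: "llen t = L" by (simp add: t_def llen_def)
    have xt: "x \<in> cyl (list_decode t)" using in_cyl_map[of x L] by (simp add: t_def)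
    have "alive_pre m x = alive_pre m (lnth t)"
      by (rule alive_pre_cong, rule cyl_lnth[OF xt]) (use L lt in linarith)
    moreover have "\<forall>k<llen c. lnth c k < 3"
      using c(2) by (metis atLeastLessThan_iff llen_def lnth_eq nth_mem subsetD)
    moreover have "pfst L = c" "pfst (psnd L) = m" by (simp_all add: L_def)
    ultimately have "prod_encode (i, t) \<in> W'"
      unfolding W'_def D_def cc_def mm_def mem_Collect_eq prod_encode_inverse fst_conv snd_conv lt
      using c L by simp
    then show ?thesis unfolding t_def by (intro string_unionI x3)
  qed
  have "emeasure lambda3 (string_union W' i) \<le> ennreal ((1/2) ^ i)" for i
  proof -
    let ?V = "string_union W' i"
    let ?b = "(1 / 2) ^ (i + 2) :: real"
    have V: "?V \<in> sets lambda3" unfolding lambda3_unifq by (rule string_union_sets)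
    have agree: "h \<in> alive_pre m (relabel T r) \<longleftrightarrow> h \<in> T"
      if "dendless T" "r \<notin> err i" "c + 2 * (2 * c + i + 3) \<le> m" "h < 2 ^ Suc c" for T r c m h
    proof -
      have "r \<notin> bad {4..} c m"
        using that(2) bad_antimono[of c "c + 2 * (2 * c + i + 3)" m "{4..}"] that(3) unfolding err_def by auto
      then show ?thesis using that by (intro alive_pre_relabel[of T c]) auto
    qed
    \<comment> \<open>A match requires the root in the approximation, but the empty tree has no
      root; so every accepted roll lies in the error set.\<close>
    have E0: "emeasure (unifq 6) {r. relabel {} r \<in> ?V} \<le> ennreal ?b"
    proof -
      have "{r. relabel {} r \<in> ?V} \<subseteq> err i"
      proof
        fix r assume "r \<in> {r. relabel {} r \<in> ?V}"
        then obtain c m where cm: "c + 2 * (2 * c + i + 3) \<le> m" "matches (alive_pre m (relabel {} r)) (list_decode c)"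
          using sub[of "relabel {} r" i] by blast
        then have "Suc 0 \<in> alive_pre m (relabel {} r)" by (simp add: matches_def)
        moreover have "dendless {}" by (simp add: dendless_def)
        moreover have "Suc 0 < 2 ^ Suc c" using one_less_power[of "2::nat" "Suc c"] by simp
        ultimately show "r \<in> err i" using agree[of "{}" r c m "Suc 0"] cm(1) by blast
      qed
      then show ?thesis using emeasure_mono[OF _ err_sets] emeasure_err le_trans by (meson order_trans)
    qed
    have E1: "emeasure zr {(z, r). relabel (Tset z) r \<in> ?V} \<le> ennreal (3 * ?b)"
    proof -
      \<comment> \<open>\<open>matches_iff_cyl\<close> needs digits below 3, which holds only almost
        surely in the ambient space.\<close>
      let ?N = "{z :: nat \<Rightarrow> nat. \<not> (\<forall>j. z j < 3)}"
      have sets3: "U (Suc i) \<in> sets (unifq 3)" unfolding W(2) by (rule string_union_sets)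
      obtain N where N: "?N \<subseteq> N" "N \<in> null_sets (unifq 3)"
        using AE_unifq[of 3] by (auto elim!: AE_E simp: null_setsI)
      have "{(z, r). relabel (Tset z) r \<in> ?V} \<subseteq> N \<times> UNIV \<union> U (Suc i) \<times> UNIV \<union> UNIV \<times> err i"
      proof
        fix p assume p: "p \<in> {(z, r). relabel (Tset z) r \<in> ?V}"
        obtain z r where zr: "p = (z, r)" by (cases p)
        have "relabel (Tset z) r \<in> ?V" using p zr by simp
        from sub[OF this] obtain c m where cm: "c + 2 * (2 * c + i + 3) \<le> m" "set (list_decode c) \<subseteq> {0..<3}"
          "prod_encode (Suc i, c) \<in> W" "matches (alive_pre m (relabel (Tset z) r)) (list_decode c)" by blast
        show "p \<in> N \<times> UNIV \<union> U (Suc i) \<times> UNIV \<union> UNIV \<times> err i"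
        proof (cases "r \<in> err i \<or> z \<in> ?N")
          case False
          have code: "is_code z (Tset z)" by (rule is_code_Tset)
          have "Suc 0 \<in> Tset z" using code by (simp add: is_code_def)
          moreover have "length (list_decode c) \<le> c" using llen_le[of c] by (simp add: llen_def)
          moreover have "h \<in> alive_pre m (relabel (Tset z) r) \<longleftrightarrow> h \<in> Tset z" if "h < 2 ^ Suc c" for h
            using agree[OF is_code_dendless[OF code] _ cm(1) that] False by blast
          ultimately have "z \<in> cyl (list_decode c)"
            using matches_iff_cyl[OF is_code_dendless[OF code] _ code, of c _ "list_decode c"] cm(4) False by blast
          then have "z \<in> U (Suc i)" unfolding W(2) in_string_union using cm(2,3) by blast
          then show ?thesis using zr by simp
        qed (use zr N(1) in auto)
      qed
      then have "emeasure zr {(z, r). relabel (Tset z) r \<in> ?V} \<le> emeasure zr (N \<times> UNIV \<union> U (Suc i) \<times> UNIV \<union> UNIV \<times> err i)"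
        using N(2) sets3 err_sets sets.top[of "unifq 3"] sets.top[of "unifq 6"]
        by (intro emeasure_mono sets.Un pair_measureI) auto
      also have "\<dots> \<le> emeasure zr (N \<times> UNIV) + emeasure zr (U (Suc i) \<times> UNIV) + emeasure zr (UNIV \<times> err i)"
        using N(2) sets3 err_sets sets.top[of "unifq 3"] sets.top[of "unifq 6"]
        by (intro order_trans[OF emeasure_subadditive] add_right_mono emeasure_subadditive sets.Un pair_measureI) auto
      also have "\<dots> = emeasure lambda3 (U (Suc i)) + emeasure (unifq 6) (err i)"
        using N(2) sets3 err_sets by (simp add: emeasure_zr_fst emeasure_zr_snd null_sets_def lambda3_unifq)
      also have "\<dots> \<le> ennreal ((1 / 2) ^ Suc i) + ennreal ?b"
      proof (rule add_mono[OF _ emeasure_err])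
        show "emeasure lambda3 (U (Suc i)) \<le> ennreal ((1 / 2) ^ Suc i)" using U unfolding mlof_test_def by blast
      qed
      also have "\<dots> = ennreal (3 * ?b)" by (subst ennreal_plus[symmetric]) (auto intro: arg_cong[of _ _ ennreal])
      finally show ?thesis .
    qed
    have "emeasure lambda3 ?V \<le> ennreal (3 / 4) * ennreal (3 * ?b) + ennreal (1 / 4) * ennreal ?b"
      unfolding emeasure_lambda3_mix[OF V] by (intro add_mono mult_left_mono E1 E0) auto
    also have "\<dots> = ennreal (3 / 4 * (3 * ?b) + 1 / 4 * ?b)" by (rule ennreal_convex) auto
    \<comment> \<open>The budget: with b = 2^-(i + 2) the surviving part costs 2b for U (i + 1) and
      b for errors, the extinct part b; the mixture 3/4 * 3b + 1/4 * b is below 4b = 2^-i.\<close>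
    also have "\<dots> \<le> ennreal ((1 / 2) ^ i)" by (rule ennreal_leI) (simp add: power_add power2_eq_square)
    finally show ?thesis .
  qed
  from mlof_random3_string_union[OF x ce this] obtain i where i: "x \<notin> string_union W' i" by blast
  have "?z \<notin> U (Suc i)"
  proof
    assume "?z \<in> U (Suc i)"
    then obtain c where c: "set (list_decode c) \<subseteq> {0..<3}" "prod_encode (Suc i, c) \<in> W" "?z \<in> cyl (list_decode c)"
      unfolding W(2) in_string_union by blast
    obtain m0 where m0: "\<And>m h. m0 \<le> m \<Longrightarrow> h < 2 ^ Suc c \<Longrightarrow> h \<in> alive_pre m x \<longleftrightarrow> h \<in> ?S"
      using alive_pre_surv[of c x] by blast
    \<comment> \<open>The stage must be late enough for x itself and also admissible for the guard
      that controls the errors.\<close>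
    define m where "m = max m0 (c + 2 * (2 * c + i + 3))"
    have "length (list_decode c) \<le> c" using llen_le[of c] by (simp add: llen_def)
    then have "matches (alive_pre m x) (list_decode c)"
      using matches_iff_cyl[OF S z code_of_less, of c "alive_pre m x" "list_decode c"] m0 c(3) by (simp add: m_def)
    then have "x \<in> string_union W' i" by (intro sup[of c i m] c) (simp_all add: m_def)
    then show False using i by blast
  qed
  then show "?z \<notin> (\<Inter>i. U i)" by blast
qed (rule code_of_less)

subsection \<open>Counting strings of base 6 digits\<close>

text \<open>Numbers below 6^N stand for the outcomes of the first N dice, so that the measure of a
  finitely determined event becomes a bounded sum and hence computable.\<close>

definition dig :: "nat \<Rightarrow> nat \<Rightarrow> nat" where
  "dig s i = s div 6 ^ i mod 6"

lemma dig_less: "dig s i < 6"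
  by (simp add: dig_def)

lemma dig_append:
  assumes "s < 6 ^ N" "a < 6"
  shows "s + a * 6 ^ N < 6 ^ Suc N" "i < N \<Longrightarrow> dig (s + a * 6 ^ N) i = dig s i" "dig (s + a * 6 ^ N) N = a"
proof -
  have "a * 6 ^ N \<le> 5 * 6 ^ N" using assms(2) by (intro mult_right_mono) auto
  then show "s + a * 6 ^ N < 6 ^ Suc N" unfolding power_Suc using assms(1) by linarith
  show "dig (s + a * 6 ^ N) N = a" using assms by (simp add: dig_def)
  assume i: "i < N"
  then obtain k where k: "N = i + Suc k" by (metis add_Suc_right less_imp_Suc_add)
  have e: "a * 6 ^ N = a * 6 ^ Suc k * 6 ^ i" by (simp add: k power_add)
  have "(s + a * 6 ^ Suc k * 6 ^ i) div 6 ^ i = a * 6 ^ Suc k + s div 6 ^ i" by (rule div_mult_self1) simp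
  then have "(s + a * 6 ^ N) div 6 ^ i = s div 6 ^ i + a * 6 ^ Suc k" unfolding e by (simp only: add.commute)
  also have "\<dots> mod 6 = s div 6 ^ i mod 6" by (simp add: mod_add_right_eq[symmetric])
  finally show "dig (s + a * 6 ^ N) i = dig s i" by (simp only: dig_def)
qed

lemma dig_surj:
  assumes "\<And>i. i < N \<Longrightarrow> r i < 6"
  shows "\<exists>s<6 ^ N. \<forall>i<N. dig s i = r i"
  using assms
proof (induction N)
  case (Suc N)
  then obtain s where s: "s < 6 ^ N" "\<forall>i<N. dig s i = r i" by auto
  note d = dig_append[OF s(1), of "r N"] 
  have "\<forall>i<Suc N. dig (s + r N * 6 ^ N) i = r i"
    using d(2,3) s(2) Suc.prems[of N] by (simp add: less_Suc_eq)
  then show ?case using d(1) Suc.prems[of N] by blast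
qed simp

lemma dig_inj:
  assumes "s < 6 ^ N" "s' < 6 ^ N" "\<And>i. i < N \<Longrightarrow> dig s i = dig s' i"
  shows "s = s'"
  using assms
proof (induction N arbitrary: s s')
  case (Suc N)
  have split: "u = u mod 6 ^ N + dig u N * 6 ^ N" if "u < 6 ^ Suc N" for u
  proof -
    have "u div 6 ^ N < 6" using that by (simp add: div_less_iff_less_mult)
    then have "dig u N = u div 6 ^ N" unfolding dig_def by (rule mod_less)
    then show ?thesis using mod_div_mult_eq[of u "6 ^ N"] by simp
  qed
  have low: "dig (u mod 6 ^ N) i = dig u i" if "u < 6 ^ Suc N" "i < N" for u i
    using dig_append(2)[of "u mod 6 ^ N" N "dig u N" i] split[OF that(1)] that(2) by (simp add: dig_less)
  have "s mod 6 ^ N = s' mod 6 ^ N"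
  proof (rule Suc.IH)
    fix i assume i: "i < N"
    have "dig s i = dig s' i" by (rule Suc.prems(3)) (use i in simp)
    then show "dig (s mod 6 ^ N) i = dig (s' mod 6 ^ N) i"
      by (simp only: low[OF Suc.prems(1) i] low[OF Suc.prems(2) i])
  qed simp_all
  moreover have "dig s N = dig s' N" by (rule Suc.prems(3)) simp
  ultimately show ?case using split[OF Suc.prems(1)] split[OF Suc.prems(2)] by metis
qed simp

lemma measure_count:
  assumes dep: "\<And>r r'. Q r \<Longrightarrow> (\<And>i. i < N \<Longrightarrow> r i = r' i) \<Longrightarrow> Q r'"
  shows "{r. Q r} \<in> sets (unifq 6)"
    and "measure (unifq 6) {r. Q r} = real (card {s. s < 6 ^ N \<and> Q (dig s)}) / 6 ^ N"
proof -
  interpret U: prob_space "unifq 6" by (rule prob_space_unifq)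
  let ?A = "{s. s < 6 ^ N \<and> Q (dig s)}"
  have eq: "{r. Q r} = (\<Union>\<tau>\<in>{\<tau>. length \<tau> = N \<and> Q (ext \<tau>)}. Cyl N (ext \<tau>))"
  proof (intro equalityI subsetI)
    fix r assume "r \<in> {r. Q r}"
    then have r: "Q r" by simp
    have "Q (ext (map r [0..<N]))" by (rule dep[OF r]) (simp add: ext_map)
    then show "r \<in> (\<Union>\<tau>\<in>{\<tau>. length \<tau> = N \<and> Q (ext \<tau>)}. Cyl N (ext \<tau>))"
      by (intro UN_I[of "map r [0..<N]"]) (simp_all add: Cyl_def ext_map)
  next
    fix r assume "r \<in> (\<Union>\<tau>\<in>{\<tau>. length \<tau> = N \<and> Q (ext \<tau>)}. Cyl N (ext \<tau>))"
    then obtain \<tau> where "Q (ext \<tau>)" "r \<in> Cyl N (ext \<tau>)" by blast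
    then have "Q r" using dep[of "ext \<tau>" r] by (simp add: Cyl_def)
    then show "r \<in> {r. Q r}" by simp
  qed
  show s: "{r. Q r} \<in> sets (unifq 6)"
    unfolding eq by (rule sets.countable_UN''[OF countableI_type]) (rule Cyl_sets)
  have fin: "finite ?A" by (rule finite_subset[of _ "{..<6 ^ N}"]) auto
  have "measure (unifq 6) {r. Q r} = measure (unifq 6) (\<Union>s\<in>?A. Cyl N (dig s))"
  proof (rule U.finite_measure_eq_AE)
    \<comment> \<open>Equality holds only almost everywhere, because digit strings do not cover dice
      with values of 6 or more.\<close>
    show "AE r in unifq 6. r \<in> {r. Q r} \<longleftrightarrow> r \<in> (\<Union>s\<in>?A. Cyl N (dig s))"
      using AE_unifq[of 6, simplified]
    proof eventually_elim
      case (elim r)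
      obtain s where s: "s < 6 ^ N" "\<forall>i<N. dig s i = r i" using dig_surj[of N r] elim by blast
      show ?case
      proof
        assume "r \<in> {r. Q r}"
        then have r: "Q r" by simp
        have "Q (dig s)" by (rule dep[OF r]) (use s(2) in simp)
        then show "r \<in> (\<Union>s\<in>?A. Cyl N (dig s))" using s by (intro UN_I[of s]) (simp_all add: Cyl_def)
      next
        assume "r \<in> (\<Union>s\<in>?A. Cyl N (dig s))"
        then obtain s where "Q (dig s)" "r \<in> Cyl N (dig s)" by blast
        then have "Q r" using dep[of "dig s" r] by (simp add: Cyl_def)
        then show "r \<in> {r. Q r}" by simp
      qed
    qed
    show "(\<Union>s\<in>?A. Cyl N (dig s)) \<in> sets (unifq 6)" using fin by (intro sets.finite_UN Cyl_sets)
  qed (rule s)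
  also have "\<dots> = (\<Sum>s\<in>?A. measure (unifq 6) (Cyl N (dig s)))"
  proof (rule U.finite_measure_finite_Union[OF fin])
    show "(\<lambda>s. Cyl N (dig s)) ` ?A \<subseteq> sets (unifq 6)" by (rule image_subsetI) (rule Cyl_sets)
    show "disjoint_family_on (\<lambda>s. Cyl N (dig s)) ?A"
      unfolding disjoint_family_on_def
    proof (intro ballI impI)
      fix s s' assume ss: "s \<in> ?A" "s' \<in> ?A" "s \<noteq> s'"
      show "Cyl N (dig s) \<inter> Cyl N (dig s') = {}"
      proof (rule ccontr)
        assume "Cyl N (dig s) \<inter> Cyl N (dig s') \<noteq> {}"
        then obtain r where r: "r \<in> Cyl N (dig s)" "r \<in> Cyl N (dig s')" by blast
        have "dig s i = dig s' i" if "i < N" for i using r that unfolding Cyl_def by simp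
        then show False using dig_inj[of s N s'] ss by blast
      qed
    qed
  qed
  also have "\<dots> = (\<Sum>s\<in>?A. 1 / 6 ^ N)"
  proof (rule sum.cong[OF refl])
    fix s
    have cb: "Cyl N (dig s) = {y. \<forall>i\<in>{..<N}. y i \<in> {dig s i}}" by (simp add: Cyl_def Ball_def)
    have "measure (unifq 6) (Cyl N (dig s)) = (\<Prod>i<N. real (card ({dig s i} \<inter> {0..<6})) / real 6)"
      unfolding cb by (rule measure_box[where B = "\<lambda>i. {dig s i}"]) simp_all
    also have "\<dots> = (\<Prod>i<N. 1 / 6)"
    proof (rule prod.cong[OF refl])
      fix i
      have "{dig s i} \<inter> {0..<6} = {dig s i}" using dig_less[of s i] by auto
      then show "real (card ({dig s i} \<inter> {0..<6})) / real 6 = 1 / 6" by simp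
    qed
    finally show "measure (unifq 6) (Cyl N (dig s)) = 1 / 6 ^ N" by (simp add: power_divide)
  qed
  finally show "measure (unifq 6) {r. Q r} = real (card ?A) / 6 ^ N" by simp
qed

subsection \<open>The conditional measure of a test is computable from below\<close>

lemma comp_dig: "comp n s \<Longrightarrow> comp n i \<Longrightarrow> comp n (\<lambda>xs. dig (s xs) (i xs))"
  unfolding dig_def by (intro comp_intros)

lemma released_bounded:
  "released S r h \<longleftrightarrow> (\<exists>j<h. 2 \<le> h div 2 ^ Suc j \<and> h div 2 ^ Suc j \<notin> S \<and> r (h div 2 ^ Suc j - 2) < 4)"
  unfolding released_def using two_le_div_imp Suc_lessD by blast

lemma dec_released:
  assumes "comp n S" "comp n s" "comp n h"
  shows "dec n (\<lambda>xs. released (set_decode (S xs)) (dig (s xs)) (h xs))"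
  unfolding released_bounded by (intro comp_dig comp_intros assms)

lemma comp_relabel:
  assumes "comp n S" "comp n s" "comp n i"
  shows "comp n (\<lambda>xs. relabel (set_decode (S xs)) (dig (s xs)) (i xs))"
  unfolding relabel_def by (intro dec_released comp_dig comp_intros assms)

text \<open>A decidable substitute for computing \<open>Tset\<close>: the recursion over levels is
  replaced by a bounded search for the finite set satisfying these conditions, which is unique below
  2H + 2.\<close>

definition is_code_upto :: "nat \<Rightarrow> (nat \<Rightarrow> nat) \<Rightarrow> nat set \<Rightarrow> bool" where
  "is_code_upto H z S \<longleftrightarrow> 0 \<notin> S \<and> Suc 0 \<in> S \<and>
     (\<forall>h<Suc H. 0 < h \<longrightarrow> (2 * h \<in> S \<longleftrightarrow> h \<in> S \<and> z (rank S h) \<noteq> 1) \<and>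
            (Suc (2 * h) \<in> S \<longleftrightarrow> h \<in> S \<and> z (rank S h) \<noteq> 0))"

lemma is_code_upto_unique:
  assumes "is_code_upto H z S" "is_code_upto H z T"
  shows "S \<inter> {..2 * H + 1} = T \<inter> {..2 * H + 1}"
proof -
  have "h \<in> S \<longleftrightarrow> h \<in> T" if "h \<le> 2 * H + 1" for h
    using that
  proof (induction h rule: less_induct)
    case (less h)
    show ?case
    proof (cases "h \<le> 1")
      case True
      then show ?thesis using assms by (cases h) (auto simp: is_code_upto_def)
    next
      case False
      define p where "p = h div 2"
      have p: "0 < p" "p < h" "p < Suc H" using False less.prems by (auto simp: p_def)
      have "S \<inter> {..<p} = T \<inter> {..<p}" using less.IH less.prems p(2) by auto
      then have r: "rank S p = rank T p" by simp
      have pST: "p \<in> S \<longleftrightarrow> p \<in> T" using less.IH less.prems p(2) by simp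
      have "h = 2 * p \<or> h = Suc (2 * p)" unfolding p_def by presburger
      moreover have "2 * p \<in> S \<longleftrightarrow> 2 * p \<in> T" "Suc (2 * p) \<in> S \<longleftrightarrow> Suc (2 * p) \<in> T"
        using assms p(1,3) r pST unfolding is_code_upto_def by simp_all
      ultimately show ?thesis by blast
    qed
  qed
  then show ?thesis by blast
qed

lemma is_code_upto_trunc:
  assumes "is_code z S"
  shows "is_code_upto H z (S \<inter> {..2 * H + 1})"
proof -
  have r: "rank (S \<inter> {..2 * H + 1}) h = rank S h" if "h < Suc H" for h
  proof -
    have "S \<inter> {..2 * H + 1} \<inter> {..<h} = S \<inter> {..<h}" using that by auto
    then show ?thesis by simp
  qed
  have "0 \<notin> S" "Suc 0 \<in> S" using assms by (auto simp: is_code_def)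
  moreover have "(2 * h \<in> S \<longleftrightarrow> h \<in> S \<and> z (rank S h) \<noteq> 1) \<and> (Suc (2 * h) \<in> S \<longleftrightarrow> h \<in> S \<and> z (rank S h) \<noteq> 0)"
    if "0 < h" for h using assms that unfolding is_code_def by blast
  ultimately show ?thesis unfolding is_code_upto_def by (simp add: r[unfolded Suc_eq_plus1[symmetric]])
qed

lemma dec_is_code_upto:
  assumes "comp n H" "comp n t" "comp n S"
  shows "dec n (\<lambda>xs. is_code_upto (H xs) (lnth (t xs)) (set_decode (S xs)))"
  unfolding is_code_upto_def sum_of_bool[symmetric] by (intro comp_intros assms)

lemma set_encode_less: "A \<subseteq> {..<N} \<Longrightarrow> set_encode A < 2 ^ N"
proof -
  assume A: "A \<subseteq> {..<N}"
  have "set_encode A \<le> (\<Sum>i<N. 2 ^ i)" unfolding set_encode_def by (rule sum_mono2) (use A in auto)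
  also have "\<dots> < (2::nat) ^ N" by (induction N) auto
  finally show ?thesis .
qed

text \<open>Here q codes a finite list of string codes, t a beginning of z, and s the dice.\<close>

definition hit :: "nat \<Rightarrow> nat \<Rightarrow> nat \<Rightarrow> bool" where
  "hit t q s \<longleftrightarrow> (\<exists>l<llen q. relabel (Tset (lnth t)) (dig s) \<in> cyl (list_decode (lnth q l)))"

lemma lnth_less: "l < llen q \<Longrightarrow> lnth q l < q"
  using list_encode_member[of "lnth q l" "list_decode q"] by (simp add: lnth_eq llen_def)

text \<open>An entry of the list is smaller than q and a string is no longer than its code. So q <=
  \<open>llen t\<close> ensures that t determines all labels in question. The bound on S covers all
  subsets of {..2H + 1} for H = \<open>llen t\<close>.\<close>

lemma hit_iff:
  assumes "q \<le> llen t"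
  shows "hit t q s \<longleftrightarrow> (\<exists>S<2 ^ (2 * llen t + 2). is_code_upto (llen t) (lnth t) (set_decode S) \<and>
    (\<exists>l<llen q. \<forall>p<llen (lnth q l). relabel (set_decode S) (dig s) p = lnth (lnth q l) p))"
proof -
  let ?H = "llen t" and ?T = "Tset (lnth t)"
  have eq: "relabel S (dig s) \<in> cyl (list_decode (lnth q l)) \<longleftrightarrow>
      (\<forall>p<llen (lnth q l). relabel S (dig s) p = lnth (lnth q l) p)" for S l
    by (simp add: cyl_def lnth_eq flip: llen_def)
  have cong: "relabel S (dig s) p = relabel ?T (dig s) p"
    if S: "is_code_upto ?H (lnth t) S" and p: "l < llen q" "p < llen (lnth q l)" for S l p
  proof (rule relabel_cong)
    have "p < ?H" using p lnth_less[of l q] llen_le[of "lnth q l"] assms by linarith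
    then have "{..2 * ?H + 1} \<inter> {..p + 2} = {..p + 2}" by auto
    moreover have "S \<inter> {..2 * ?H + 1} = ?T \<inter> {..2 * ?H + 1} \<inter> {..2 * ?H + 1}"
      by (rule is_code_upto_unique[OF S is_code_upto_trunc[OF is_code_Tset]])
    then have "S \<inter> {..2 * ?H + 1} \<inter> {..p + 2} = ?T \<inter> {..2 * ?H + 1} \<inter> {..p + 2}" by blast
    ultimately show "S \<inter> {..p + 2} = ?T \<inter> {..p + 2}" by (simp only: Int_assoc)
  qed simp
  show ?thesis
  proof
    assume "hit t q s"
    then obtain l where l: "l < llen q" "\<forall>p<llen (lnth q l). relabel ?T (dig s) p = lnth (lnth q l) p"
      unfolding hit_def eq by blast
    let ?S = "?T \<inter> {..2 * ?H + 1}"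
    have S: "is_code_upto ?H (lnth t) ?S" by (rule is_code_upto_trunc[OF is_code_Tset])
    have dec: "set_decode (set_encode ?S) = ?S" by (rule set_encode_inverse) simp
    have "set_encode ?S < 2 ^ (2 * ?H + 2)" by (rule set_encode_less) auto
    moreover have "\<forall>p<llen (lnth q l). relabel ?S (dig s) p = lnth (lnth q l) p"
      using cong[OF S l(1)] l(2) by simp
    ultimately show "\<exists>S<2 ^ (2 * ?H + 2). is_code_upto ?H (lnth t) (set_decode S) \<and>
      (\<exists>l<llen q. \<forall>p<llen (lnth q l). relabel (set_decode S) (dig s) p = lnth (lnth q l) p)"
      using S l(1) dec by metis
  next
    assume "\<exists>S<2 ^ (2 * ?H + 2). is_code_upto ?H (lnth t) (set_decode S) \<and>
      (\<exists>l<llen q. \<forall>p<llen (lnth q l). relabel (set_decode S) (dig s) p = lnth (lnth q l) p)"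
    then obtain S l where S: "is_code_upto ?H (lnth t) (set_decode S)" "l < llen q"
      "\<forall>p<llen (lnth q l). relabel (set_decode S) (dig s) p = lnth (lnth q l) p" by blast
    then show "hit t q s" unfolding hit_def eq using cong[OF S(1,2)] by auto
  qed
qed

lemma hit_dep:
  assumes "q \<le> llen t" "\<And>i. i < llen t \<Longrightarrow> y i = lnth t i" "\<And>i. i < 2 * llen t \<Longrightarrow> r i = r' i"
    "l < llen q" "relabel (Tset y) r \<in> cyl (list_decode (lnth q l))"
  shows "relabel (Tset (lnth t)) r' \<in> cyl (list_decode (lnth q l))"
proof -
  have "Tset y \<inter> {..2 * llen t + 1} = Tset (lnth t) \<inter> {..2 * llen t + 1}"
    by (rule Tset_cong) (rule assms(2))
  moreover have "relabel (Tset y) r p = relabel (Tset (lnth t)) r' p" if "p < llen (lnth q l)" for p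
  proof (rule relabel_cong)
    have p: "p < llen t" using that lnth_less[OF assms(4)] llen_le[of "lnth q l"] assms(1) by linarith
    then have "{..2 * llen t + 1} \<inter> {..p + 2} = {..p + 2}" by auto
    moreover have "Tset y \<inter> {..2 * llen t + 1} \<inter> {..p + 2} = Tset (lnth t) \<inter> {..2 * llen t + 1} \<inter> {..p + 2}"
      by (simp only: \<open>Tset y \<inter> {..2 * llen t + 1} = Tset (lnth t) \<inter> {..2 * llen t + 1}\<close>)
    ultimately show "Tset y \<inter> {..p + 2} = Tset (lnth t) \<inter> {..p + 2}" by (simp only: Int_assoc)
    show "r k = r' k" if "k \<le> p" for k using assms(3)[of k] that p by simp
  qed
  ultimately show ?thesis using assms(5) unfolding cyl_def llen_def[symmetric] by simp
qed

text \<open>The condition that the proportion of hits exceeds 2^-e, cleared of denominators.\<close>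

lemma dec_hit_count:
  assumes "comp n e" "comp n t"
  shows "dec n (\<lambda>xs. (6::nat) ^ (2 * llen (t xs)) <
    2 ^ e xs * (\<Sum>s<6 ^ (2 * llen (t xs)). of_bool (hit (t xs) (pfst (llen (t xs))) s)))"
proof -
  have "hit t (pfst (llen t)) s \<longleftrightarrow> (\<exists>S<2 ^ (2 * llen t + 2). is_code_upto (llen t) (lnth t) (set_decode S) \<and>
    (\<exists>l<llen (pfst (llen t)). \<forall>p<llen (lnth (pfst (llen t)) l).
       relabel (set_decode S) (dig s) p = lnth (lnth (pfst (llen t)) l) p))" for t s
    by (rule hit_iff) (rule pfst_le)
  then show ?thesis
    by (simp only:) (intro dec_is_code_upto comp_relabel comp_intros assms)
qed

lemma measure_hit:
  assumes q: "q \<le> llen t" and y: "\<And>i. i < llen t \<Longrightarrow> y i = lnth t i"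
  shows "{r. \<exists>l<llen q. relabel (Tset y) r \<in> cyl (list_decode (lnth q l))} \<in> sets (unifq 6)"
    and "measure (unifq 6) {r. \<exists>l<llen q. relabel (Tset y) r \<in> cyl (list_decode (lnth q l))} =
      real (\<Sum>s<6 ^ (2 * llen t). of_bool (hit t q s)) / 6 ^ (2 * llen t)"
proof -
  let ?N = "2 * llen t"
  let ?Q = "\<lambda>r. \<exists>l<llen q. relabel (Tset (lnth t)) r \<in> cyl (list_decode (lnth q l))"
  have eq: "(\<exists>l<llen q. relabel (Tset y) r \<in> cyl (list_decode (lnth q l))) \<longleftrightarrow> ?Q r" for r
  proof
    assume "\<exists>l<llen q. relabel (Tset y) r \<in> cyl (list_decode (lnth q l))"
    then obtain l where l: "l < llen q" "relabel (Tset y) r \<in> cyl (list_decode (lnth q l))" by blast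
    have "relabel (Tset (lnth t)) r \<in> cyl (list_decode (lnth q l))"
      by (rule hit_dep[OF q _ _ l]) (simp_all add: y)
    then show "?Q r" using l(1) by blast
  next
    assume "?Q r"
    then obtain l where l: "l < llen q" "relabel (Tset (lnth t)) r \<in> cyl (list_decode (lnth q l))" by blast
    \<comment> \<open>\<open>hit_dep\<close> passes from a sequence to the string that begins it.
      For the converse, the roles are exchanged: y is turned into a string of the same
      length.\<close>
    define t' where "t' = list_encode (map y [0..<llen t])"
    have t': "llen t' = llen t" "\<And>i. i < llen t \<Longrightarrow> lnth t' i = y i"
      using cyl_lnth[of y t'] in_cyl_map[of y "llen t"] by (simp_all add: t'_def llen_def)
    have "relabel (Tset (lnth t')) r \<in> cyl (list_decode (lnth q l))"
      by (rule hit_dep[of _ _ "lnth t" r, OF _ _ _ l]) (simp_all add: q y t')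
    then have "relabel (Tset y) r \<in> cyl (list_decode (lnth q l))"
    proof -
      have T: "Tset (lnth t') \<inter> {..2 * llen t + 1} = Tset y \<inter> {..2 * llen t + 1}"
        by (rule Tset_cong) (rule t'(2))
      have "relabel (Tset (lnth t')) r p = relabel (Tset y) r p" if "p < llen (lnth q l)" for p
      proof (rule relabel_cong)
        have p: "p < llen t" using that lnth_less[OF l(1)] llen_le[of "lnth q l"] q by linarith
        then have "{..2 * llen t + 1} \<inter> {..p + 2} = {..p + 2}" by auto
        moreover have "Tset (lnth t') \<inter> {..2 * llen t + 1} \<inter> {..p + 2} = Tset y \<inter> {..2 * llen t + 1} \<inter> {..p + 2}"
          by (simp only: T)
        ultimately show "Tset (lnth t') \<inter> {..p + 2} = Tset y \<inter> {..p + 2}" by (simp only: Int_assoc)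
      qed simp
      then show ?thesis using \<open>relabel (Tset (lnth t')) r \<in> cyl (list_decode (lnth q l))\<close>
        unfolding cyl_def llen_def[symmetric] by simp
    qed
    then show "\<exists>l<llen q. relabel (Tset y) r \<in> cyl (list_decode (lnth q l))" using l(1) by blast
  qed
  have dep: "?Q r'" if Qr: "?Q r" and rr: "\<And>i. i < ?N \<Longrightarrow> r i = r' i" for r r'
  proof -
    obtain l where l: "l < llen q" "relabel (Tset (lnth t)) r \<in> cyl (list_decode (lnth q l))" using Qr by blast
    have "relabel (Tset (lnth t)) r' \<in> cyl (list_decode (lnth q l))"
      by (rule hit_dep[OF q _ _ l]) (simp_all add: rr)
    then show ?thesis using l(1) by blast
  qed
  show "{r. \<exists>l<llen q. relabel (Tset y) r \<in> cyl (list_decode (lnth q l))} \<in> sets (unifq 6)"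
    unfolding eq by (rule measure_count(1)[OF dep])
  have "measure (unifq 6) {r. ?Q r} = real (card {s. s < 6 ^ ?N \<and> ?Q (dig s)}) / 6 ^ ?N"
    by (rule measure_count(2)[OF dep])
  also have "{s. s < 6 ^ ?N \<and> ?Q (dig s)} = {..<6 ^ ?N} \<inter> {s. hit t q s}" by (auto simp: hit_def)
  also have "card \<dots> = (\<Sum>s<6 ^ ?N. of_bool (hit t q s))" by (simp add: of_bool_def sum.If_cases)
  finally show "measure (unifq 6) {r. \<exists>l<llen q. relabel (Tset y) r \<in> cyl (list_decode (lnth q l))} =
      real (\<Sum>s<6 ^ ?N. of_bool (hit t q s)) / 6 ^ ?N" unfolding eq .
qed

section \<open>Sections of a test over a fixed code, and Markov's inequality\<close>

definition section_mass :: "(nat \<Rightarrow> nat) set \<Rightarrow> (nat \<Rightarrow> nat) \<Rightarrow> ennreal" where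
  "section_mass V z = emeasure (unifq 6) {r. relabel (Tset z) r \<in> V}"

lemma section_sets:
  assumes "V \<in> sets lambda3"
  shows "{r. relabel (Tset z) r \<in> V} \<in> sets (unifq 6)"
  using sets_Pair1[OF relabel_Tset_sets[OF assms], of z] by (simp add: vimage_def)

text \<open>The average section mass is at most 4/3 times the measure of V. Markov's inequality at
  threshold 2^-e loses the factor 2^e, so the exponent 2e leaves 2^-e, and the additional 1 absorbs
  the factor 4/3.\<close>

lemma emeasure_section_mass:
  assumes V: "V \<in> sets lambda3" and le: "emeasure lambda3 V \<le> ennreal ((1 / 2) ^ (2 * e + 1))"
    and A: "\<And>z. z \<in> A \<Longrightarrow> ennreal ((1 / 2) ^ e) \<le> section_mass V z"
  shows "emeasure lambda3 A \<le> ennreal ((1 / 2) ^ e)"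
proof -
  interpret U: prob_space "unifq 6" by (rule prob_space_unifq)
  interpret Z: prob_space zr by (rule prob_space_zr)
  let ?X = "{(z, r). relabel (Tset z) r \<in> V}"
  have X: "?X \<in> sets zr" by (rule relabel_Tset_sets[OF V])
  have Pair: "Pair z -` ?X = {r. relabel (Tset z) r \<in> V}" for z by auto
  have meas: "section_mass V \<in> borel_measurable (unifq 3)"
    using U.measurable_emeasure_Pair[OF X] unfolding Pair section_mass_def[abs_def] by simp
  have int: "(\<integral>\<^sup>+z. section_mass V z \<partial>unifq 3) = emeasure zr ?X"
    unfolding U.emeasure_pair_measure_alt[OF X] Pair section_mass_def by simp
  let ?B = "{z \<in> space (unifq 3). 1 \<le> ennreal (2 ^ e) * section_mass V z}"
  have AB: "A \<subseteq> ?B"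
  proof
    fix z assume "z \<in> A"
    then have "ennreal (2 ^ e) * ennreal ((1 / 2) ^ e) \<le> ennreal (2 ^ e) * section_mass V z"
      by (intro mult_left_mono A) auto
    moreover have "ennreal (2 ^ e) * ennreal ((1 / 2) ^ e) = 1"
    proof -
      have "ennreal (2 ^ e) * ennreal ((1 / 2) ^ e) = ennreal (2 ^ e * (1 / 2) ^ e)"
        by (rule ennreal_mult[symmetric]) simp_all
      also have "(2::real) ^ e * (1 / 2) ^ e = 1" by (simp add: power_divide)
      finally show ?thesis by simp
    qed
    ultimately show "z \<in> ?B" by simp
  qed
  have B: "?B \<in> sets (unifq 3)" using meas by measurable
  have mass: "measure zr ?X \<le> 4 / 3 * (1 / 2) ^ (2 * e + 1)"
  proof -
    have "ennreal (3 / 4) * emeasure zr ?X \<le> emeasure lambda3 V"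
      unfolding emeasure_lambda3_mix[OF V] by simp
    also have "\<dots> \<le> ennreal ((1 / 2) ^ (2 * e + 1))" by (rule le)
    finally have "ennreal (3 / 4 * measure zr ?X) \<le> ennreal ((1 / 2) ^ (2 * e + 1))"
      unfolding Z.emeasure_eq_measure by (subst ennreal_mult) simp_all
    then have "3 / 4 * measure zr ?X \<le> (1 / 2) ^ (2 * e + 1)"
      by (subst (asm) ennreal_le_iff) simp_all
    then show ?thesis by simp
  qed
  have "emeasure lambda3 A \<le> emeasure (unifq 3) ?B"
    unfolding lambda3_unifq by (rule emeasure_mono[OF AB B])
  also have "\<dots> \<le> ennreal (2 ^ e) * (\<integral>\<^sup>+z. section_mass V z \<partial>unifq 3)"
    using nn_integral_Markov_inequality[of "section_mass V" "space (unifq 3)" "unifq 3" "ennreal (2 ^ e)"] meas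
      sets.top[of "unifq 3"] by simp
  also have "\<dots> = ennreal (2 ^ e * measure zr ?X)"
    unfolding int Z.emeasure_eq_measure by (rule ennreal_mult[symmetric]) simp_all
  also have "\<dots> \<le> ennreal ((1 / 2) ^ e)"
  proof (rule ennreal_leI)
    have "2 ^ e * measure zr ?X \<le> 2 ^ e * (4 / 3 * (1 / 2) ^ (2 * e + 1))"
      by (rule mult_left_mono[OF mass]) simp
    also have "(2::real) ^ e * (4 / 3 * (1 / 2) ^ (2 * e + 1)) = 2 / 3 * (1 / 2) ^ e"
    proof -
      have "(2::real) ^ e * (1 / 2) ^ e = 1" by (simp add: power_divide)
      moreover have "(1 / 2 :: real) ^ (2 * e + 1) = (1 / 2) ^ e * (1 / 2) ^ e / 2"
        by (simp add: mult_2 power_add)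
      ultimately show ?thesis by (simp add: field_simps)
    qed
    also have "\<dots> \<le> (1 / 2) ^ e" by simp
    finally show "2 ^ e * measure zr ?X \<le> (1 / 2) ^ e" .
  qed
  finally show ?thesis .
qed

text \<open>A random z is only known to escape some level of a test. Shifting the levels by k turns
  this into small sections for arbitrarily large e, which is enough to make the section of the
  intersection null.\<close>

lemma section_mass_small:
  assumes z: "mlof_random3 z" and W: "ce_set W"
    and test: "\<And>i. emeasure lambda3 (string_union W i) \<le> ennreal ((1 / 2) ^ i)"
  shows "\<exists>e\<ge>k. section_mass (string_union W (2 * e + 1)) z \<le> ennreal ((1 / 2) ^ e)"
proof (rule ccontr)
  assume neg: "\<not> ?thesis"
  interpret U: prob_space "unifq 6" by (rule prob_space_unifq)
  have z3: "z i < 3" for i using z by (simp add: mlof_random3_def)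
  let ?V = "\<lambda>e. string_union W (2 * e + 1)"
  have V: "?V e \<in> sets lambda3" for e unfolding lambda3_unifq by (rule string_union_sets)
  define E where "E = (\<lambda>n. pfst n + k)"
  txt \<open>Again the length of the string encodes the witness, here a finite list of codes of strings in W.\<close>
  define q where "q = (\<lambda>n. pfst (llen (psnd n)))"
  define D where "D = (\<lambda>n. (6::nat) ^ (2 * llen (psnd n)) <
    2 ^ E n * (\<Sum>s<6 ^ (2 * llen (psnd n)). of_bool (hit (psnd n) (pfst (llen (psnd n))) s)))"
  define W' where "W' = {n. D n \<and> (\<forall>l<llen (q n). prod_encode (2 * E n + 1, lnth (q n) l) \<in> W)}"
  have "dec (Suc 0) (\<lambda>xs. D (hd xs))" unfolding D_def E_def by (intro dec_hit_count comp_intros)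
  moreover have "comp (Suc 0) (\<lambda>xs. llen (q (hd xs)))" unfolding q_def by (intro comp_intros)
  moreover have "comp (Suc (Suc 0)) (\<lambda>xs. prod_encode (2 * E (hd (tl xs)) + 1, lnth (q (hd (tl xs))) (hd xs)))"
    unfolding q_def E_def by (intro comp_intros)
  ultimately have ce: "ce_set W'"
    unfolding W'_def
    by (intro ce_set_bounded_all[where g = "\<lambda>l n. prod_encode (2 * E n + 1, lnth (q n) l)"
          and len = "\<lambda>n. llen (q n)", OF W]) (simp_all only: One_nat_def numeral_2_eq_2)
  have small: "emeasure lambda3 (string_union W' i) \<le> ennreal ((1 / 2) ^ i)" for i
  proof -
    let ?e = "i + k"
    have "emeasure lambda3 (string_union W' i) \<le> ennreal ((1 / 2) ^ ?e)"
    proof (rule emeasure_section_mass[OF V test])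
      fix y assume "y \<in> string_union W' i"
      then obtain t where t: "prod_encode (i, t) \<in> W'" "y \<in> cyl (list_decode t)" unfolding in_string_union by blast
      let ?q = "pfst (llen t)" and ?N = "2 * llen t"
      let ?C = "\<Sum>s<6 ^ ?N. of_bool (hit t ?q s) :: nat"
      have c: "6 ^ ?N < 2 ^ ?e * ?C" "\<forall>l<llen ?q. prod_encode (2 * ?e + 1, lnth ?q l) \<in> W"
        using t(1) unfolding W'_def D_def E_def q_def mem_Collect_eq prod_encode_inverse fst_conv snd_conv by blast+
      have agree: "y p = lnth t p" if "p < llen t" for p by (rule cyl_lnth[OF t(2) that])
      let ?R = "{r. \<exists>l<llen ?q. relabel (Tset y) r \<in> cyl (list_decode (lnth ?q l))}"
      have "(1 / 2) ^ ?e \<le> real ?C / 6 ^ ?N"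
      proof -
        have "real (6 ^ ?N) \<le> real (2 ^ ?e * ?C)" using c(1) by (intro of_nat_mono) simp
        then have "6 ^ ?N \<le> 2 ^ ?e * real ?C" by simp
        then show ?thesis by (simp add: field_simps)
      qed
      also have "\<dots> = measure (unifq 6) ?R" by (rule measure_hit(2)[OF pfst_le agree, symmetric])
      finally have "ennreal ((1 / 2) ^ ?e) \<le> emeasure (unifq 6) ?R"
        unfolding U.emeasure_eq_measure by (rule ennreal_leI)
      also have "\<dots> \<le> section_mass (?V ?e) y"
        unfolding section_mass_def
      proof (rule emeasure_mono[OF _ section_sets[OF V]], rule subsetI)
        fix r assume "r \<in> ?R"
        then obtain l where l: "l < llen ?q" "relabel (Tset y) r \<in> cyl (list_decode (lnth ?q l))" by blast
        have "set (list_decode (lnth ?q l)) \<subseteq> {0..<3}"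
        proof
          fix v assume "v \<in> set (list_decode (lnth ?q l))"
          then obtain p where "p < length (list_decode (lnth ?q l))" "v = list_decode (lnth ?q l) ! p"
            by (metis in_set_conv_nth)
          then have "v = relabel (Tset y) r p" using l(2) by (simp add: cyl_def)
          then show "v \<in> {0..<3}" using relabel_less[of "Tset y" r p] by simp
        qed
        then have "relabel (Tset y) r \<in> ?V ?e" unfolding in_string_union using c(2) l by blast
        then show "r \<in> {r. relabel (Tset y) r \<in> ?V ?e}" by simp
      qed
      finally show "ennreal ((1 / 2) ^ ?e) \<le> section_mass (?V ?e) y" .
    qed
    also have "\<dots> \<le> ennreal ((1 / 2) ^ i)" by (rule ennreal_leI) (rule power_decreasing, simp_all)
    finally show ?thesis .
  qed
  from mlof_random3_string_union[OF z ce small] obtain i where i: "z \<notin> string_union W' i" by blast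
  let ?e = "i + k"
  have big: "ennreal ((1 / 2) ^ ?e) < section_mass (?V ?e) z" using neg by (auto simp: not_le)
  let ?P = "\<lambda>c. set (list_decode c) \<subseteq> {0..<3} \<and> prod_encode (2 * ?e + 1, c) \<in> W"
  let ?R = "\<lambda>n. \<Union>c\<in>{c. c < n \<and> ?P c}. {r. relabel (Tset z) r \<in> cyl (list_decode c)}"
  have R_sets: "?R n \<in> sets (unifq 6)" for n
  proof (rule sets.finite_UN)
    show "finite {c. c < n \<and> ?P c}" by (rule finite_subset[of _ "{..<n}"]) auto
    show "{r. relabel (Tset z) r \<in> cyl (list_decode c)} \<in> sets (unifq 6)" for c
      by (rule section_sets) (simp add: lambda3_unifq cyl_sets)
  qed
  have union: "(\<Union>n. ?R n) = {r. relabel (Tset z) r \<in> ?V ?e}" (is "?l = ?r")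
  proof (intro equalityI subsetI)
    fix r assume "r \<in> ?l"
    then obtain c where "?P c" "relabel (Tset z) r \<in> cyl (list_decode c)" by blast
    then show "r \<in> ?r" unfolding in_string_union by blast
  next
    fix r assume "r \<in> ?r"
    then obtain c where c: "?P c" "relabel (Tset z) r \<in> cyl (list_decode c)" unfolding in_string_union by blast
    then have "r \<in> ?R (Suc c)" using lessI by blast
    then show "r \<in> ?l" by blast
  qed
  have R_range: "range ?R \<subseteq> sets (unifq 6)" by (rule image_subsetI) (rule R_sets)
  have inc: "incseq ?R" unfolding incseq_def by (intro allI impI UN_mono subset_refl) auto
  have "(SUP n. emeasure (unifq 6) (?R n)) = emeasure (unifq 6) (\<Union>n. ?R n)"
    by (rule SUP_emeasure_incseq[OF R_range inc])
  also have "\<dots> = section_mass (?V ?e) z" unfolding section_mass_def by (rule arg_cong[OF union])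
  finally have mass: "(SUP n. emeasure (unifq 6) (?R n)) = section_mass (?V ?e) z" .
  \<comment> \<open>Continuity from below: finitely many strings already exceed the threshold.
    Strictness of the inequality is what survives the passage to a finite stage.\<close>
  obtain n where n: "ennreal ((1 / 2) ^ ?e) < emeasure (unifq 6) (?R n)"
    using big unfolding mass[symmetric] less_SUP_iff by blast
  define q0 where "q0 = list_encode (filter ?P [0..<n])"
  \<comment> \<open>A length from which q0 can be read off. It is at least q0, as
    \<open>measure_hit\<close> requires.\<close>
  define H where "H = prod_encode (q0, 0)"
  define t where "t = list_encode (map z [0..<H])"
  have lt: "llen t = H" by (simp add: t_def llen_def)
  have qH: "pfst H = q0" by (simp add: H_def)
  have q_le: "q0 \<le> llen t" unfolding lt H_def by (rule le_prod_encode_1)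
  have agree: "z p = lnth t p" if "p < llen t" for p
    using cyl_lnth[of z t p] in_cyl_map[of z H] that by (simp add: t_def)
  have P: "?P (lnth q0 l)" if "l < llen q0" for l
  proof -
    have "lnth q0 l \<in> set (filter ?P [0..<n])"
      using that nth_mem[of l "filter ?P [0..<n]"] lnth_eq[of l q0] by (simp add: q0_def llen_def del: set_filter)
    then show ?thesis by simp
  qed
  let ?C = "\<Sum>s<6 ^ (2 * llen t). of_bool (hit t q0 s) :: nat"
  have "?R n \<subseteq> {r. \<exists>l<llen q0. relabel (Tset z) r \<in> cyl (list_decode (lnth q0 l))}"
  proof
    fix r assume "r \<in> ?R n"
    then obtain c where c: "c < n" "?P c" "relabel (Tset z) r \<in> cyl (list_decode c)" by blast
    then have "c \<in> set (list_decode q0)" by (simp add: q0_def)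
    then obtain l where l: "l < length (list_decode q0)" "list_decode q0 ! l = c"
      unfolding in_set_conv_nth by blast
    have lq: "l < llen q0" using l(1) by (simp only: llen_def)
    have "lnth q0 l = c" unfolding lnth_eq[OF lq] by (rule l(2))
    then have "l < llen q0 \<and> relabel (Tset z) r \<in> cyl (list_decode (lnth q0 l))" using c(3) lq by simp
    then show "r \<in> {r. \<exists>l<llen q0. relabel (Tset z) r \<in> cyl (list_decode (lnth q0 l))}" by blast
  qed
  then have "emeasure (unifq 6) (?R n) \<le> emeasure (unifq 6) {r. \<exists>l<llen q0. relabel (Tset z) r \<in> cyl (list_decode (lnth q0 l))}"
    by (rule emeasure_mono) (rule measure_hit(1)[OF q_le agree])
  then have "ennreal ((1 / 2) ^ ?e) < ennreal (measure (unifq 6) {r. \<exists>l<llen q0. relabel (Tset z) r \<in> cyl (list_decode (lnth q0 l))})"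
    unfolding U.emeasure_eq_measure[symmetric] by (rule less_le_trans[OF n])
  then have "(1 / 2) ^ ?e < measure (unifq 6) {r. \<exists>l<llen q0. relabel (Tset z) r \<in> cyl (list_decode (lnth q0 l))}"
    by (subst (asm) ennreal_less_iff) simp_all
  also have "\<dots> = real ?C / 6 ^ (2 * llen t)" by (rule measure_hit(2)[OF q_le agree])
  finally have "(1 / 2) ^ ?e < real ?C / 6 ^ (2 * llen t)" .
  then have "6 ^ (2 * llen t) < 2 ^ ?e * real ?C" by (simp add: field_simps)
  then have "real (6 ^ (2 * llen t)) < real (2 ^ ?e * ?C)" by simp
  then have C: "6 ^ (2 * llen t) < 2 ^ ?e * ?C" by (simp only: of_nat_less_iff)
  have "pfst (llen t) = q0" unfolding lt by (rule qH)
  then have "prod_encode (i, t) \<in> W'"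
    unfolding W'_def D_def E_def q_def mem_Collect_eq prod_encode_inverse fst_conv snd_conv
    using C P by (simp only:) blast
  then have "z \<in> string_union W' i" unfolding t_def by (intro string_unionI z3)
  then show False using i by blast
qed

text \<open>The intersection of a test lies in its levels 2e + 1, whose sections have mass at most
  2^-e for arbitrarily large e. So each test excludes a null set of dice, and a countable union of
  null sets is null.\<close>

lemma AE_relabel_random:
  assumes z: "mlof_random3 z"
  shows "AE r in unifq 6. mlof_random3 (relabel (Tset z) r)"
proof -
  interpret U: prob_space "unifq 6" by (rule prob_space_unifq)
  let ?T = "{W. ce_set W \<and> (\<forall>i. emeasure lambda3 (string_union W i) \<le> ennreal ((1 / 2) ^ i))}"
  have "countable ?T" by (rule countable_subset[OF _ countable_ce_sets]) auto
  moreover have "AE r in unifq 6. \<exists>i. relabel (Tset z) r \<notin> string_union W i" if W: "W \<in> ?T" for W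
  proof -
    let ?N = "\<Inter>i. {r. relabel (Tset z) r \<in> string_union W i}"
    have s: "{r. relabel (Tset z) r \<in> string_union W i} \<in> sets (unifq 6)" for i
      by (rule section_sets) (simp add: lambda3_unifq string_union_sets)
    then have N: "?N \<in> sets (unifq 6)" by (intro sets.countable_INT) auto
    have "measure (unifq 6) ?N \<le> (1 / 2) ^ k" for k
    proof -
      obtain e where e: "k \<le> e" "section_mass (string_union W (2 * e + 1)) z \<le> ennreal ((1 / 2) ^ e)"
        using section_mass_small[OF z, of W k] W by blast
      have "emeasure (unifq 6) ?N \<le> section_mass (string_union W (2 * e + 1)) z"
        unfolding section_mass_def by (intro emeasure_mono s) blast
      also note e(2)
      also have "ennreal ((1 / 2) ^ e) \<le> ennreal ((1 / 2) ^ k)"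
        by (intro ennreal_leI power_decreasing e(1)) simp_all
      finally show ?thesis unfolding U.emeasure_eq_measure by (subst (asm) ennreal_le_iff) simp_all
    qed
    moreover have "(\<lambda>k. (1 / 2 :: real) ^ k) \<longlonglongrightarrow> 0" by (rule LIMSEQ_power_zero) simp
    ultimately have "measure (unifq 6) ?N \<le> 0" by (intro LIMSEQ_le_const) auto
    then have "?N \<in> null_sets (unifq 6)"
      using N unfolding null_sets_def U.emeasure_eq_measure by (simp add: measure_le_0_iff)
    then show ?thesis by (rule AE_I') auto
  qed
  ultimately have "AE r in unifq 6. \<forall>W\<in>?T. \<exists>i. relabel (Tset z) r \<notin> string_union W i"
    by (subst AE_ball_countable) auto
  then show ?thesis
  proof eventually_elim
    case (elim r)
    show ?case unfolding mlof_random3_def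
    proof (intro conjI allI impI)
      fix U assume "mlof_test U"
      then obtain W where "ce_set W" "U = string_union W" "\<forall>i. emeasure lambda3 (U i) \<le> ennreal ((1 / 2) ^ i)"
        unfolding mlof_test_def unif_sigma01_iff by blast
      then show "relabel (Tset z) r \<notin> (\<Inter>i. U i)" using elim by blast
    qed (rule relabel_less)
  qed
qed

lemma AE_not_bad: "AE r in unifq 6. \<forall>n. \<exists>m\<ge>n. r \<notin> bad {4..} n m"
  unfolding AE_all_countable
proof
  fix n
  interpret U: prob_space "unifq 6" by (rule prob_space_unifq)
  let ?N = "\<Inter>K. bad {4..} n (n + 2 * K)"
  have N: "?N \<in> sets (unifq 6)" by (intro sets.countable_INT) (auto intro: bad_sets)
  have "measure (unifq 6) ?N \<le> 2 ^ n * (1 / 2) ^ K" for K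
  proof -
    have "measure (unifq 6) ?N \<le> measure (unifq 6) (bad {4..} n (n + 2 * K))"
      by (intro U.finite_measure_mono bad_sets) blast
    also have "{4..} \<inter> {0..<6::nat} = {4, 5}" by auto
    then have "measure (unifq 6) (bad {4..} n (n + 2 * K)) \<le> 2 ^ n * (1 / 2) ^ K"
      by (intro measure_bad_le) simp_all
    finally show ?thesis .
  qed
  then have bound: "\<exists>K0. \<forall>K\<ge>K0. measure (unifq 6) ?N \<le> 2 ^ n * (1 / 2) ^ K" by blast
  have "(\<lambda>K. 2 ^ n * (1 / 2 :: real) ^ K) \<longlonglongrightarrow> 2 ^ n * 0"
    by (intro tendsto_mult_left LIMSEQ_power_zero) simp
  then have "measure (unifq 6) ?N \<le> 2 ^ n * 0" by (rule LIMSEQ_le_const) (rule bound)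
  then have "?N \<in> null_sets (unifq 6)"
    using N unfolding null_sets_def U.emeasure_eq_measure by (simp add: measure_le_0_iff)
  then show "AE r in unifq 6. \<exists>m\<ge>n. r \<notin> bad {4..} n m"
  proof (rule AE_I')
    show "{r \<in> space (unifq 6). \<not> (\<exists>m\<ge>n. r \<notin> bad {4..} n m)} \<subseteq> ?N"
      using le_add1 by blast
  qed
qed

text \<open>A branch that leaves S at level n and stays alive shows only rolls of at least 4 from
  then on, so it would make r bad for every m >= n.\<close>

lemma alive_path_relabel:
  assumes S: "dendless S" and r: "\<And>n. \<exists>m\<ge>n. r \<notin> bad {4..} n m"
  shows "(\<forall>n. alive (relabel S r) (hidx (prefix y n))) \<longleftrightarrow> (\<forall>n. hidx (prefix y n) \<in> S)"
proof
  assume "\<forall>n. hidx (prefix y n) \<in> S"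
  then show "\<forall>n. alive (relabel S r) (hidx (prefix y n))" using alive_relabel[OF S] by blast
next
  assume alive: "\<forall>n. alive (relabel S r) (hidx (prefix y n))"
  show "\<forall>n. hidx (prefix y n) \<in> S"
  proof
    fix n
    show "hidx (prefix y n) \<in> S"
    proof (rule ccontr)
      assume out: "hidx (prefix y n) \<notin> S"
      obtain m where m: "n \<le> m" "r \<notin> bad {4..} n m" using r by blast
      let ?d = "hidx (prefix y m)"
      have "r (?d div 2 ^ i - 2) \<in> {4..}" if i: "i < m - n" for i
      proof -
        obtain k where k: "m = n + Suc k + i" using i less_imp_Suc_add[of i "m - n"] m(1)
          by (metis add.commute add.left_commute add_Suc_right le_add_diff_inverse)
        have d: "?d div 2 ^ i = hidx (prefix y (n + Suc k))" unfolding k by (rule hidx_prefix_div)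
        have "hidx (prefix y (n + Suc k)) div 2 ^ Suc k = hidx (prefix y n)" by (rule hidx_prefix_div)
        then have "?d div 2 ^ i \<notin> S"
          using dendless_div[OF S, of "hidx (prefix y (n + Suc k))" "Suc k"] out hidx_pos d by metis
        moreover have "2 \<le> ?d div 2 ^ i"
          unfolding d using hidx_pos[of "prefix y (n + k)"] by (simp add: prefix_Suc del: hidx_pos)
        moreover have "alive (relabel S r) (?d div 2 ^ i)" unfolding d using alive by blast
        ultimately show ?thesis using relabel_dying by simp
      qed
      moreover have "2 ^ m \<le> ?d" "?d < 2 ^ Suc m" using hidx_bounds[of "prefix y m"] by simp_all
      ultimately show False using m(2) unfolding bad_def by blast
    qed
  qed
qed

section \<open>Passing between zero sets and random closed sets\<close>

lemma zeros_random_closed: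
  assumes x: "mlof_random3 x" and ne: "zeros (Ffun x) \<noteq> {}"
  shows "random_closed (zeros (Ffun x))"
proof -
  have zeros: "zeros (Ffun x) = {y. \<forall>n. hidx (prefix y n) \<in> surv x}"
    unfolding zeros_random[OF x] alive_path_surv ..
  have "Suc 0 \<in> surv x"
  proof -
    obtain y where "\<forall>n. hidx (prefix y n) \<in> surv x" using ne unfolding zeros by blast
    then have "hidx (prefix y 0) \<in> surv x" by blast
    then show ?thesis by (simp add: prefix_def)
  qed
  then have z: "mlof_random3 (code_of (surv x))" "is_code (code_of (surv x)) (surv x)"
    using random_code_of_surv[OF x] is_code_code_of[OF surv_dendless] by blast+
  have "surv x = Tset (code_of (surv x))" by (rule is_code_unique[OF z(2) is_code_Tset])
  then have "zeros (Ffun x) = paths (tree (code_of (surv x)))" unfolding zeros paths_tree by metis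
  then show ?thesis using ne z(1) unfolding random_closed_def by blast
qed

lemma random_closed_zeros:
  assumes z: "mlof_random3 z"
  shows "\<exists>x. mlof_random3 x \<and> paths (tree z) = zeros (Ffun x)"
proof -
  interpret U: prob_space "unifq 6" by (rule prob_space_unifq)
  have "AE r in unifq 6. mlof_random3 (relabel (Tset z) r) \<and> (\<forall>n. \<exists>m\<ge>n. r \<notin> bad {4..} n m)"
    using AE_relabel_random[OF z] AE_not_bad by eventually_elim simp
  moreover have "ae_filter (unifq 6) \<noteq> bot" unfolding ae_filter_eq_bot_iff U.emeasure_space_1 by simp
  ultimately obtain r where r: "mlof_random3 (relabel (Tset z) r)" "\<And>n. \<exists>m\<ge>n. r \<notin> bad {4..} n m"
    using eventually_happens' by blast
  have "paths (tree z) = zeros (Ffun (relabel (Tset z) r))"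
    unfolding zeros_random[OF r(1)] paths_tree
      alive_path_relabel[OF is_code_dendless[OF is_code_Tset] r(2)] ..
  then show ?thesis using r(1) by blast
qed

theorem theorem4p4:
  shows "(\<forall>F. random_cont_fun F \<and> zeros F \<noteq> {} \<longrightarrow> random_closed (zeros F)) \<and>
         (\<forall>C. random_closed C \<longrightarrow> (\<exists>F. random_cont_fun F \<and> C = zeros F))"
  using zeros_random_closed random_closed_zeros
  unfolding random_cont_fun_def random_closed_def by metis

end
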